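(* Let $k\ge 1$ and let $M$ be $S^{k+2}$ or $\mathbb R^{k+2}$. Fix an unlinked embedding $\phi:\coprod_n S^k\hookrightarrow M$, and let $[\phi]\in\mathrm{Conf}_n(S^k,M)$ denote the corresponding configuration. Let $\mathcal D(M,[\phi])$ be the group of compactly supported $C^1$ diffeomorphisms $f$ of $M$ that are isotopic to the identity and satisfy $[f\circ\phi]=[\phi]$. If either (a) $M=\mathbb R^{k+2}$ and $n\ge 5$, or (b) $M=S^{k+2}$ and $n\ge 6$, then the spherical push map $\mathcal P:B_n(S^k,M)\to\pi_0(\mathcal D(M,[\phi]))$ is not realized by diffeomorphisms; that is, there is no group homomorphism $\sigma:B_n(S^k,M)\to\mathcal D(M,[\phi])$ whose composition with the quotient map $\mathcal D(M,[\phi])\to\pi_0(\mathcal D(M,[\phi]))$ equals $\mathcal P$.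
   Context: All diffeomorphisms are orientation-preserving and $C^1$; spaces of embeddings and diffeomorphisms carry the $C^1$ topology. An embedding $\phi:\coprod_nS^k\to M$ is unlinked if it extends to an embedding $\coprod_n\mathbb D^{k+1}\to M$ of $n$ disjoint $(k+1)$-disks. $\mathrm{Emb}_n(S^k,M)$ is the space of $C^1$ embeddings $\coprod_nS^k\to M$, and $\mathrm{Emb}_n(S^k,M;\phi)$ is the path component of $\phi$. The symmetric group $S_n$ acts by permuting the components of $\coprod_n S^k$ (precomposition), and $\mathrm{Conf}_n(S^k,M)=\mathrm{Emb}_n(S^k,M;\phi)/S_n$; $[\phi]$ is the class of $\phi$. The spherical motion group is $B_n(S^k,M)=\pi_1(\mathrm{Conf}_n(S^k,M),[\phi])$. Let $\mathcal D(M)$ be the group of compactly supported $C^1$ diffeomorphisms of $M$ isotopic to the identity. The elements $f$ of $\mathcal D(M,[\phi])\le\mathcal D(M)$ preserve the image of $\phi$ together with the parameterizations of the spheres, up to permutation of the spheres. The spherical push map $\mathcal P$ is the connecting homomorphism $\pi_1(\mathrm{Conf}_n(S^k,M),[\phi])\to\pi_0(\mathcal D(M,[\phi]))$ of the fibration $\mathcal D(M,[\phi])\to\mathcal D(M)\to\mathrm{Conf}_n(S^k,M)$, $f\mapsto[f\circ\phi]$: a loop $\gamma$ is lifted to a path $f_t$ in $\mathcal D(M)$ with $f_0=\mathrm{id}$ and $[f_t\circ\phi]=\gamma(t)$, and $\mathcal P([\gamma])=[f_1]$ (products in $\pi_1$ are ordered so that $\mathcal P$ is a homomorphism). *)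

theory Defs
  imports "HOL-Analysis.Analysis" "HOL-Algebra.Bij"
begin

section \<open>Maps of class C1 between subsets of Euclidean spaces\<close>

text \<open>
  All manifolds (spheres, closed disks, Euclidean space itself) are subsets of Euclidean
  spaces, and a map on such a subset is C1 if it extends to a C1 map on an open neighbourhood.
  Maps on a subset are kept extensional, so that equality of maps is equality of functions.
\<close>

definition C1_on :: "'a::euclidean_space set \<Rightarrow> ('a \<Rightarrow> 'b::euclidean_space) \<Rightarrow> bool" where
  "C1_on S f \<longleftrightarrow> (\<exists>U g (g' :: 'a \<Rightarrow> 'a \<Rightarrow>\<^sub>L 'b).
     open U \<and> S \<subseteq> U \<and> (\<forall>x\<in>S. g x = f x) \<and>
     (\<forall>x\<in>U. (g has_derivative blinfun_apply (g' x)) (at x)) \<and> continuous_on U g')"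

definition C1_maps :: "'a::euclidean_space set \<Rightarrow> 'b::euclidean_space set \<Rightarrow> ('a \<Rightarrow> 'b) set" where
  "C1_maps S M = {f \<in> S \<rightarrow>\<^sub>E M. C1_on S f}"

text \<open>
  The C1 topology. On a sphere the derivative within \<open>S\<close> is determined only on the tangent
  space; the existence of some derivative \<open>D\<close> of \<open>g - f\<close> within \<open>S\<close> with norm below
  \<open>\<epsilon> x\<close> says precisely that the tangential derivative of \<open>g - f\<close> has norm below
  \<open>\<epsilon> x\<close> (extend it by zero on the normal space).

  The tolerance \<open>\<epsilon>\<close> is a positive continuous function. For compact \<open>S\<close> this gives uniform
  convergence of maps and first derivatives; for noncompact \<open>S\<close> it is the strong (Whitney)
  topology, in which paths of compactly supported diffeomorphisms have a common compact
  support. (In the compact-open C1 topology supports could escape to infinity along a path.)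
\<close>

definition C1_nbhd ::
  "'a::euclidean_space set \<Rightarrow> 'b::euclidean_space set \<Rightarrow> ('a \<Rightarrow> 'b) \<Rightarrow> ('a \<Rightarrow> real) \<Rightarrow> ('a \<Rightarrow> 'b) set" where
  "C1_nbhd S M f \<epsilon> = {g \<in> C1_maps S M. \<forall>x\<in>S. norm (g x - f x) < \<epsilon> x \<and>
     (\<exists>D. ((\<lambda>y. g y - f y) has_derivative D) (at x within S) \<and> onorm D < \<epsilon> x)}"

definition C1_topology ::
  "'a::euclidean_space set \<Rightarrow> 'b::euclidean_space set \<Rightarrow> ('a \<Rightarrow> 'b) topology" where
  "C1_topology S M = topology_generated_by
     {C1_nbhd S M f \<epsilon> | f \<epsilon>. f \<in> C1_maps S M \<and> continuous_on S \<epsilon> \<and> (\<forall>x\<in>S. 0 < \<epsilon> x)}"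


section \<open>Embeddings and configurations of spheres\<close>

text \<open>An embedding is a C1 diffeomorphism onto its image.\<close>

definition C1_embedding :: "'a::euclidean_space set \<Rightarrow> 'b::euclidean_space set \<Rightarrow> ('a \<Rightarrow> 'b) \<Rightarrow> bool" where
  "C1_embedding S M f \<longleftrightarrow> f \<in> C1_maps S M \<and> inj_on f S \<and> C1_on (f ` S) (inv_into S f)"

text \<open>
  Embeddings of \<open>n\<close> disjoint copies of a compact \<open>S\<close>; the restriction to the copy with
  index \<open>i < n\<close> is \<open>\<phi> i\<close>. The space of C1 maps on the coproduct is the product of the
  spaces of C1 maps on the copies.
\<close>

definition Emb :: "nat \<Rightarrow> 'a::euclidean_space set \<Rightarrow> 'b::euclidean_space set \<Rightarrow> (nat \<Rightarrow> 'a \<Rightarrow> 'b) set" where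
  "Emb n S M = {\<phi> \<in> extensional {..<n}.
     (\<forall>i<n. C1_embedding S M (\<phi> i)) \<and> disjoint_family_on (\<lambda>i. \<phi> i ` S) {..<n}}"

definition Emb_top :: "nat \<Rightarrow> 'a::euclidean_space set \<Rightarrow> 'b::euclidean_space set \<Rightarrow> (nat \<Rightarrow> 'a \<Rightarrow> 'b) topology" where
  "Emb_top n S M = subtopology (product_topology (\<lambda>_. C1_topology S M) {..<n}) (Emb n S M)"

text \<open>With \<open>DIM('a) = k + 1\<close>, the set \<open>sphere 0 1 :: 'a set\<close> is the k-sphere and
  \<open>cball 0 1 :: 'a set\<close> is the (k+1)-disk it bounds.\<close>

definition unlinked :: "nat \<Rightarrow> 'b::euclidean_space set \<Rightarrow> (nat \<Rightarrow> 'a::euclidean_space \<Rightarrow> 'b) \<Rightarrow> bool" where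
  "unlinked n M \<phi> \<longleftrightarrow> \<phi> \<in> Emb n (sphere 0 1) M \<and>
     (\<exists>\<psi> \<in> Emb n (cball 0 1) M. \<forall>i<n. \<forall>x\<in>sphere 0 1. \<psi> i x = \<phi> i x)"

definition conf_class :: "nat \<Rightarrow> (nat \<Rightarrow> 'c) \<Rightarrow> (nat \<Rightarrow> 'c) set" where
  "conf_class n \<psi> = {\<psi> \<circ> \<pi> | \<pi>. \<pi> permutes {..<n}}"

definition quotient_topology :: "'x topology \<Rightarrow> ('x \<Rightarrow> 'y) \<Rightarrow> 'y topology" where
  "quotient_topology X q =
     topology (\<lambda>V. V \<subseteq> q ` topspace X \<and> openin X {x \<in> topspace X. q x \<in> V})"

lemma openin_quotient_topology:
  "openin (quotient_topology X q) V \<longleftrightarrow> V \<subseteq> q ` topspace X \<and> openin X {x \<in> topspace X. q x \<in> V}"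
proof -
  let ?L = "\<lambda>V. V \<subseteq> q ` topspace X \<and> openin X {x \<in> topspace X. q x \<in> V}"
  have "istopology ?L"
    unfolding istopology_def
  proof (intro conjI allI impI)
    fix S T assume "?L S" "?L T"
    moreover have "{x \<in> topspace X. q x \<in> S \<inter> T} =
        {x \<in> topspace X. q x \<in> S} \<inter> {x \<in> topspace X. q x \<in> T}" by auto
    ultimately show "S \<inter> T \<subseteq> q ` topspace X" "openin X {x \<in> topspace X. q x \<in> S \<inter> T}"
      by auto
  next
    fix K assume K: "\<forall>V\<in>K. ?L V"
    then show "\<Union>K \<subseteq> q ` topspace X" by auto
    have "{x \<in> topspace X. q x \<in> \<Union>K} = (\<Union>V\<in>K. {x \<in> topspace X. q x \<in> V})" by auto
    with K show "openin X {x \<in> topspace X. q x \<in> \<Union>K}" by auto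
  qed
  then show ?thesis
    unfolding quotient_topology_def by simp
qed

lemma quotient_map_quotient_topology: "quotient_map X (quotient_topology X q) q"
proof -
  have "{x \<in> topspace X. q x \<in> q ` topspace X} = topspace X" by auto
  then have "openin (quotient_topology X q) (q ` topspace X)"
    by (simp add: openin_quotient_topology)
  moreover have "topspace (quotient_topology X q) \<subseteq> q ` topspace X"
    using openin_quotient_topology openin_topspace by metis
  ultimately have "q ` topspace X = topspace (quotient_topology X q)"
    by (meson openin_subset subset_antisym)
  then show ?thesis
    by (auto simp: quotient_map_def openin_quotient_topology)
qed

definition Conf_top ::
  "nat \<Rightarrow> 'b::euclidean_space set \<Rightarrow> (nat \<Rightarrow> 'a::euclidean_space \<Rightarrow> 'b) \<Rightarrow> (nat \<Rightarrow> 'a \<Rightarrow> 'b) set topology" where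
  "Conf_top n M \<phi> = quotient_topology
     (subtopology (Emb_top n (sphere 0 1) M) (path_component_of_set (Emb_top n (sphere 0 1) M) \<phi>))
     (conf_class n)"


section \<open>The fundamental group\<close>

definition loops_at :: "'x topology \<Rightarrow> 'x \<Rightarrow> (real \<Rightarrow> 'x) set" where
  "loops_at X x = {\<gamma>. pathin X \<gamma> \<and> \<gamma> 0 = x \<and> \<gamma> 1 = x}"

definition loop_class :: "'x topology \<Rightarrow> 'x \<Rightarrow> (real \<Rightarrow> 'x) \<Rightarrow> (real \<Rightarrow> 'x) set" where
  "loop_class X x \<gamma> =
     {\<delta>. homotopic_with (\<lambda>p. p 0 = x \<and> p 1 = x) (top_of_set {0..1}) X \<gamma> \<delta>}"

definition join_loops :: "(real \<Rightarrow> 'x) \<Rightarrow> (real \<Rightarrow> 'x) \<Rightarrow> real \<Rightarrow> 'x" where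
  "join_loops \<gamma> \<delta> = (\<lambda>t. if t \<le> 1/2 then \<gamma> (2 * t) else \<delta> (2 * t - 1))"

text \<open>
  In the product \<open>a \<otimes> b\<close> the loop from \<open>b\<close> is traversed first. If \<open>f\<close> and \<open>g\<close> are the
  endpoints of lifts of loops in \<open>a\<close> and \<open>b\<close>, a lift of the product then ends at
  \<open>f \<circ> g\<close>, so this is the order that makes the push map a homomorphism.
  The union below is a union of equal classes.
\<close>

definition pi1 :: "'x topology \<Rightarrow> 'x \<Rightarrow> (real \<Rightarrow> 'x) set monoid" where
  "pi1 X x = \<lparr>carrier = loop_class X x ` loops_at X x,
     mult = (\<lambda>a b. \<Union>\<gamma>\<in>a. \<Union>\<delta>\<in>b. loop_class X x (join_loops \<delta> \<gamma>)),
     one = loop_class X x (\<lambda>_. x)\<rparr>"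

definition motion_group ::
  "nat \<Rightarrow> 'b::euclidean_space set \<Rightarrow> (nat \<Rightarrow> 'a::euclidean_space \<Rightarrow> 'b) \<Rightarrow> (real \<Rightarrow> (nat \<Rightarrow> 'a \<Rightarrow> 'b) set) set monoid" where
  "motion_group n M \<phi> = pi1 (Conf_top n M \<phi>) (conf_class n \<phi>)"


section \<open>Diffeomorphism groups and the push map\<close>

definition Diff_c :: "'b::euclidean_space set \<Rightarrow> ('b \<Rightarrow> 'b) set" where
  "Diff_c M = {f \<in> Bij M. C1_on M f \<and> C1_on M (inv_into M f) \<and>
     (\<exists>K. compact K \<and> K \<subseteq> M \<and> (\<forall>x\<in>M - K. f x = x))}"

text \<open>Isotopies are paths of compactly supported diffeomorphisms. Everything isotopic to
  the identity is automatically orientation-preserving.\<close>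

definition Diff_id :: "'b::euclidean_space set \<Rightarrow> ('b \<Rightarrow> 'b) set" where
  "Diff_id M = path_component_of_set (subtopology (C1_topology M M) (Diff_c M)) (\<lambda>x\<in>M. x)"

definition Diff_id_top :: "'b::euclidean_space set \<Rightarrow> ('b \<Rightarrow> 'b) topology" where
  "Diff_id_top M = subtopology (C1_topology M M) (Diff_id M)"

definition apply_diffeo ::
  "nat \<Rightarrow> ('b \<Rightarrow> 'b) \<Rightarrow> (nat \<Rightarrow> 'a::euclidean_space \<Rightarrow> 'b) \<Rightarrow> nat \<Rightarrow> 'a \<Rightarrow> 'b" where
  "apply_diffeo n f \<phi> = (\<lambda>i\<in>{..<n}. compose (sphere 0 1) f (\<phi> i))"

definition Diff_conf ::
  "nat \<Rightarrow> 'b::euclidean_space set \<Rightarrow> (nat \<Rightarrow> 'a::euclidean_space \<Rightarrow> 'b) \<Rightarrow> ('b \<Rightarrow> 'b) set" where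
  "Diff_conf n M \<phi> = {f \<in> Diff_id M. conf_class n (apply_diffeo n f \<phi>) = conf_class n \<phi>}"

definition Diff_conf_group ::
  "nat \<Rightarrow> 'b::euclidean_space set \<Rightarrow> (nat \<Rightarrow> 'a::euclidean_space \<Rightarrow> 'b) \<Rightarrow> ('b \<Rightarrow> 'b) monoid" where
  "Diff_conf_group n M \<phi> = (BijGroup M)\<lparr>carrier := Diff_conf n M \<phi>\<rparr>"

text \<open>The quotient map to \<open>\<pi>\<^sub>0\<close>, whose elements are the path components.\<close>

definition to_pi0 ::
  "nat \<Rightarrow> 'b::euclidean_space set \<Rightarrow> (nat \<Rightarrow> 'a::euclidean_space \<Rightarrow> 'b) \<Rightarrow> ('b \<Rightarrow> 'b) \<Rightarrow> ('b \<Rightarrow> 'b) set" where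
  "to_pi0 n M \<phi> f =
     path_component_of_set (subtopology (Diff_id_top M) (Diff_conf n M \<phi>)) f"

definition lifts_loop ::
  "nat \<Rightarrow> 'b::euclidean_space set \<Rightarrow> (nat \<Rightarrow> 'a::euclidean_space \<Rightarrow> 'b) \<Rightarrow>
   (real \<Rightarrow> (nat \<Rightarrow> 'a \<Rightarrow> 'b) set) \<Rightarrow> (real \<Rightarrow> 'b \<Rightarrow> 'b) \<Rightarrow> bool" where
  "lifts_loop n M \<phi> \<gamma> F \<longleftrightarrow> pathin (Diff_id_top M) F \<and> F 0 = (\<lambda>x\<in>M. x) \<and>
     (\<forall>t\<in>{0..1}. conf_class n (apply_diffeo n (F t) \<phi>) = \<gamma> t)"

text \<open>By the homotopy lifting property the component obtained depends neither on the
  representing loop nor on the lift.\<close>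

definition push_map ::
  "nat \<Rightarrow> 'b::euclidean_space set \<Rightarrow> (nat \<Rightarrow> 'a::euclidean_space \<Rightarrow> 'b) \<Rightarrow>
   (real \<Rightarrow> (nat \<Rightarrow> 'a \<Rightarrow> 'b) set) set \<Rightarrow> ('b \<Rightarrow> 'b) set" where
  "push_map n M \<phi> c = to_pi0 n M \<phi> (SOME f. \<exists>\<gamma>\<in>c. \<exists>F. lifts_loop n M \<phi> \<gamma> F \<and> f = F 1)"

end

theory Submission
  imports Defs
begin

text \<open>
  Translating small round spheres along planar paths yields a homomorphism from the symmetric group
  to the spherical motion group: two planar motions with the same endpoints are homotopic, since
  the spheres can be pulled apart in a third direction. A realization would therefore turn
  permutations of the spheres into a finite group of diffeomorphisms that permutes the spheres in
  the same way. Let \<open>p\<close> lie on the fifth sphere and consider permutations of the first four.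
  Their derivatives at \<open>p\<close> fix the k-dimensional tangent space of that sphere, in a
  (k+2)-dimensional space. A double transposition is the square of a 4-cycle, so its derivative is
  the identity or acts as -1 on the normal plane; hence one of three commuting double
  transpositions has trivial derivative at \<open>p\<close>. An involution \<open>f\<close> with this property is the
  identity near \<open>p\<close>, because \<open>(id + f) / 2\<close> is injective near \<open>p\<close> and invariant under \<open>f\<close>,
  and then it is the identity everywhere. But it moves the spheres.

  The base point is brought to a configuration of affine spheres in a chart by an isotopy
  extension argument. For C1 embeddings there is no flow to integrate; instead an embedding close
  to \<open>\<psi>\<close> is reached by adding its displacement, transported by a C1 left inverse of \<open>\<psi>\<close> and
  multiplied by a bump function, to the identity.
\<close>

section \<open>C1 maps and C1 families\<close>

text \<open>\<open>push_map\<close> selects an arbitrary lift of an arbitrary representative, and a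
  homotopy of loops sees unordered configurations only. The permutation induced by the selected
  diffeomorphism is therefore read off from a covering: one marked point on each sphere gives n
  unordered points, and paths in the square of the homotopy lift uniquely to them.

  Permutations have to respect the parameterizations. This is why all spheres are deformed to
  translates of one ellipsoid: exchanging centres then exchanges parameterized spheres. The
  homomorphism from the symmetric group uses three directions, one for the row of centres, one to
  let spheres pass each other and one for the homotopies.

  An involution of the normal plane could be a reflection; squares exclude this, because a square
  root acts as a complex structure on the eigenspace for -1, which hence has even dimension.

  Euclidean space and the sphere are treated together through a C1 retraction \<open>r\<close> of an
  open set onto M. Derivatives on M are derivatives after composition with \<open>r\<close>, so the
  identity acts on vectors by the projection \<open>Dif r p\<close> to the tangent space.\<close>

definition Dif :: "('a::euclidean_space \<Rightarrow> 'b::euclidean_space) \<Rightarrow> 'a \<Rightarrow> 'a \<Rightarrow>\<^sub>L 'b" where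
  "Dif f x = Blinfun (frechet_derivative f (at x))"

text \<open>Derivatives are taken in the point only, but continuity is joint with the parameter.
  Over a compact set the tube lemma turns this into continuity of \<open>z \<mapsto> G z\<close> in
  the C1 topology.\<close>

definition C1_fam :: "'z::t2_space set \<Rightarrow> 'a::euclidean_space set \<Rightarrow> ('z \<Rightarrow> 'a \<Rightarrow> 'b::euclidean_space) \<Rightarrow> bool" where
  "C1_fam Z U G \<longleftrightarrow> (\<forall>z\<in>Z. \<forall>x\<in>U. G z differentiable (at x)) \<and>
     continuous_on (Z \<times> U) (\<lambda>p. G (fst p) (snd p)) \<and> continuous_on (Z \<times> U) (\<lambda>p. Dif (G (fst p)) (snd p))"

definition C1o :: "'a::euclidean_space set \<Rightarrow> ('a \<Rightarrow> 'b::euclidean_space) \<Rightarrow> bool" where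
  "C1o U f \<longleftrightarrow> (\<forall>x\<in>U. f differentiable (at x)) \<and> continuous_on U (Dif f)"

lemma Dif_eqI:
  assumes "(f has_derivative blinfun_apply A) (at x)"
  shows "Dif f x = A"
proof -
  have "frechet_derivative f (at x) = blinfun_apply A"
    using assms frechet_derivative_at by metis
  then show ?thesis by (simp add: Dif_def blinfun_apply_inverse)
qed

lemma has_derivative_Dif:
  assumes "f differentiable (at x)"
  shows "(f has_derivative blinfun_apply (Dif f x)) (at x)"
proof -
  have "(f has_derivative frechet_derivative f (at x)) (at x)"
    using assms frechet_derivative_works by blast
  moreover from this have "bounded_linear (frechet_derivative f (at x))"
    by (rule has_derivative_bounded_linear)
  ultimately show ?thesis by (simp add: Dif_def bounded_linear_Blinfun_apply)
qed

lemma C1_fam_D: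
  assumes "C1_fam Z U G" "z \<in> Z" "x \<in> U"
  shows "(G z has_derivative blinfun_apply (Dif (G z) x)) (at x)"
  using assms by (auto simp: C1_fam_def intro: has_derivative_Dif)

lemma C1o_D:
  assumes "C1o U f" "x \<in> U"
  shows "(f has_derivative blinfun_apply (Dif f x)) (at x)"
  using assms by (auto simp: C1o_def intro: has_derivative_Dif)

lemma C1o_imp_continuous_on: "C1o U f \<Longrightarrow> continuous_on U f"
  by (intro continuous_at_imp_continuous_on ballI differentiable_imp_continuous_within)
    (simp add: C1o_def)

lemma C1o_Dif: "C1o U f \<Longrightarrow> continuous_on U (Dif f)"
  by (simp add: C1o_def)

lemma C1_fam_cont: "C1_fam Z U G \<Longrightarrow> continuous_on (Z \<times> U) (\<lambda>p. G (fst p) (snd p))"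
  and C1_fam_Dif: "C1_fam Z U G \<Longrightarrow> continuous_on (Z \<times> U) (\<lambda>p. Dif (G (fst p)) (snd p))"
  by (auto simp: C1_fam_def)

lemma C1_famI:
  assumes "\<And>z x. z \<in> Z \<Longrightarrow> x \<in> U \<Longrightarrow> (G z has_derivative blinfun_apply (G' z x)) (at x)"
    and "continuous_on (Z \<times> U) (\<lambda>p. G (fst p) (snd p))"
    and "continuous_on (Z \<times> U) (\<lambda>p. G' (fst p) (snd p))"
  shows "C1_fam Z U G"
  unfolding C1_fam_def
proof (intro conjI ballI)
  show "G z differentiable at x" if "z \<in> Z" "x \<in> U" for z x
    using assms(1)[OF that] by (auto simp: differentiable_def)
  have "Dif (G (fst p)) (snd p) = G' (fst p) (snd p)" if "p \<in> Z \<times> U" for p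
    using assms(1) that by (auto intro: Dif_eqI)
  then show "continuous_on (Z \<times> U) (\<lambda>p. Dif (G (fst p)) (snd p))"
    using assms(3) by (simp cong: continuous_on_cong)
qed (fact assms(2))

lemma C1oI:
  assumes "\<And>x. x \<in> U \<Longrightarrow> (f has_derivative blinfun_apply (f' x)) (at x)" "continuous_on U f'"
  shows "C1o U f"
  unfolding C1o_def
proof (intro conjI ballI)
  show "f differentiable at x" if "x \<in> U" for x
    using assms(1)[OF that] by (auto simp: differentiable_def)
  have "Dif f x = f' x" if "x \<in> U" for x
    using assms(1) that by (auto intro: Dif_eqI)
  then show "continuous_on U (Dif f)"
    using assms(2) by (simp cong: continuous_on_cong)
qed

lemma C1_on_iff: "C1_on S f \<longleftrightarrow> (\<exists>U g. open U \<and> S \<subseteq> U \<and> (\<forall>x\<in>S. g x = f x) \<and> C1o U g)"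
proof
  assume "C1_on S f"
  then obtain U g g' where "open U" "S \<subseteq> U" "\<forall>x\<in>S. g x = f x"
     "\<forall>x\<in>U. (g has_derivative blinfun_apply (g' x)) (at x)" "continuous_on U g'"
    unfolding C1_on_def by blast
  then show "\<exists>U g. open U \<and> S \<subseteq> U \<and> (\<forall>x\<in>S. g x = f x) \<and> C1o U g"
    using C1oI[of U g g'] by blast
next
  assume "\<exists>U g. open U \<and> S \<subseteq> U \<and> (\<forall>x\<in>S. g x = f x) \<and> C1o U g"
  then obtain U g where *: "open U" "S \<subseteq> U" "\<forall>x\<in>S. g x = f x" "C1o U g" by blast
  show "C1_on S f"
    unfolding C1_on_def
    using * C1o_D[OF *(4)] by (intro exI[of _ U] exI[of _ g] exI[of _ "Dif g"]) (auto simp: C1o_def)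
qed

lemma C1_fam_fixed:
  assumes "C1o U f"
  shows "C1_fam Z U (\<lambda>_. f)"
proof (rule C1_famI[where G' = "\<lambda>_. Dif f"])
  show "continuous_on (Z \<times> U) (\<lambda>p. f (snd p))"
    by (intro continuous_on_compose2[OF C1o_imp_continuous_on[OF assms]] continuous_intros) auto
  show "continuous_on (Z \<times> U) (\<lambda>p. Dif f (snd p))"
    by (intro continuous_on_compose2[OF C1o_Dif[OF assms]] continuous_intros) auto
qed (use assms C1o_D in blast)

lemma C1_fam_reparam:
  assumes "C1_fam Z U G" "continuous_on Z' \<theta>" "\<And>z. z \<in> Z' \<Longrightarrow> \<theta> z \<in> Z"
  shows "C1_fam Z' U (\<lambda>z. G (\<theta> z))"
proof (rule C1_famI[where G' = "\<lambda>z. Dif (G (\<theta> z))"])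
  have 1: "continuous_on (Z' \<times> U) (\<lambda>p. (\<theta> (fst p), snd p))"
    by (intro continuous_intros continuous_on_compose2[OF assms(2)]) auto
  show "continuous_on (Z' \<times> U) (\<lambda>p. G (\<theta> (fst p)) (snd p))"
    using continuous_on_compose2[OF C1_fam_cont[OF assms(1)] 1] assms(3) by fastforce
  show "continuous_on (Z' \<times> U) (\<lambda>p. Dif (G (\<theta> (fst p))) (snd p))"
    using continuous_on_compose2[OF C1_fam_Dif[OF assms(1)] 1] assms(3) by fastforce
qed (use assms C1_fam_D in blast)

lemma C1_fam_mono:
  assumes "C1_fam Z U G" "Z' \<subseteq> Z" "U' \<subseteq> U"
  shows "C1_fam Z' U' G"
  using assms unfolding C1_fam_def
  by (meson Sigma_mono continuous_on_subset subsetD)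

lemma C1o_mono: "C1o U f \<Longrightarrow> U' \<subseteq> U \<Longrightarrow> C1o U' f"
  unfolding C1o_def by (meson continuous_on_subset subsetD)

lemma C1_fam_at:
  assumes "C1_fam Z U G" "z \<in> Z"
  shows "C1o U (G z)"
proof (rule C1oI[where f' = "Dif (G z)"])
  have "continuous_on U (\<lambda>x. (z, x))" by (intro continuous_intros)
  then show "continuous_on U (Dif (G z))"
    using continuous_on_compose2[OF C1_fam_Dif[OF assms(1)], of U "\<lambda>x. (z,x)"] assms(2) by auto
qed (use assms C1_fam_D in blast)

text \<open>Reads a single map as a family over one parameter, so that closure properties proved for
  families transfer.\<close>

lemma C1o_iff_fam: "C1o U f \<longleftrightarrow> C1_fam {0::real} U (\<lambda>_. f)"
  using C1_fam_fixed C1_fam_at by fastforce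

lemma C1_fam_compose:
  assumes G: "C1_fam Z U G" and H: "C1_fam Z V H" and im: "\<And>z x. z \<in> Z \<Longrightarrow> x \<in> U \<Longrightarrow> G z x \<in> V"
  shows "C1_fam Z U (\<lambda>z x. H z (G z x))"
proof (rule C1_famI[where G' = "\<lambda>z x. Dif (H z) (G z x) o\<^sub>L Dif (G z) x"])
  show "((\<lambda>x. H z (G z x)) has_derivative blinfun_apply (Dif (H z) (G z x) o\<^sub>L Dif (G z) x)) (at x)"
    if "z \<in> Z" "x \<in> U" for z x
    using has_derivative_compose[OF C1_fam_D[OF G that] C1_fam_D[OF H that(1) im[OF that]]]
    by (simp add: blinfun_compose.rep_eq o_def)
  have c: "continuous_on (Z \<times> U) (\<lambda>p. (fst p, G (fst p) (snd p)))"
    by (intro continuous_intros C1_fam_cont[OF G])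
  show "continuous_on (Z \<times> U) (\<lambda>p. H (fst p) (G (fst p) (snd p)))"
    using continuous_on_compose2[OF C1_fam_cont[OF H] c] im by fastforce
  have "continuous_on (Z \<times> U) (\<lambda>p. Dif (H (fst p)) (G (fst p) (snd p)))"
    using continuous_on_compose2[OF C1_fam_Dif[OF H] c] im by fastforce
  then show "continuous_on (Z \<times> U) (\<lambda>p. Dif (H (fst p)) (G (fst p) (snd p)) o\<^sub>L Dif (G (fst p)) (snd p))"
    by (intro continuous_intros C1_fam_Dif[OF G])
qed

lemma C1o_compose:
  assumes "C1o U g" "C1o V f" "\<And>x. x \<in> U \<Longrightarrow> g x \<in> V"
  shows "C1o U (\<lambda>x. f (g x))"
  using assms C1_fam_compose unfolding C1o_iff_fam by fast

lemma Dif_compose: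
  assumes "C1o U g" "C1o V f" "x \<in> U" "g x \<in> V"
  shows "Dif (\<lambda>x. f (g x)) x = Dif f (g x) o\<^sub>L Dif g x"
  using has_derivative_compose[OF C1o_D[OF assms(1,3)] C1o_D[OF assms(2,4)]]
  by (intro Dif_eqI) (simp add: blinfun_compose.rep_eq o_def)

lemma Dif_cong:
  assumes "open U" "x \<in> U" "\<And>y. y \<in> U \<Longrightarrow> f y = g y" "f differentiable (at x)"
  shows "Dif g x = Dif f x"
  using has_derivative_transform_within_open[OF has_derivative_Dif[OF assms(4)] assms(1,2,3)]
  by (intro Dif_eqI) auto

lemma C1_fam_cong:
  assumes "C1_fam Z U G" "open U" "\<And>z x. z \<in> Z \<Longrightarrow> x \<in> U \<Longrightarrow> G z x = H z x"
  shows "C1_fam Z U H"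
proof (rule C1_famI[where G' = "\<lambda>z. Dif (G z)"])
  show "(H z has_derivative blinfun_apply (Dif (G z) x)) (at x)" if "z \<in> Z" "x \<in> U" for z x
    using has_derivative_transform_within_open[OF C1_fam_D[OF assms(1) that] assms(2)] assms(3) that by blast
  show "continuous_on (Z \<times> U) (\<lambda>p. H (fst p) (snd p))"
    by (rule iffD1[OF continuous_on_cong[OF refl] C1_fam_cont[OF assms(1)]])
      (use assms(3) in auto)
qed (fact C1_fam_Dif[OF assms(1)])

lemma C1o_cong:
  assumes "C1o U f" "open U" "\<And>x. x \<in> U \<Longrightarrow> f x = g x"
  shows "C1o U g"
  unfolding C1o_iff_fam
  by (rule C1_fam_cong[OF assms(1)[unfolded C1o_iff_fam]]) (use assms in auto)

lemma C1_fam_add: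
  assumes "C1_fam Z U G" "C1_fam Z U H"
  shows "C1_fam Z U (\<lambda>z x. G z x + H z x)"
proof (rule C1_famI[where G' = "\<lambda>z x. Dif (G z) x + Dif (H z) x"])
  show "((\<lambda>x. G z x + H z x) has_derivative blinfun_apply (Dif (G z) x + Dif (H z) x)) (at x)"
    if "z \<in> Z" "x \<in> U" for z x
    using has_derivative_add[OF C1_fam_D[OF assms(1) that] C1_fam_D[OF assms(2) that]]
    by (simp add: plus_blinfun.rep_eq)
qed (intro continuous_intros C1_fam_cont C1_fam_Dif assms)+

lemma C1_fam_scaleR:
  assumes "C1_fam Z U G" "C1_fam Z U H"
  shows "C1_fam Z U (\<lambda>z x. (G z x :: real) *\<^sub>R H z x)"
proof (rule C1_famI[where G' = "\<lambda>z x. G z x *\<^sub>R Dif (H z) x + (blinfun_scaleR_left (H z x) o\<^sub>L Dif (G z) x)"])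
  show "((\<lambda>x. G z x *\<^sub>R H z x) has_derivative
     blinfun_apply (G z x *\<^sub>R Dif (H z) x + (blinfun_scaleR_left (H z x) o\<^sub>L Dif (G z) x))) (at x)"
    if "z \<in> Z" "x \<in> U" for z x
    using has_derivative_scaleR[OF C1_fam_D[OF assms(1) that] C1_fam_D[OF assms(2) that]]
    by (simp add: plus_blinfun.rep_eq scaleR_blinfun.rep_eq blinfun_compose.rep_eq o_def)
qed (intro continuous_intros C1_fam_cont C1_fam_Dif assms)+

lemma C1_fam_param:
  assumes "continuous_on Z c"
  shows "C1_fam Z U (\<lambda>z x. c z)"
  by (rule C1_famI[where G' = "\<lambda>z x. 0"])
    (auto intro!: continuous_intros continuous_on_compose2[OF assms] simp: zero_blinfun.rep_eq)

lemma C1o_linear: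
  assumes "bounded_linear f"
  shows "C1o U f"
  by (rule C1oI[where f' = "\<lambda>_. Blinfun f"])
    (use assms in \<open>auto simp: bounded_linear_Blinfun_apply intro: bounded_linear_imp_has_derivative\<close>)

lemma C1o_id: "C1o U (\<lambda>x. x)" using C1o_linear[OF bounded_linear_ident] .

lemma C1o_add: "C1o U f \<Longrightarrow> C1o U g \<Longrightarrow> C1o U (\<lambda>x. f x + g x)"
  unfolding C1o_iff_fam by (rule C1_fam_add)

lemma C1o_scaleR: "C1o U f \<Longrightarrow> C1o U g \<Longrightarrow> C1o U (\<lambda>x. (f x::real) *\<^sub>R g x)"
  unfolding C1o_iff_fam by (rule C1_fam_scaleR)

lemma C1o_const: "C1o U (\<lambda>x. c)"
  unfolding C1o_iff_fam by (rule C1_fam_param) (rule continuous_on_const)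

lemma C1_fam_diff:
  assumes "C1_fam Z U G" "C1_fam Z U H"
  shows "C1_fam Z U (\<lambda>z x. G z x - H z x)"
proof -
  have "C1_fam Z U (\<lambda>z x. G z x + (-1) *\<^sub>R H z x)"
    by (intro C1_fam_add C1_fam_scaleR assms C1_fam_param continuous_on_const)
  then show ?thesis by simp
qed

lemma C1o_diff: "C1o U f \<Longrightarrow> C1o U g \<Longrightarrow> C1o U (\<lambda>x. f x - g x)"
  unfolding C1o_iff_fam by (rule C1_fam_diff)

lemma C1_fam_sum:
  assumes "finite I" "\<And>i. i \<in> I \<Longrightarrow> C1_fam Z U (G i)"
  shows "C1_fam Z U (\<lambda>z x. \<Sum>i\<in>I. G i z x)"
  using assms
  by (induction I rule: finite_induct) (auto intro!: C1_fam_add C1_fam_param continuous_on_const)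

lemma C1o_sum:
  assumes "finite I" "\<And>i. i \<in> I \<Longrightarrow> C1o U (f i)"
  shows "C1o U (\<lambda>x. \<Sum>i\<in>I. f i x)"
  using assms unfolding C1o_iff_fam by (rule C1_fam_sum)

text \<open>Serves maps that are given by a formula on one open set and by zero on another, such as
  cut-off displacements.\<close>

lemma C1_fam_local:
  assumes "\<And>x. x \<in> U \<Longrightarrow> \<exists>V. open V \<and> x \<in> V \<and> C1_fam Z V G"
  shows "C1_fam Z U G"
proof -
  have loc: "continuous_on (Z \<times> U) F"
    if F: "\<And>V. C1_fam Z V G \<Longrightarrow> continuous_on (Z \<times> V) F" for F :: "_ \<Rightarrow> 'd::topological_space"
    unfolding continuous_on_eq_continuous_within
  proof
    fix p assume p: "p \<in> Z \<times> U"
    then obtain V where V: "open V" "snd p \<in> V" "C1_fam Z V G" using assms[of "snd p"] by auto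
    have "continuous (at p within Z \<times> V) F"
      using F[OF V(3)] p V(2) by (auto simp: continuous_on_eq_continuous_within)
    then have "continuous (at p within Z \<times> (U \<inter> V)) F"
      by (rule continuous_within_subset) auto
    moreover have "at p within Z \<times> U = at p within Z \<times> (U \<inter> V)"
      by (rule at_within_nhd[where S = "UNIV \<times> V"]) (use V in \<open>auto simp: open_Times mem_Times_iff\<close>)
    ultimately show "continuous (at p within Z \<times> U) F" by simp
  qed
  show ?thesis unfolding C1_fam_def
  proof (intro conjI ballI)
    show "G z differentiable at x" if "z \<in> Z" "x \<in> U" for z x
      using assms[OF that(2)] that(1) by (auto simp: C1_fam_def)
  qed (rule loc, simp add: C1_fam_def)+
qed

lemma C1o_local:
  assumes "\<And>x. x \<in> U \<Longrightarrow> \<exists>V. open V \<and> x \<in> V \<and> C1o V f"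
  shows "C1o U f"
  using assms unfolding C1o_iff_fam by (rule C1_fam_local)


section \<open>C1 retractions onto Euclidean space and the sphere\<close>

text \<open>Composition with \<open>r\<close> extends a map from M to the open set X, so that
  derivatives on M become ordinary ones; at points of M, \<open>Dif r x\<close> is the projection to
  the tangent space. \<open>near_M\<close> controls derivatives off M, and \<open>surj_M\<close> is
  the topological input behind the surjectivity of maps close to the identity (Brouwer for Euclidean
  space, non-contractibility for the sphere).\<close>

locale C1_retract =
  fixes M X :: "'b::euclidean_space set" and r :: "'b \<Rightarrow> 'b"
  assumes open_X: "open X" and M_sub: "M \<subseteq> X" and C1_r: "C1o X r"
    and r_in: "\<And>x. x \<in> X \<Longrightarrow> r x \<in> M" and r_id: "\<And>x. x \<in> M \<Longrightarrow> r x = x"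
    and norm_Dif_r: "\<And>x. x \<in> M \<Longrightarrow> norm (Dif r x) \<le> 1"
    and near_M: "\<And>x y. x \<in> M \<Longrightarrow> dist x y < 1/2 \<Longrightarrow> y \<in> X \<and> norm (Dif r y) \<le> 2"
    and conn_M: "connected M" and closed_M: "closed M"
    and surj_M: "\<And>f K. continuous_on M f \<Longrightarrow> f ` M \<subseteq> M \<Longrightarrow> (\<forall>x\<in>M. norm (f x - x) \<le> 1/4) \<Longrightarrow>
        compact K \<Longrightarrow> (\<forall>x\<in>M - K. f x = x) \<Longrightarrow> f ` M = M"

lemma Dif_id [simp]: "Dif (\<lambda>x. x) x = id_blinfun"
  by (rule Dif_eqI) (simp add: id_blinfun.rep_eq)

lemma C1_retract_UNIV: "C1_retract (UNIV::'b::euclidean_space set) UNIV (\<lambda>x. x)"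
proof
  fix f :: "'b \<Rightarrow> 'b" and K assume f: "continuous_on UNIV f" "\<forall>x\<in>UNIV. norm (f x - x) \<le> 1/4"
  show "f ` UNIV = UNIV"
  proof (intro equalityI subset_UNIV subsetI)
    fix x :: 'b
    \<comment> \<open>A solution is a fixed point of y \<mapsto> x + (y - f y), which maps the unit
      ball around x to itself because displacements are at most 1/4.\<close>
    have "\<exists>y\<in>cball x 1. f y = x"
    proof (rule brouwer_surjective_cball[where S = "{x}"])
      show "continuous_on (cball x 1) f" using f(1) continuous_on_subset by blast
      show "z + (y - f y) \<in> cball x 1" if "z \<in> {x}" for z y
      proof -
        have "norm (f y - y) \<le> 1" using f(2)[rule_format, of y] by simp
        then show ?thesis using that by (simp add: dist_norm norm_minus_commute)
      qed
    qed auto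
    then show "x \<in> range f" by auto
  qed
next
  show "norm (Dif (\<lambda>x. x) (x::'b)) \<le> 1" for x
    by (simp add: norm_blinfun_id_le)
  show "y \<in> UNIV \<and> norm (Dif (\<lambda>x. x) y) \<le> 2" for x y :: 'b
    by (simp add: order_trans[OF norm_blinfun_id_le])
qed (auto simp: C1o_id)

lemma C1o_norm: "C1o (- {0}) (norm :: 'b::euclidean_space \<Rightarrow> real)"
proof (rule C1oI)
  show "(norm has_derivative blinfun_apply (blinfun_inner_left (sgn x))) (at x)" if "x \<in> - {0}" for x :: 'b
    using has_derivative_norm[of x] that by (simp add: inner_commute)
  show "continuous_on (- {0}) (\<lambda>x::'b. blinfun_inner_left (sgn x))"
    by (intro bounded_linear.continuous_on[OF bounded_linear_blinfun_inner_left] continuous_intros) auto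
qed

lemma C1o_inverse: "C1o (- {0}) (inverse :: real \<Rightarrow> real)"
proof (rule C1oI)
  show "(inverse has_derivative blinfun_apply (blinfun_scaleR_left (- (inverse x * inverse x)))) (at x)"
    if "x \<in> - {0}" for x :: real
    using has_derivative_inverse'[of x UNIV] that by (auto simp: algebra_simps)
  show "continuous_on (- {0}) (\<lambda>x::real. blinfun_scaleR_left (- (inverse x * inverse x)) :: real \<Rightarrow>\<^sub>L real)"
    by (intro bounded_linear.continuous_on[OF bounded_linear_blinfun_scaleR_left] continuous_intros) auto
qed

definition nrm :: "'b::euclidean_space \<Rightarrow> 'b" where "nrm x = x /\<^sub>R norm x"

lemma C1o_nrm: "C1o (- {0}) (nrm :: 'b::euclidean_space \<Rightarrow> 'b)"
proof -
  have "C1o (- {0}) (\<lambda>x::'b. inverse (norm x) *\<^sub>R x)"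
    by (intro C1o_scaleR C1o_id C1o_compose[OF C1o_norm C1o_inverse]) auto
  then show ?thesis by (simp add: nrm_def[abs_def])
qed

lemma Dif_nrm:
  fixes x :: "'b::euclidean_space"
  assumes "x \<noteq> 0"
  shows "blinfun_apply (Dif nrm x) v = (v - (nrm x \<bullet> v) *\<^sub>R nrm x) /\<^sub>R norm x"
proof -
  have "((\<lambda>x. inverse (norm x) *\<^sub>R x) has_derivative
      (\<lambda>v. inverse (norm x) *\<^sub>R v + (- (inverse (norm x) * (sgn x \<bullet> v) * inverse (norm x))) *\<^sub>R x)) (at x)"
    using assms by (auto intro!: derivative_eq_intros has_derivative_norm[THEN has_derivative_eq_rhs] simp: inner_commute)
  then have "(nrm has_derivative (\<lambda>v. (v - (nrm x \<bullet> v) *\<^sub>R nrm x) /\<^sub>R norm x)) (at x)"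
    by (simp add: nrm_def[abs_def] sgn_div_norm algebra_simps)
  moreover have "(nrm has_derivative blinfun_apply (Dif nrm x)) (at x)"
    using C1o_D[OF C1o_nrm] assms by blast
  ultimately have "blinfun_apply (Dif nrm x) = (\<lambda>v. (v - (nrm x \<bullet> v) *\<^sub>R nrm x) /\<^sub>R norm x)"
    using has_derivative_unique by blast
  then show ?thesis by simp
qed

lemma norm_nrm: "x \<noteq> 0 \<Longrightarrow> norm (nrm x) = 1"
  by (simp add: nrm_def)

lemma norm_Dif_nrm:
  fixes x :: "'b::euclidean_space"
  assumes "x \<noteq> 0"
  shows "norm (Dif nrm x) \<le> inverse (norm x)"
proof (rule norm_blinfun_bound)
  fix v :: 'b
  let ?u = "nrm x"
  have "norm (v - (?u \<bullet> v) *\<^sub>R ?u) ^ 2 = norm v ^ 2 - (?u \<bullet> v)^2"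
    using norm_nrm[OF assms] unfolding power2_norm_eq_inner
    by (simp add: inner_diff_left inner_diff_right inner_commute power2_eq_square norm_eq_1)
  also have "\<dots> \<le> norm v ^ 2" by simp
  finally have "norm (v - (?u \<bullet> v) *\<^sub>R ?u) \<le> norm v"
    by (rule power2_le_imp_le) simp
  then show "norm (blinfun_apply (Dif nrm x) v) \<le> inverse (norm x) * norm v"
    using assms by (simp add: Dif_nrm mult_left_mono)
qed simp

text \<open>For the surjectivity: if f misses b, the segments from f x to -b avoid 0, so f is
  homotopic to a constant in the punctured space. Being close to the identity, f is also homotopic
  to the identity there. Normalizing gives a contraction of the sphere.\<close>

lemma C1_retract_sphere:
  assumes "DIM('b) \<ge> 2"
  shows "C1_retract (sphere 0 1 :: 'b::euclidean_space set) (- {0}) nrm"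
proof
  show "norm (Dif nrm x) \<le> 1" if "x \<in> sphere 0 1" for x :: 'b
    using norm_Dif_nrm[of x] that by (cases "x = 0") auto
  show "y \<in> - {0} \<and> norm (Dif nrm y) \<le> 2" if "x \<in> sphere 0 1" "dist x y < 1/2" for x y :: 'b
  proof -
    have *: "norm y > 1/2" using that norm_triangle_ineq2[of x y] by (simp add: dist_norm)
    then have "y \<noteq> 0" by auto
    moreover have "inverse (norm y) \<le> inverse (1/2)" by (rule le_imp_inverse_le) (use * in auto)
    ultimately show ?thesis using norm_Dif_nrm[of y] by auto
  qed
  show "connected (sphere 0 1 :: 'b set)" using assms by (rule connected_sphere)
  fix f :: "'b \<Rightarrow> 'b" and K :: "'b set" assume f: "continuous_on (sphere 0 1) f" "f ` sphere 0 1 \<subseteq> sphere 0 1"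
    "\<forall>x\<in>sphere 0 1. norm (f x - x) \<le> 1/4"
  show "f ` sphere 0 1 = sphere 0 1"
  proof (rule ccontr)
    assume ne: "f ` sphere 0 1 \<noteq> sphere 0 1"
    let ?S = "sphere 0 1 :: 'b set"
    obtain b where b: "b \<in> ?S" "b \<notin> f ` ?S" using ne f(2) by blast
    have "homotopic_with_canon (\<lambda>x. True) ?S (-{0}) f (\<lambda>x. - b)"
    proof (rule homotopic_with_linear)
      show "closed_segment (f x) (- b) \<subseteq> - {0}" if "x \<in> ?S" for x
      proof clarify
        assume "0 \<in> closed_segment (f x) (- b)"
        then obtain u where u: "0 \<le> u" "u \<le> 1" "0 = (1 - u) *\<^sub>R f x + u *\<^sub>R (- b)"
          unfolding closed_segment_def by blast
        then have e: "(1 - u) *\<^sub>R f x = u *\<^sub>R b" by simp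
        have "norm (f x) = 1" "norm b = 1" using f(2)[THEN subsetD, of "f x"] that b by auto
        with e have "1 - u = u" using u by (metis abs_of_nonneg diff_ge_0_iff_ge mult.right_neutral norm_scaleR)
        then have "u = 1/2" by simp
        with e have "f x = b" by simp
        then show False using b that by auto
      qed
    qed (use f in \<open>auto intro: continuous_intros\<close>)
    moreover
    have "homotopic_with_canon (\<lambda>x. True) ?S (-{0}) (\<lambda>x. x) f"
    proof (rule homotopic_with_linear)
      show "closed_segment x (f x) \<subseteq> - {0}" if "x \<in> ?S" for x
      proof -
        have "closed_segment x (f x) \<subseteq> ball x (1/2)"
          using f(3)[rule_format, OF that]
          by (intro closed_segment_subset convex_ball) (simp_all add: dist_norm norm_minus_commute)
        then show ?thesis using that by auto
      qed
    qed (use f in \<open>auto intro: continuous_intros\<close>)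
    ultimately have "homotopic_with_canon (\<lambda>x. True) ?S (-{0}) (\<lambda>x. x) (\<lambda>x. - b)"
      using homotopic_with_trans by blast
    then have "homotopic_with_canon (\<lambda>x. True) ?S ?S (nrm \<circ> (\<lambda>x. x)) (nrm \<circ> (\<lambda>x. - b))"
      by (rule homotopic_with_compose_continuous_left)
        (use C1o_imp_continuous_on[OF C1o_nrm] in \<open>auto simp: norm_nrm\<close>)
    then have "homotopic_with_canon (\<lambda>x. True) ?S ?S (\<lambda>x. x) (\<lambda>x. - b)"
      by (rule homotopic_with_eq) (use b in \<open>auto simp: nrm_def\<close>)
    then have "contractible ?S"
      unfolding contractible_def id_def by blast
    then show False using contractible_sphere[of "0::'b" 1] by simp
  qed
qed (auto simp: C1o_nrm nrm_def)

text \<open>At a unit vector the derivative of the normalization is the orthogonal projection to the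
  tangent hyperplane.\<close>

lemma dim_range_Dif_nrm:
  fixes x :: "'b::euclidean_space"
  assumes "norm x = 1"
  shows "range (blinfun_apply (Dif nrm x)) = {v. x \<bullet> v = 0}" "dim (range (blinfun_apply (Dif nrm x))) = DIM('b) - 1"
proof -
  have x: "x \<noteq> 0" "nrm x = x" "x \<bullet> x = 1" using assms by (auto simp: nrm_def) (simp add: dot_square_norm)
  show 1: "range (blinfun_apply (Dif nrm x)) = {v. x \<bullet> v = 0}"
  proof (intro equalityI subsetI)
    fix v assume "v \<in> {v. x \<bullet> v = 0}"
    then have "v = blinfun_apply (Dif nrm x) v" using x assms by (simp add: Dif_nrm)
    then show "v \<in> range (blinfun_apply (Dif nrm x))" by blast
  qed (use x assms in \<open>auto simp: Dif_nrm inner_diff_right\<close>)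
  show "dim (range (blinfun_apply (Dif nrm x))) = DIM('b) - 1"
    unfolding 1 using dim_hyperplane[OF x(1)] by simp
qed


section \<open>Continuity in the C1 topology\<close>

lemma C1_nbhd_self:
  assumes "f \<in> C1_maps S N" "\<And>x. x \<in> S \<Longrightarrow> 0 < \<epsilon> x"
  shows "f \<in> C1_nbhd S N f \<epsilon>"
proof -
  have "((\<lambda>y. f y - f y) has_derivative (\<lambda>_. 0)) (at x within S)" for x by simp
  then show ?thesis using assms by (auto simp: C1_nbhd_def onorm_zero intro!: exI[of _ "\<lambda>_. 0"])
qed

lemma openin_C1_nbhd:
  assumes "f \<in> C1_maps S N" "continuous_on S \<epsilon>" "\<And>x. x \<in> S \<Longrightarrow> 0 < \<epsilon> x"
  shows "openin (C1_topology S N) (C1_nbhd S N f \<epsilon>)"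
  unfolding C1_topology_def using assms by (intro topology_generated_by_Basis) blast

lemma topspace_C1_topology [simp]: "topspace (C1_topology S N) = C1_maps S N"
proof
  show "topspace (C1_topology S N) \<subseteq> C1_maps S N"
    unfolding C1_topology_def topology_generated_by_topspace by (auto simp: C1_nbhd_def)
  show "C1_maps S N \<subseteq> topspace (C1_topology S N)"
  proof
    fix f assume f: "f \<in> C1_maps S N"
    have "openin (C1_topology S N) (C1_nbhd S N f (\<lambda>_. 1))"
      by (rule openin_C1_nbhd) (use f in auto)
    then show "f \<in> topspace (C1_topology S N)"
      using C1_nbhd_self[OF f, of "\<lambda>_. 1"] openin_subset by fastforce
  qed
qed

lemma continuous_map_C1_eval:
  fixes N :: "'b::euclidean_space set"
  assumes "x0 \<in> S"
  shows "continuous_map (C1_topology S N) euclidean (\<lambda>f. f x0)"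
  unfolding continuous_map_def
proof (intro conjI allI impI)
  fix B :: "'b set" assume "openin euclidean B"
  then have B: "open B" by simp
  show "openin (C1_topology S N) {f \<in> topspace (C1_topology S N). f x0 \<in> B}"
  proof (subst openin_subopen, intro ballI)
    fix f assume "f \<in> {f \<in> topspace (C1_topology S N). f x0 \<in> B}"
    then have f: "f \<in> C1_maps S N" "f x0 \<in> B" by auto
    then obtain e where e: "e > 0" "ball (f x0) e \<subseteq> B" using B open_contains_ball by blast
    show "\<exists>T. openin (C1_topology S N) T \<and> f \<in> T \<and> T \<subseteq> {f \<in> topspace (C1_topology S N). f x0 \<in> B}"
    proof (intro exI conjI)
      show "openin (C1_topology S N) (C1_nbhd S N f (\<lambda>_. e))"
        by (rule openin_C1_nbhd) (use f e in auto)
      show "f \<in> C1_nbhd S N f (\<lambda>_. e)" by (rule C1_nbhd_self) (use f e in auto)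
      show "C1_nbhd S N f (\<lambda>_. e) \<subseteq> {f \<in> topspace (C1_topology S N). f x0 \<in> B}"
        using e(2) assms by (auto simp: C1_nbhd_def dist_norm norm_minus_commute subset_iff)
    qed
  qed
qed auto

context C1_retract
begin

text \<open>\<open>C1_on\<close> hides an open neighbourhood that depends on the map; composition
  with \<open>r\<close> gives an extension to the fixed open set X.\<close>

lemma C1o_compose_r:
  fixes f :: "'b \<Rightarrow> 'c::euclidean_space"
  assumes "C1_on M f" shows "C1o X (\<lambda>x. f (r x))"
proof -
  obtain U g where U: "open U" "M \<subseteq> U" "\<forall>x\<in>M. g x = f x" "C1o U g"
    using assms unfolding C1_on_iff by blast
  have "C1o X (\<lambda>x. g (r x))" by (rule C1o_compose[OF C1_r U(4)]) (use U r_in in auto)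
  then show ?thesis by (rule C1o_cong) (use open_X r_in U in auto)
qed

lemma C1_onI_r:
  assumes "C1o X f"
  shows "C1_on M f"
  unfolding C1_on_iff using assms open_X M_sub by blast

text \<open>The definition accepts any derivative D within M, which is determined in tangential
  directions only. The derivative of the difference after \<open>r\<close> is D composed with
  \<open>Dif r x\<close>; as this projection has norm at most 1, it is the smallest admissible
  choice.\<close>

lemma C1_nbhd_iff:
  fixes f g :: "'b \<Rightarrow> 'c::euclidean_space"
  assumes "f \<in> C1_maps M N" "g \<in> C1_maps M N"
  shows "g \<in> C1_nbhd M N f \<epsilon> \<longleftrightarrow>
    (\<forall>x\<in>M. norm (g x - f x) < \<epsilon> x \<and> norm (Dif (\<lambda>y. g (r y) - f (r y)) x) < \<epsilon> x)"
proof -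
  let ?h = "\<lambda>y. g (r y) - f (r y)"
  have C: "C1o X ?h"
    using assms by (intro C1o_diff[OF C1o_compose_r C1o_compose_r]) (auto simp: C1_maps_def)
  have "(\<exists>D. ((\<lambda>y. g y - f y) has_derivative D) (at x within M) \<and> onorm D < \<epsilon> x) \<longleftrightarrow> norm (Dif ?h x) < \<epsilon> x"
    if x: "x \<in> M" for x
  proof
    assume "\<exists>D. ((\<lambda>y. g y - f y) has_derivative D) (at x within M) \<and> onorm D < \<epsilon> x"
    then obtain D where D: "((\<lambda>y. g y - f y) has_derivative D) (at x within M)" "onorm D < \<epsilon> x" by blast
    have xX: "x \<in> X" using x M_sub by blast
    have 1: "((\<lambda>y. g y - f y) has_derivative D) (at (r x) within r ` X)"
      unfolding r_id[OF x] by (rule has_derivative_subset[OF D(1)]) (use r_in in blast)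
    have "((\<lambda>y. g y - f y) \<circ> r has_derivative D \<circ> blinfun_apply (Dif r x)) (at x within X)"
      by (rule diff_chain_within[OF has_derivative_at_withinI[OF C1o_D[OF C1_r xX]] 1])
    then have "(?h has_derivative D \<circ> blinfun_apply (Dif r x)) (at x)"
      unfolding at_within_open[OF xX open_X] o_def .
    then have "blinfun_apply (Dif ?h x) = D \<circ> blinfun_apply (Dif r x)"
      by (rule has_derivative_unique[OF C1o_D[OF C xX]])
    then have "norm (Dif ?h x) \<le> onorm D * norm (Dif r x)"
      unfolding norm_blinfun.rep_eq
      by (simp only:) (rule onorm_compose[OF has_derivative_bounded_linear[OF D(1)] blinfun.bounded_linear_right])
    also have "\<dots> \<le> onorm D * 1"
      by (intro mult_left_mono norm_Dif_r x onorm_pos_le has_derivative_bounded_linear[OF D(1)])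
    finally show "norm (Dif ?h x) < \<epsilon> x" using D(2) by simp
  next
    assume n: "norm (Dif ?h x) < \<epsilon> x"
    have "(?h has_derivative blinfun_apply (Dif ?h x)) (at x within M)"
      by (rule has_derivative_at_withinI[OF C1o_D[OF C subsetD[OF M_sub x]]])
    then have "((\<lambda>y. g y - f y) has_derivative blinfun_apply (Dif ?h x)) (at x within M)"
      by (rule has_derivative_transform_within[where d = 1]) (use x in \<open>simp_all add: r_id\<close>)
    with n show "\<exists>D. ((\<lambda>y. g y - f y) has_derivative D) (at x within M) \<and> onorm D < \<epsilon> x"
      by (auto simp: norm_blinfun.rep_eq)
  qed
  then show ?thesis using assms(2) by (auto simp: C1_nbhd_def)
qed

lemma C1_maps_restrict:
  fixes g :: "'b \<Rightarrow> 'c::euclidean_space"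
  assumes "C1o X g" "\<And>x. x \<in> M \<Longrightarrow> g x \<in> N"
  shows "restrict g M \<in> C1_maps M N"
proof -
  have "C1_on M g" using assms(1) by (rule C1_onI_r)
  then have "C1_on M (restrict g M)" unfolding C1_on_def by simp
  then show ?thesis using assms(2) by (auto simp: C1_maps_def)
qed

text \<open>The tolerance may tend to zero at infinity, so joint continuity is not enough on a
  noncompact M. On K the tube lemma applies. Off K the family does not depend on the parameter, and
  neither do its derivatives, because the complement of K has an open preimage under
  \<open>r\<close>.\<close>

lemma continuous_map_C1_topology:
  fixes G :: "'z::t2_space \<Rightarrow> 'b \<Rightarrow> 'c::euclidean_space"
  assumes G: "C1_fam Z X G" and im: "\<And>z x. z \<in> Z \<Longrightarrow> x \<in> M \<Longrightarrow> G z x \<in> N"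
    and K: "compact K" "K \<subseteq> M" "\<And>z z' x. z \<in> Z \<Longrightarrow> z' \<in> Z \<Longrightarrow> x \<in> M - K \<Longrightarrow> G z x = G z' x"
  shows "continuous_map (top_of_set Z) (C1_topology M N) (\<lambda>z. restrict (G z) M)"
  unfolding C1_topology_def
proof (rule continuous_on_generated_topo)
  have maps: "restrict (G z) M \<in> C1_maps M N" if "z \<in> Z" for z
    using C1_maps_restrict[OF C1_fam_at[OF G that]] im that by blast
  show "(\<lambda>z. restrict (G z) M) ` topspace (top_of_set Z) \<subseteq>
    \<Union> {C1_nbhd M N f \<epsilon> |f \<epsilon>. f \<in> C1_maps M N \<and> continuous_on M \<epsilon> \<and> (\<forall>x\<in>M. 0 < \<epsilon> x)}"
  proof clarsimp
    fix z assume z: "z \<in> Z"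
    have "restrict (G z) M \<in> C1_nbhd M N (restrict (G z) M) (\<lambda>_. 1)"
      by (rule C1_nbhd_self) (use maps z in auto)
    then show "\<exists>x. (\<exists>f \<epsilon>. x = C1_nbhd M N f \<epsilon> \<and> f \<in> C1_maps M N \<and> continuous_on M \<epsilon> \<and> (\<forall>x\<in>M. 0 < \<epsilon> x)) \<and> restrict (G z) M \<in> x"
      using maps[OF z] by (intro exI[of _ "C1_nbhd M N (restrict (G z) M) (\<lambda>_. 1)"] conjI exI[of _ "restrict (G z) M"] exI[of _ "\<lambda>_. 1"]) auto
  qed
  fix W assume "W \<in> {C1_nbhd M N f \<epsilon> |f \<epsilon>. f \<in> C1_maps M N \<and> continuous_on M \<epsilon> \<and> (\<forall>x\<in>M. 0 < \<epsilon> x)}"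
  then obtain f \<epsilon> where W: "W = C1_nbhd M N f \<epsilon>" and f: "f \<in> C1_maps M N" and \<epsilon>: "continuous_on M \<epsilon>" by blast
  define H where "H z x = G z (r x) - f (r x)" for z x
  have Gr: "C1_fam Z X (\<lambda>z x. G z (r x))"
    by (rule C1_fam_compose[OF C1_fam_fixed[OF C1_r] G]) (use r_in M_sub in blast)
  have H: "C1_fam Z X H" unfolding H_def
    by (rule C1_fam_diff[OF Gr C1_fam_fixed[OF C1o_compose_r]]) (use f in \<open>simp add: C1_maps_def\<close>)
  define Q where "Q z x \<longleftrightarrow> norm (G z x - f x) < \<epsilon> x \<and> norm (Dif (H z) x) < \<epsilon> x" for z x
  have iff: "restrict (G z) M \<in> W \<longleftrightarrow> (\<forall>x\<in>M. Q z x)" if z: "z \<in> Z" for z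
  proof -
    have "Dif (\<lambda>y. restrict (G z) M (r y) - f (r y)) x = Dif (H z) x" if "x \<in> M" for x
      by (rule Dif_cong[OF open_X]) (use that M_sub r_in H z in \<open>auto simp: H_def C1_fam_def\<close>)
    then show ?thesis
      unfolding W C1_nbhd_iff[OF f maps[OF z]] Q_def by (intro ball_cong refl) simp
  qed
  show "openin (top_of_set Z) ((\<lambda>z. restrict (G z) M) -` W \<inter> topspace (top_of_set Z))"
  proof (subst openin_subopen, intro ballI)
    fix z0 assume "z0 \<in> (\<lambda>z. restrict (G z) M) -` W \<inter> topspace (top_of_set Z)"
    then have z0: "z0 \<in> Z" and Q0: "\<And>x. x \<in> M \<Longrightarrow> Q z0 x" using iff by auto
    define \<Omega> where "\<Omega> = {p \<in> Z \<times> K. Q (fst p) (snd p)}"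
    have KX: "Z \<times> K \<subseteq> Z \<times> X" using K(2) M_sub by auto
    have cf: "continuous_on K f"
    proof -
      have "continuous_on K (\<lambda>x. f (r x))"
        using f K(2) M_sub by (intro continuous_on_subset[OF C1o_imp_continuous_on[OF C1o_compose_r]]) (auto simp: C1_maps_def)
      then show ?thesis
        by (rule iffD1[OF continuous_on_cong[OF refl], rotated]) (use K(2) r_id in auto)
    qed
    have c1: "continuous_on (Z \<times> K) (\<lambda>p. norm (G (fst p) (snd p) - f (snd p)))"
      by (intro continuous_intros continuous_on_subset[OF C1_fam_cont[OF G] KX] continuous_on_compose2[OF cf]) auto
    have c2: "continuous_on (Z \<times> K) (\<lambda>p. norm (Dif (H (fst p)) (snd p)))"
      by (intro continuous_intros continuous_on_subset[OF C1_fam_Dif[OF H] KX])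
    have c3: "continuous_on (Z \<times> K) (\<lambda>p. \<epsilon> (snd p))"
      by (intro continuous_on_compose2[OF \<epsilon>] continuous_intros) (use K(2) in auto)
    have "\<Omega> = {p \<in> Z \<times> K. norm (G (fst p) (snd p) - f (snd p)) < \<epsilon> (snd p)} \<inter>
               {p \<in> Z \<times> K. norm (Dif (H (fst p)) (snd p)) < \<epsilon> (snd p)}"
      by (auto simp: \<Omega>_def Q_def)
    moreover have "openin (top_of_set (Z \<times> K)) \<dots>"
    proof (intro openin_Int)
      have aux: "openin (top_of_set (Z \<times> K)) {p \<in> Z \<times> K. u p < v p}"
        if "continuous_on (Z \<times> K) u" "continuous_on (Z \<times> K) v" for u v :: "'z \<times> 'b \<Rightarrow> real"
      proof -
        have "continuous_on (Z \<times> K) (\<lambda>p. v p - u p)" using that by (intro continuous_intros)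
        then have "openin (top_of_set (Z \<times> K)) (Z \<times> K \<inter> (\<lambda>p. v p - u p) -` {0<..})"
          by (rule continuous_openin_preimage_gen) simp
        moreover have "Z \<times> K \<inter> (\<lambda>p. v p - u p) -` {0<..} = {p \<in> Z \<times> K. u p < v p}" by auto
        ultimately show ?thesis by simp
      qed
      show "openin (top_of_set (Z \<times> K)) {p \<in> Z \<times> K. norm (G (fst p) (snd p) - f (snd p)) < \<epsilon> (snd p)}"
        by (rule aux[OF c1 c3])
      show "openin (top_of_set (Z \<times> K)) {p \<in> Z \<times> K. norm (Dif (H (fst p)) (snd p)) < \<epsilon> (snd p)}"
        by (rule aux[OF c2 c3])
    qed
    ultimately have "openin (prod_topology (top_of_set Z) (top_of_set K)) \<Omega>"
      by (simp add: prod_topology_subtopology_eu)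
    moreover have "compactin (top_of_set K) K" using K(1) by (simp add: compactin_subtopology)
    moreover have "z0 \<in> topspace (top_of_set Z)" using z0 by simp
    moreover have "{z0} \<times> K \<subseteq> \<Omega>" using z0 Q0 K(2) by (auto simp: \<Omega>_def)
    ultimately have "\<exists>U V. openin (top_of_set Z) U \<and> openin (top_of_set K) V \<and> z0 \<in> U \<and> K \<subseteq> V \<and> U \<times> V \<subseteq> \<Omega>"
      by (rule tube_lemma_right)
    then obtain U V where U: "openin (top_of_set Z) U" "z0 \<in> U" and V: "K \<subseteq> V" "U \<times> V \<subseteq> \<Omega>"
      by blast
    have "Q z x" if z: "z \<in> U" and x: "x \<in> M" for z x
    proof (cases "x \<in> K")
      case True
      then have "(z, x) \<in> \<Omega>" using V z by blast
      then show ?thesis by (simp add: \<Omega>_def)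
    next
      case False
      have zZ: "z \<in> Z" using z U openin_imp_subset by blast
      have "open (X \<inter> r -` (- K))"
        using continuous_open_preimage[OF C1o_imp_continuous_on[OF C1_r] open_X] compact_imp_closed[OF K(1)] by blast
      then have "Dif (H z) x = Dif (H z0) x"
      proof (rule Dif_cong)
        show "x \<in> X \<inter> r -` (- K)" using x False M_sub r_id[OF x] by auto
        show "H z0 y = H z y" if "y \<in> X \<inter> r -` (- K)" for y
          using K(3)[OF zZ z0, of "r y"] r_in that by (simp add: H_def)
        show "H z0 differentiable at x"
          using H z0 x M_sub by (auto simp: C1_fam_def)
      qed
      moreover have "G z x = G z0 x" using K(3)[OF zZ z0] x False by blast
      ultimately show ?thesis using Q0[OF x] by (simp add: Q_def)
    qed
    then show "\<exists>T. openin (top_of_set Z) T \<and> z0 \<in> T \<and> T \<subseteq> (\<lambda>z. restrict (G z) M) -` W \<inter> topspace (top_of_set Z)"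
      using U iff openin_imp_subset[OF U(1)] by (intro exI[of _ U]) auto
  qed
qed

end


section \<open>Diffeomorphisms close to the identity\<close>

lemma near_id_bound:
  fixes A :: "'a::euclidean_space \<Rightarrow>\<^sub>L 'a"
  assumes "norm (A - id_blinfun) \<le> 1/2"
  shows "norm v \<le> 2 * norm (blinfun_apply A v)"
proof -
  have "norm (blinfun_apply A v - v) \<le> 1/2 * norm v"
    using norm_blinfun[of "A - id_blinfun" v] mult_right_mono[OF assms, of "norm v"]
    by (simp add: minus_blinfun.rep_eq)
  moreover have "norm v \<le> norm (blinfun_apply A v) + norm (blinfun_apply A v - v)"
    using norm_triangle_ineq4[of "blinfun_apply A v" "blinfun_apply A v - v"] by simp
  ultimately show ?thesis by simp
qed

text \<open>The inverse function theorem provides a differentiable local inverse; the point to be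
  added is that its derivative varies continuously.\<close>

lemma local_C1_inverse:
  fixes G :: "'a::euclidean_space \<Rightarrow> 'a"
  assumes U: "open U" and G: "C1o U G" and p: "p \<in> U" and near: "norm (Dif G p - id_blinfun) < 1/2"
  shows "\<exists>U' V \<Gamma>. open U' \<and> p \<in> U' \<and> open V \<and> G p \<in> V \<and> C1o V \<Gamma> \<and> (\<forall>x\<in>U'. G x \<in> V \<and> \<Gamma> (G x) = x)"
proof -
  define U0 where "U0 = U \<inter> Dif G -` ball id_blinfun (1/2)"
  have U0: "open U0" "p \<in> U0" "U0 \<subseteq> U"
    using continuous_open_preimage[OF C1o_Dif[OF G] U open_ball] p near
    by (auto simp: U0_def dist_norm norm_minus_commute)
  have b: "norm v \<le> 2 * norm (blinfun_apply (Dif G x) v)" if "x \<in> U0" for x v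
    using that by (intro near_id_bound) (auto simp: U0_def dist_norm norm_minus_commute)
  have inj: "inj (blinfun_apply (Dif G p))"
  proof (rule injI)
    fix v w assume "blinfun_apply (Dif G p) v = blinfun_apply (Dif G p) w"
    then show "v = w" using b[OF U0(2), of "v - w"] by (simp add: blinfun.diff_right)
  qed
  obtain h where h: "linear h" "\<And>x. h (blinfun_apply (Dif G p) x) = x"
    using linear_injective_isomorphism[OF bounded_linear.linear[OF blinfun.bounded_linear_right] inj] by blast
  have "Blinfun h o\<^sub>L Dif G p = id_blinfun"
    by (rule blinfun_eqI) (use h in \<open>simp add: bounded_linear_Blinfun_apply linear_conv_bounded_linear\<close>)
  then obtain U' V \<Gamma> g' where U': "open U'" "U' \<subseteq> U0" "p \<in> U'" and V: "open V" "G p \<in> V" "homeomorphism U' V G \<Gamma>"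
    and der: "\<And>y. y \<in> V \<Longrightarrow> (\<Gamma> has_derivative (g' y)) (at y)"
    and g': "\<And>y. y \<in> V \<Longrightarrow> g' y = inv_into UNIV (blinfun_apply (Dif G (\<Gamma> y)))"
    and bij: "\<And>y. y \<in> V \<Longrightarrow> bij (blinfun_apply (Dif G (\<Gamma> y)))"
    using inverse_function_theorem[OF U0(1) C1o_D[OF C1o_mono[OF G U0(3)]] C1o_Dif[OF C1o_mono[OF G U0(3)]] U0(2)]
    by metis
  have \<Gamma>U: "\<Gamma> y \<in> U0" if "y \<in> V" for y
    using V(3) U'(2) that unfolding homeomorphism_def by blast
  define A where "A y = Blinfun (g' y)" for y
  have A: "blinfun_apply (A y) = g' y" if "y \<in> V" for y
    unfolding A_def using der[OF that] has_derivative_bounded_linear by (intro bounded_linear_Blinfun_apply) blast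
  have AB: "blinfun_apply (Dif G (\<Gamma> y)) (blinfun_apply (A y) v) = v"
       "blinfun_apply (A y) (blinfun_apply (Dif G (\<Gamma> y)) v) = v" if "y \<in> V" for y v
    unfolding A[OF that] g'[OF that] using bij[OF that] by (simp_all add: bij_is_surj surj_f_inv_f bij_is_inj)
  have nA: "norm (A y) \<le> 2" if "y \<in> V" for y
  proof (rule norm_blinfun_bound)
    show "norm (blinfun_apply (A y) v) \<le> 2 * norm v" for v
      using b[OF \<Gamma>U[OF that], of "blinfun_apply (A y) v"] AB(1)[OF that] by simp
  qed simp
  have c\<Gamma>: "continuous_on V (\<lambda>y. Dif G (\<Gamma> y))"
    by (rule continuous_on_compose2[OF C1o_Dif[OF C1o_mono[OF G U0(3)]]])
      (use V(3) U'(2) in \<open>simp_all add: homeomorphism_def image_subset_iff\<close>)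
  have "continuous_on V A"
    unfolding continuous_on_iff
  proof (intro ballI allI impI)
    fix y0 and e :: real assume y0: "y0 \<in> V" and e: "e > 0"
    then obtain d where d: "d > 0" "\<And>y. y \<in> V \<Longrightarrow> dist y y0 < d \<Longrightarrow> dist (Dif G (\<Gamma> y)) (Dif G (\<Gamma> y0)) < e / 4"
      using c\<Gamma> unfolding continuous_on_iff by (metis divide_pos_pos zero_less_numeral)
    have "dist (A y) (A y0) < e" if y: "y \<in> V" "dist y y0 < d" for y
    proof -
      \<comment> \<open>Resolvent identity for inverses. The two outer factors have norm at most 2,
        which explains the e / 4 above.\<close>
      have "A y - A y0 = A y o\<^sub>L ((Dif G (\<Gamma> y0) - Dif G (\<Gamma> y)) o\<^sub>L A y0)"
        by (rule blinfun_eqI) (simp add: minus_blinfun.rep_eq blinfun.diff_right AB[OF y0] AB[OF y(1)])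
      then have "norm (A y - A y0) \<le> norm (A y) * (norm (Dif G (\<Gamma> y0) - Dif G (\<Gamma> y)) * norm (A y0))"
        by (simp only:) (rule order_trans[OF norm_blinfun_compose mult_left_mono[OF norm_blinfun_compose norm_ge_zero]])
      also have "\<dots> \<le> 2 * (norm (Dif G (\<Gamma> y0) - Dif G (\<Gamma> y)) * 2)"
        using nA[OF y(1)] nA[OF y0] by (intro mult_mono) auto
      also have "\<dots> < e" using d(2)[OF y] by (simp add: dist_norm norm_minus_commute)
      finally show ?thesis by (simp add: dist_norm)
    qed
    with d(1) show "\<exists>d>0. \<forall>x'\<in>V. dist x' y0 < d \<longrightarrow> dist (A x') (A y0) < e" by blast
  qed
  then have "C1o V \<Gamma>"
    by (rule C1oI[rotated]) (use der A in simp)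
  moreover have "G x \<in> V \<and> \<Gamma> (G x) = x" if "x \<in> U'" for x
    using V(3) that unfolding homeomorphism_def by blast
  ultimately show ?thesis
    using U' V by (intro exI[of _ U'] exI[of _ V] exI[of _ \<Gamma>]) simp
qed

lemma C1_on_cong:
  assumes "C1_on S f" "\<And>x. x \<in> S \<Longrightarrow> g x = f x"
  shows "C1_on S g"
  using assms unfolding C1_on_def by simp

context C1_retract
begin

text \<open>A segment between points of M may leave M, but each of its points is within 1/2 of one
  of the ends, hence in X, where \<open>Dif r\<close> has norm at most 2. Because \<zeta> factors
  through \<open>r\<close>, its derivative there is at most twice the bound b on M.\<close>

lemma Lipschitz_near:
  fixes \<zeta> :: "'b \<Rightarrow> 'c::euclidean_space"
  assumes C: "C1o X \<zeta>" and rr: "\<And>x. x \<in> X \<Longrightarrow> \<zeta> (r x) = \<zeta> x"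
    and b: "\<And>x. x \<in> M \<Longrightarrow> norm (Dif \<zeta> x) \<le> b" and xy: "x \<in> M" "y \<in> M" "dist x y < 1"
  shows "norm (\<zeta> x - \<zeta> y) \<le> 2 * b * norm (x - y)"
proof -
  let ?S = "closed_segment x y"
  have S: "z \<in> X \<and> norm (Dif r z) \<le> 2" if "z \<in> ?S" for z
  proof -
    have "dist x z < 1/2 \<or> dist y z < 1/2"
    proof (rule ccontr)
      assume "\<not> ?thesis"
      then have "dist x z + dist z y \<ge> 1" by (auto simp: dist_commute)
      moreover have "dist x z + dist z y = dist x y" using that by (simp add: between_mem_segment[symmetric] between)
      ultimately show False using xy by simp
    qed
    then show ?thesis using near_M xy by blast
  qed
  have "b \<ge> 0" using b[OF xy(1)] norm_ge_zero order_trans by blast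
  have "onorm (blinfun_apply (Dif \<zeta> z)) \<le> 2 * b" if "z \<in> ?S" for z
  proof -
    have z: "z \<in> X" "norm (Dif r z) \<le> 2" using S that by auto
    have "Dif \<zeta> z = Dif (\<lambda>x. \<zeta> (r x)) z"
      by (rule sym, rule Dif_cong[OF open_X z(1)]) (use C z rr in \<open>auto simp: C1o_def\<close>)
    also have "\<dots> = Dif \<zeta> (r z) o\<^sub>L Dif r z"
      by (rule Dif_compose[OF C1_r C]) (use z r_in M_sub in auto)
    finally have "norm (Dif \<zeta> z) \<le> norm (Dif \<zeta> (r z)) * norm (Dif r z)"
      by (metis norm_blinfun_compose)
    also have "\<dots> \<le> b * 2" by (rule mult_mono) (use b r_in z \<open>b \<ge> 0\<close> in auto)
    finally show ?thesis by (simp add: norm_blinfun.rep_eq mult.commute)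
  qed
  then show ?thesis
    by (intro differentiable_bound[where S = ?S and f' = "\<lambda>z. blinfun_apply (Dif \<zeta> z)"])
      (use S C1o_D[OF C] in \<open>auto intro: has_derivative_at_withinI\<close>)
qed

lemma Diff_cI:
  assumes f: "C1o X f" "\<And>x. x \<in> M \<Longrightarrow> f x \<in> M" and g: "C1o X g" "\<And>x. x \<in> M \<Longrightarrow> g x \<in> M"
    and gf: "\<And>x. x \<in> M \<Longrightarrow> g (f x) = x" and fg: "\<And>x. x \<in> M \<Longrightarrow> f (g x) = x"
    and K: "compact K" "K \<subseteq> M" "\<And>x. x \<in> M - K \<Longrightarrow> f x = x"
  shows "restrict f M \<in> Diff_c M"
proof -
  have bij: "bij_betw f M M"
    by (rule bij_betw_byWitness[where f' = g]) (use f g gf fg in auto)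
  then have bij': "bij_betw (restrict f M) M M" by (simp cong: bij_betw_cong)
  have inv: "inv_into M (restrict f M) x = g x" if "x \<in> M" for x
    by (rule inv_into_f_eq) (use bij' that g fg in \<open>auto simp: bij_betw_def\<close>)
  have "C1_on M (restrict f M)" "C1_on M (inv_into M (restrict f M))"
    using C1_on_cong[OF C1_onI_r[OF f(1)]] C1_on_cong[OF C1_onI_r[OF g(1)]] inv by simp_all
  then show ?thesis using bij' K unfolding Diff_c_def Bij_def by auto
qed

lemma Diff_cE:
  assumes "\<phi> \<in> Diff_c M"
  obtains f g K where "C1o X f" "\<forall>x\<in>X. f x = \<phi> (r x) \<and> f x \<in> M"
    "C1o X g" "\<forall>x\<in>X. g (r x) = g x \<and> g x \<in> M" "\<forall>x\<in>M. g (\<phi> x) = x \<and> \<phi> (g x) = x"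
    "compact K" "K \<subseteq> M" "\<forall>x\<in>M - K. \<phi> x = x"
proof -
  have bij: "bij_betw \<phi> M M" and C: "C1_on M \<phi>" "C1_on M (inv_into M \<phi>)"
    and "\<exists>K. compact K \<and> K \<subseteq> M \<and> (\<forall>x\<in>M - K. \<phi> x = x)"
    using assms unfolding Diff_c_def Bij_def by auto
  then obtain K where K: "compact K" "K \<subseteq> M" "\<forall>x\<in>M - K. \<phi> x = x" by blast
  have im: "\<phi> x \<in> M" "inv_into M \<phi> x \<in> M" if "x \<in> M" for x
    using bij that by (auto simp: bij_betw_def inv_into_into)
  show ?thesis
    by (rule that[of "\<lambda>x. \<phi> (r x)" "\<lambda>x. inv_into M \<phi> (r x)" K])
      (use C K im bij r_in r_id M_sub in \<open>auto intro: C1o_compose_r simp: bij_betw_inv_into_left bij_betw_inv_into_right\<close>)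
qed

text \<open>The displacement \<zeta> is 1/2-Lipschitz on M: for points closer than 1 by the
  derivative bound, for other points because two displacements add up to at most 1/2. This gives
  injectivity and an inverse with Lipschitz constant 2; surjectivity comes from
  \<open>surj_M\<close>.\<close>

lemma near_id_Diff_c:
  assumes f: "C1o X f" "\<And>x. x \<in> X \<Longrightarrow> f (r x) = f x" "\<And>x. x \<in> X \<Longrightarrow> f x \<in> M"
    and K: "compact K" "K \<subseteq> M" "\<And>x. x \<in> M - K \<Longrightarrow> f x = x"
    and b: "\<And>x. x \<in> M \<Longrightarrow> norm (f x - x) \<le> 1/4" "\<And>x. x \<in> M \<Longrightarrow> norm (Dif (\<lambda>y. f y - r y) x) \<le> 1/8"
  shows "restrict f M \<in> Diff_c M"
proof -
  define \<zeta> where "\<zeta> y = f y - r y" for y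
  have \<zeta>: "C1o X \<zeta>" unfolding \<zeta>_def by (intro C1o_diff f C1_r)
  have \<zeta>M: "\<zeta> x = f x - x" if "x \<in> M" for x using that r_id by (simp add: \<zeta>_def)
  have lip: "norm (\<zeta> x - \<zeta> y) \<le> 1/2 * norm (x - y)" if xy: "x \<in> M" "y \<in> M" for x y
  proof (cases "dist x y < 1")
    case True
    have "norm (\<zeta> x - \<zeta> y) \<le> 2 * (1/8) * norm (x - y)"
      by (rule Lipschitz_near[OF \<zeta>]) (use f(2) r_in r_id b(2) xy True in \<open>auto simp: \<zeta>_def[abs_def]\<close>)
    also have "\<dots> \<le> 1/2 * norm (x - y)" by simp
    finally show ?thesis .
  next
    case False
    have "norm (\<zeta> x - \<zeta> y) \<le> norm (\<zeta> x) + norm (\<zeta> y)" by (rule norm_triangle_ineq4)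
    also have "\<dots> \<le> 1/2" using b(1)[OF xy(1)] b(1)[OF xy(2)] xy by (simp add: \<zeta>M)
    also have "\<dots> \<le> 1/2 * norm (x - y)" using False by (simp add: dist_norm)
    finally show ?thesis .
  qed
  have expand: "norm (x - y) \<le> 2 * norm (f x - f y)" if "x \<in> M" "y \<in> M" for x y
  proof -
    have "x - y = (f x - f y) - (\<zeta> x - \<zeta> y)" using that by (simp add: \<zeta>M)
    then have "norm (x - y) \<le> norm (f x - f y) + norm (\<zeta> x - \<zeta> y)"
      by (metis norm_triangle_ineq4)
    then show ?thesis using lip[OF that] by simp
  qed
  have inj: "inj_on f M" by (rule inj_onI) (use expand in fastforce)
  have surj: "f ` M = M"
    by (rule surj_M[of f K]) (use f M_sub b K in \<open>auto intro: continuous_on_subset[OF C1o_imp_continuous_on]\<close>)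
  define g where "g = inv_into M f"
  have g: "g y \<in> M" "f (g y) = y" if "y \<in> M" for y
    using that surj by (auto simp: g_def inv_into_into f_inv_into_f)
  have gf: "g (f x) = x" if "x \<in> M" for x using inj that by (simp add: g_def)
  have "C1o X (\<lambda>y. g (r y))"
  proof (rule C1o_local)
    fix y0 assume y0: "y0 \<in> X"
    let ?q = "r y0" let ?p = "g ?q"
    have q: "?q \<in> M" and p: "?p \<in> M" "f ?p = ?q" using y0 r_in g by auto
    \<comment> \<open>\<open>f\<close> factors through \<open>r\<close> and so is degenerate in
      directions normal to M. \<open>G\<close> equals \<open>f\<close> on M, but its derivative
      there is close to the full ambient identity, so that the inverse function theorem
      applies.\<close>
    define G where "G y = f y + (y - r y)" for y
    have G: "C1o X G" unfolding G_def by (intro C1o_add C1o_diff f C1_r C1o_id)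
    have GM: "G x = f x" if "x \<in> M" for x using that r_id by (simp add: G_def)
    have *: "Dif G x = Dif \<zeta> x + id_blinfun" if "x \<in> X" for x
    proof -
      have "((\<lambda>y. \<zeta> y + y) has_derivative blinfun_apply (Dif \<zeta> x + id_blinfun)) (at x)"
        using has_derivative_add[OF C1o_D[OF \<zeta> that] has_derivative_ident]
        by (simp add: plus_blinfun.rep_eq id_blinfun.rep_eq)
      then show ?thesis by (intro Dif_eqI) (simp add: G_def[abs_def] \<zeta>_def algebra_simps)
    qed
    have "norm (Dif G ?p - id_blinfun) < 1/2"
    proof -
      have "Dif G ?p - id_blinfun = Dif \<zeta> ?p" using subsetD[OF M_sub p(1)] * by simp
      then show ?thesis using b(2)[OF p(1)] unfolding \<zeta>_def[abs_def] by simp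
    qed
    from local_C1_inverse[OF open_X G subsetD[OF M_sub p(1)] this]
    obtain U' V \<Gamma> where U': "open U'" "?p \<in> U'" "open V" "G ?p \<in> V" "C1o V \<Gamma>"
        and \<Gamma>: "\<forall>x\<in>U'. G x \<in> V \<and> \<Gamma> (G x) = x"
      by (elim exE conjE)
    obtain e' where e': "e' > 0" "ball ?p e' \<subseteq> U'"
      using U'(1,2) by (meson openE)
    \<comment> \<open>The inverse of f at most doubles distances, so points of M within e of ?q have
      their preimages in the ball of radius e'.\<close>
    define e where "e = e' / 2"
    have e: "e > 0" "ball ?p (2 * e) \<subseteq> U'" using e' by (auto simp: e_def)
    define N where "N = X \<inter> r -` (V \<inter> ball ?q e)"
    have N: "open N" unfolding N_def
      by (rule continuous_open_preimage[OF C1o_imp_continuous_on[OF C1_r] open_X]) (intro open_Int U'(3) open_ball)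
    have eq: "\<Gamma> (r y) = g (r y)" if "y \<in> N" for y
    proof -
      have ry: "r y \<in> M" "dist ?q (r y) < e" using that r_in by (auto simp: N_def)
      have "norm (?p - g (r y)) \<le> 2 * norm (f ?p - f (g (r y)))"
        by (rule expand) (use p g ry in auto)
      then have "g (r y) \<in> ball ?p (2 * e)" using ry p g by (simp add: dist_norm)
      then have "\<Gamma> (G (g (r y))) = g (r y)" using e(2) \<Gamma> by auto
      then show ?thesis using GM g ry by simp
    qed
    have "C1o N (\<lambda>y. \<Gamma> (r y))"
      by (rule C1o_compose[OF C1o_mono[OF C1_r] U'(5)]) (auto simp: N_def)
    then have "C1o N (\<lambda>y. g (r y))" by (rule C1o_cong) (use N eq in auto)
    moreover have "y0 \<in> N" using y0 U'(4) GM[OF p(1)] p(2) e by (simp add: N_def)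
    ultimately show "\<exists>V. open V \<and> y0 \<in> V \<and> C1o V (\<lambda>y. g (r y))" using N by (intro exI[of _ N]) simp
  qed
  then show ?thesis
    by (intro Diff_cI[of f "\<lambda>y. g (r y)" K]) (use f g gf K r_id M_sub in auto)
qed

end


section \<open>Rigidity of involutions\<close>

lemma (in C1_retract) involution_rigid:
  assumes \<phi>: "\<phi> \<in> Diff_c M" and inv: "\<And>x. x \<in> M \<Longrightarrow> \<phi> (\<phi> x) = x"
    and p: "p \<in> M" "\<phi> p = p" "Dif (\<lambda>x. \<phi> (r x)) p = Dif r p" and x: "x \<in> M"
  shows "\<phi> x = x"
proof -
  define F where "F x = \<phi> (r x)" for x
  have \<phi>M: "\<phi> y \<in> M" if "y \<in> M" for y
    using \<phi> that by (auto simp: Diff_c_def Bij_def bij_betw_def)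
  have F: "C1o X F" unfolding F_def
    by (rule C1o_compose_r) (use \<phi> in \<open>simp add: Diff_c_def\<close>)
  have FM: "F y = \<phi> y" if "y \<in> M" for y using r_id[OF that] by (simp add: F_def)
  define \<eta> where "\<eta> y = F y - r y" for y
  have \<eta>: "C1o X \<eta>" unfolding \<eta>_def by (rule C1o_diff[OF F C1_r])
  have D\<eta>: "Dif \<eta> y = Dif F y - Dif r y" if "y \<in> X" for y
    using has_derivative_diff[OF C1o_D[OF F that] C1o_D[OF C1_r that]]
    by (intro Dif_eqI) (simp add: \<eta>_def[abs_def] minus_blinfun.rep_eq)
  \<comment> \<open>W records derivatives as well as values: the local argument can start at a limit
    point of fixed points only if the derivative there is trivial too. W is closed by continuity,
    and the local argument makes it open in the connected M.\<close>
  define W where "W = {y \<in> M. \<eta> y = 0} \<inter> {y \<in> M. Dif \<eta> y = 0}"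
  have W: "W \<subseteq> M" by (auto simp: W_def)
  have "closedin (top_of_set M) W" unfolding W_def
    by (intro closedin_Int continuous_closedin_preimage_constant
        continuous_on_subset[OF C1o_imp_continuous_on[OF \<eta>] M_sub] continuous_on_subset[OF C1o_Dif[OF \<eta>] M_sub])
  moreover have "openin (top_of_set M) W"
  proof (subst openin_subopen, intro ballI)
    fix y assume y: "y \<in> W"
    then have yM: "y \<in> M" and yX: "y \<in> X" and \<eta>y: "\<eta> y = 0" "Dif \<eta> y = 0" using M_sub by (auto simp: W_def)
    have "open (X \<inter> Dif \<eta> -` ball 0 1)"
      by (rule continuous_open_preimage[OF C1o_Dif[OF \<eta>] open_X open_ball])
    moreover have "y \<in> X \<inter> Dif \<eta> -` ball 0 1" using yX \<eta>y by simp
    ultimately obtain d where d: "d > 0" "ball y d \<subseteq> X \<inter> Dif \<eta> -` ball 0 1" by (rule openE)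
    define N where "N = X \<inter> F -` ball y d \<inter> (X \<inter> r -` ball y d)"
    have N: "open N" unfolding N_def
      by (intro open_Int continuous_open_preimage[OF C1o_imp_continuous_on[OF F] open_X open_ball]
          continuous_open_preimage[OF C1o_imp_continuous_on[OF C1_r] open_X open_ball])
    have yN: "y \<in> N" using yX \<eta>y r_id[OF yM] d(1) by (simp add: N_def \<eta>_def)
    have fixed: "\<phi> z = z" if z: "z \<in> M" "z \<in> ball y d" "\<phi> z \<in> ball y d" for z
    proof -
      \<comment> \<open>An involution reverses the displacement between z and its image, so the left
        side is twice the displacement; any Lipschitz constant below 2 forces it to vanish.\<close>
      have "norm (\<eta> z - \<eta> (\<phi> z)) \<le> 1 * norm (z - \<phi> z)"
      proof (rule differentiable_bound[where S = "ball y d" and f' = "\<lambda>z. blinfun_apply (Dif \<eta> z)"])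
        show "(\<eta> has_derivative blinfun_apply (Dif \<eta> w)) (at w within ball y d)" if "w \<in> ball y d" for w
          by (rule has_derivative_at_withinI[OF C1o_D[OF \<eta>]]) (use d(2) that in auto)
        show "onorm (blinfun_apply (Dif \<eta> w)) \<le> 1" if "w \<in> ball y d" for w
          using d(2) that by (auto simp: norm_blinfun.rep_eq[symmetric] less_imp_le subset_iff)
      qed (use z in auto)
      moreover have "\<eta> z = \<phi> z - z" "\<eta> (\<phi> z) = z - \<phi> z"
        using z(1) \<phi>M FM inv r_id by (simp_all add: \<eta>_def)
      then have "\<eta> z - \<eta> (\<phi> z) = 2 *\<^sub>R (\<phi> z - z)" by (simp add: scaleR_2)
      ultimately have "2 * norm (\<phi> z - z) \<le> norm (\<phi> z - z)"
        by (simp add: norm_minus_commute)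
      then show ?thesis by simp
    qed
    have \<eta>0: "\<eta> z = 0" if "z \<in> N" for z
    proof -
      have "r z \<in> M" using that r_in by (simp add: N_def)
      then have "\<phi> (r z) = r z" using that by (intro fixed) (auto simp: N_def F_def)
      then show ?thesis by (simp add: \<eta>_def F_def)
    qed
    have "Dif \<eta> z = 0" if "z \<in> N" for z
    proof -
      have "Dif \<eta> z = Dif (\<lambda>_. 0) z" by (rule Dif_cong[OF N that]) (use \<eta>0 in auto)
      also have "\<dots> = 0" by (rule Dif_eqI) (simp add: zero_blinfun.rep_eq)
      finally show ?thesis .
    qed
    with \<eta>0 have "M \<inter> N \<subseteq> W" by (auto simp: W_def)
    then show "\<exists>T. openin (top_of_set M) T \<and> y \<in> T \<and> T \<subseteq> W"
      using N yN yM by (intro exI[of _ "M \<inter> N"]) (auto simp: openin_open_Int)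
  qed
  moreover have "p \<in> W"
    using p M_sub FM r_id D\<eta>[of p] by (auto simp: W_def \<eta>_def F_def[abs_def])
  ultimately have "W = M" using conn_M unfolding connected_clopen by blast
  then have "\<eta> x = 0" using x by (auto simp: W_def)
  then show ?thesis using FM[OF x] r_id[OF x] by (simp add: \<eta>_def)
qed

section \<open>Linear algebra of the derivatives at a fixed point\<close>

text \<open>On the eigenspace of the square of Y for -1, the map Y is a complex structure, so this
  eigenspace is zero or contains a plane spanned by v and Y v. The plane meets V only in 0, hence
  complements V, which has codimension at most 2. The second alternative says that the square of Y
  is -1 on T/V.\<close>

lemma square_involution_dichotomy:
  fixes Y :: "'b::euclidean_space \<Rightarrow> 'b"
  assumes Y: "linear Y" and T: "subspace T" "\<And>t. t \<in> T \<Longrightarrow> Y t \<in> T"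
    and V: "subspace V" "V \<subseteq> T" "dim T \<le> dim V + 2"
    and inv: "\<And>t. t \<in> T \<Longrightarrow> Y (Y (Y (Y t))) = t" and fixV: "\<And>v. v \<in> V \<Longrightarrow> Y (Y v) = v"
  shows "(\<forall>t\<in>T. Y (Y t) = t) \<or> (\<forall>t\<in>T. Y (Y t) + t \<in> V)"
proof (rule disjCI)
  assume "\<not> (\<forall>t\<in>T. Y (Y t) + t \<in> V)"
  show "\<forall>t\<in>T. Y (Y t) = t"
  proof (rule ccontr)
    assume "\<not> (\<forall>t\<in>T. Y (Y t) = t)"
    then obtain t0 where t0: "t0 \<in> T" "Y (Y t0) \<noteq> t0" by blast
    \<comment> \<open>The square of Y is an involution on T, so subtracting t0 from its image lands
      in the eigenspace for -1.\<close>
    define v where "v = Y (Y t0) - t0"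
    have v: "v \<noteq> 0" "v \<in> T" "Y v \<in> T" using t0 T by (auto simp: v_def subspace_diff)
    have Xv: "Y (Y v) = - v" using inv t0 by (simp add: v_def linear_diff[OF Y])
    define E where "E = span {v, Y v}"
    have YE: "Y (Y e) = - e" if "e \<in> E" for e
      using that unfolding E_def
    proof (induction rule: span_induct_alt)
      case (step c x y)
      then show ?case using Xv by (auto simp: linear_add[OF Y] linear_cmul[OF Y] linear_neg[OF Y])
    qed (simp add: linear_0[OF Y])
    have nin: "Y v \<notin> span {v}"
    proof
      assume "Y v \<in> span {v}"
      then obtain c where c: "Y v = c *\<^sub>R v" by (auto simp: span_singleton)
      then have "Y (Y v) = (c * c) *\<^sub>R v" by (simp add: linear_cmul[OF Y])
      then have "(c * c + 1) *\<^sub>R v = - v + v" using Xv by (simp add: scaleR_add_left)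
      then have "c * c + 1 = 0" using v(1) by (metis add.left_inverse scaleR_eq_0_iff)
      then show False by (metis add_nonneg_pos less_irrefl zero_le_square zero_less_one)
    qed
    have "v \<noteq> Y v" using nin span_base by force
    moreover have "independent {v, Y v}"
      using nin v(1) by (subst insert_commute) (simp add: independent_insert)
    ultimately have dE: "dim E = 2" by (simp add: E_def dim_span dim_eq_card_independent)
    have "V \<inter> E = {0}"
    proof -
      have "w = 0" if "w \<in> V" "w \<in> E" for w
      proof -
        have "w = - w" using fixV[OF that(1)] YE[OF that(2)] by simp
        then have "2 *\<^sub>R w = 0" by (metis add.right_inverse scaleR_2)
        then show ?thesis by simp
      qed
      then show ?thesis using V(1) by (auto simp: E_def subspace_0 span_zero)
    qed
    then have "dim {x + y |x y. x \<in> V \<and> y \<in> E} = dim V + 2"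
      using dim_sums_Int[OF V(1), of E] dE by (simp add: E_def)
    moreover have "E \<subseteq> T" unfolding E_def by (rule span_minimal) (use v T in auto)
    moreover have "subspace {x + y |x y. x \<in> V \<and> y \<in> E}"
      by (rule subspace_sums) (use V in \<open>auto simp: E_def\<close>)
    ultimately have TE: "{x + y |x y. x \<in> V \<and> y \<in> E} = T"
      using V T by (intro subspace_dim_equal) (auto intro: subspace_add)
    have "Y (Y t) + t \<in> V" if t: "t \<in> T" for t
    proof -
      obtain x y where xy: "t = x + y" "x \<in> V" "y \<in> E" using t unfolding TE[symmetric] by blast
      have "Y (Y t) + t = 2 *\<^sub>R x"
        using fixV[OF xy(2)] YE[OF xy(3)] xy(1) by (simp add: linear_add[OF Y] scaleR_2)
      then show ?thesis using V(1) xy(2) by (simp add: subspace_scale)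
    qed
    then show False using \<open>\<not> (\<forall>t\<in>T. Y (Y t) + t \<in> V)\<close> by blast
  qed
qed

text \<open>If both squares are -1 on T/V, their product is the identity on T/V: it sends t to t + n
  with n in V. It also fixes V, so applying it twice gives t + 2 n. Being an involution, it has n =
  0.\<close>

lemma klein_four_dichotomy:
  fixes Y1 Y2 :: "'b::euclidean_space \<Rightarrow> 'b"
  assumes Y1: "linear Y1" "\<And>t. t \<in> T \<Longrightarrow> Y1 t \<in> T" and Y2: "linear Y2" "\<And>t. t \<in> T \<Longrightarrow> Y2 t \<in> T"
    and T: "subspace T" and V: "subspace V" "V \<subseteq> T" "dim T \<le> dim V + 2"
    and inv: "\<And>t. t \<in> T \<Longrightarrow> Y1 (Y1 (Y1 (Y1 t))) = t" "\<And>t. t \<in> T \<Longrightarrow> Y2 (Y2 (Y2 (Y2 t))) = t"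
      "\<And>t. t \<in> T \<Longrightarrow> Y1 (Y1 (Y2 (Y2 (Y1 (Y1 (Y2 (Y2 t))))))) = t"
    and fixV: "\<And>v. v \<in> V \<Longrightarrow> Y1 (Y1 v) = v" "\<And>v. v \<in> V \<Longrightarrow> Y2 (Y2 v) = v"
  shows "(\<forall>t\<in>T. Y1 (Y1 t) = t) \<or> (\<forall>t\<in>T. Y2 (Y2 t) = t) \<or> (\<forall>t\<in>T. Y1 (Y1 (Y2 (Y2 t))) = t)"
proof -
  consider "\<forall>t\<in>T. Y1 (Y1 t) = t" | "\<forall>t\<in>T. Y2 (Y2 t) = t"
    | "\<forall>t\<in>T. Y1 (Y1 t) + t \<in> V" "\<forall>t\<in>T. Y2 (Y2 t) + t \<in> V"
    using square_involution_dichotomy[OF Y1(1) T Y1(2) V inv(1) fixV(1)]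
      square_involution_dichotomy[OF Y2(1) T Y2(2) V inv(2) fixV(2)] by blast
  then show ?thesis
  proof cases
    case 3
    have "Y1 (Y1 (Y2 (Y2 t))) = t" if t: "t \<in> T" for t
    proof -
      define u where "u = Y2 (Y2 t) + t"
      define w where "w = Y1 (Y1 t) + t"
      have u: "u \<in> V" "w \<in> V" using 3 t by (auto simp: u_def w_def)
      have X2: "Y2 (Y2 t) = u - t" and X1: "Y1 (Y1 t) = w - t" by (simp_all add: u_def w_def)
      define n where "n = u - w"
      have n: "n \<in> V" using u V(1) by (simp add: n_def subspace_diff)
      have *: "Y1 (Y1 (Y2 (Y2 t))) = t + n"
        using fixV(1)[OF u(1)] X1 by (simp add: X2 linear_diff[OF Y1(1)] n_def)
      then have "Y1 (Y1 (Y2 (Y2 (t + n)))) = t"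
        using inv(3)[OF t] by simp
      moreover have "Y1 (Y1 (Y2 (Y2 (t + n)))) = t + n + n"
        using * fixV n by (simp add: linear_add[OF Y1(1)] linear_add[OF Y2(1)])
      ultimately have "2 *\<^sub>R n = 0" by (simp add: scaleR_2)
      then show ?thesis using * by simp
    qed
    then show ?thesis by blast
  qed blast+
qed

section \<open>C1 bump functions\<close>

lemma C1o_max_square: "C1o UNIV (\<lambda>t::real. (max 0 t)\<^sup>2)"
proof (rule C1oI)
  show "continuous_on UNIV (\<lambda>t::real. blinfun_scaleR_left (2 * max 0 t) :: real \<Rightarrow>\<^sub>L real)"
    by (intro bounded_linear.continuous_on[OF bounded_linear_blinfun_scaleR_left] continuous_intros)
  have d: "((\<lambda>t::real. (max 0 t)\<^sup>2) has_real_derivative (2 * max 0 x)) (at x)" for x :: real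
  proof -
    consider "x < 0" | "x = 0" | "x > 0" by linarith
    then show ?thesis
    proof cases
      case 1
      have "((\<lambda>t::real. 0) has_real_derivative 2 * max 0 x) (at x)" using 1 by simp
      then show ?thesis
        by (rule has_field_derivative_transform_within_open[where S = "{..<0}"]) (use 1 in auto)
    next
      case 3
      have "((\<lambda>t::real. t\<^sup>2) has_real_derivative 2 * max 0 x) (at x)"
        using 3 by (auto intro!: derivative_eq_intros)
      then show ?thesis
        by (rule has_field_derivative_transform_within_open[where S = "{0<..}"]) (use 3 in auto)
    next
      case 2
      have "((\<lambda>h::real. max 0 h) \<longlongrightarrow> max 0 0) (at 0)" by (intro tendsto_intros)
      moreover have "(\<lambda>h::real. (max 0 h)\<^sup>2 / h) = (\<lambda>h. max 0 h)"
        by (auto simp: fun_eq_iff max_def power2_eq_square)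
      ultimately show ?thesis using 2 by (simp add: DERIV_def)
    qed
  qed
  show "((\<lambda>t::real. (max 0 t)\<^sup>2) has_derivative blinfun_apply (blinfun_scaleR_left (2 * max 0 x))) (at x)" for x
    using d[of x] by (simp add: has_field_derivative_def mult_commute_abs)
qed

lemma C1o_dist_square: "C1o U (\<lambda>y::'b::euclidean_space. (norm (y - a))\<^sup>2)"
proof (rule C1oI)
  show "continuous_on U (\<lambda>y. blinfun_inner_left (2 *\<^sub>R (y - a)))"
    by (intro bounded_linear.continuous_on[OF bounded_linear_blinfun_inner_left] continuous_intros)
  show "((\<lambda>y. (norm (y - a))\<^sup>2) has_derivative blinfun_apply (blinfun_inner_left (2 *\<^sub>R (y - a)))) (at y)" for y
    unfolding power2_norm_eq_inner by (auto intro!: derivative_eq_intros simp: inner_commute)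
qed

lemma C1_bump:
  fixes A :: "'b::euclidean_space set"
  assumes A: "compact A" and N: "open N" "A \<subseteq> N"
  obtains \<beta> :: "'b \<Rightarrow> real" and K where "C1o UNIV \<beta>" "compact K" "K \<subseteq> N"
    "\<And>y. y \<in> A \<Longrightarrow> \<beta> y = 1" "\<And>y. y \<notin> K \<Longrightarrow> \<beta> y = 0"
proof -
  have "\<forall>a\<in>A. \<exists>\<rho>>0. cball a \<rho> \<subseteq> N" using N open_contains_cball by blast
  then obtain \<rho> where \<rho>: "\<And>a. a \<in> A \<Longrightarrow> \<rho> a > 0 \<and> cball a (\<rho> a) \<subseteq> N" by metis
  obtain C where C: "C \<subseteq> A" "finite C" "A \<subseteq> (\<Union>a\<in>C. ball a (\<rho> a / 2))"
    by (rule compactE_image[OF A, of A "\<lambda>a. ball a (\<rho> a / 2)"]) (use \<rho> in auto)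
  \<comment> \<open>b a vanishes outside the ball of radius \<rho> a and is at least 9/16, the
    square of 3/4, on the ball of half that radius. Hence the factor 16/9 makes the sum at least 1
    on A. As h is 0 at 0 and constantly 1 from 1 on, \<beta> is exactly 1 on A.\<close>
  define b where "b a y = (max 0 (1 + (- 1 / (\<rho> a)\<^sup>2) *\<^sub>R (norm (y - a))\<^sup>2))\<^sup>2" for a y :: 'b
  define h where "h t = 1 - (max 0 (1 - t))\<^sup>2" for t :: real
  define \<beta> where "\<beta> y = h ((16/9) *\<^sub>R (\<Sum>a\<in>C. b a y))" for y
  have "C1o UNIV (b a)" for a unfolding b_def
    by (intro C1o_compose[OF _ C1o_max_square] C1o_add C1o_scaleR C1o_const C1o_dist_square) auto
  moreover have "C1o UNIV h" unfolding h_def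
    by (intro C1o_diff C1o_const C1o_id C1o_compose[OF _ C1o_max_square]) auto
  ultimately have "C1o UNIV \<beta>" unfolding \<beta>_def
    by (intro C1o_compose[OF _ \<open>C1o UNIV h\<close>] C1o_scaleR C1o_const C1o_sum C) auto
  moreover have "compact (\<Union>a\<in>C. cball a (\<rho> a))" using C by (intro compact_UN) auto
  moreover have "(\<Union>a\<in>C. cball a (\<rho> a)) \<subseteq> N" using C \<rho> by blast
  moreover have "\<beta> y = 1" if y: "y \<in> A" for y
  proof -
    obtain a where a: "a \<in> C" "y \<in> ball a (\<rho> a / 2)" using C y by blast
    have pos: "\<rho> a > 0" using a C \<rho> by blast
    have "(norm (y - a))\<^sup>2 \<le> (\<rho> a / 2)\<^sup>2"
      using a(2) by (intro power_mono) (auto simp: dist_norm norm_minus_commute)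
    then have "(norm (y - a))\<^sup>2 / (\<rho> a)\<^sup>2 \<le> 1/4"
      using pos by (simp add: field_simps power2_eq_square)
    then have "3/4 \<le> 1 + (- 1 / (\<rho> a)\<^sup>2) *\<^sub>R (norm (y - a))\<^sup>2" by simp
    then have "3/4 \<le> max 0 (1 + (- 1 / (\<rho> a)\<^sup>2) *\<^sub>R (norm (y - a))\<^sup>2)" by (rule max.coboundedI2)
    then have "(3/4)\<^sup>2 \<le> b a y" unfolding b_def by (rule power_mono) simp
    also have "b a y \<le> (\<Sum>a\<in>C. b a y)"
      by (rule member_le_sum) (use a C in \<open>auto simp: b_def\<close>)
    finally show ?thesis by (simp add: \<beta>_def h_def power2_eq_square max_def)
  qed
  moreover have "\<beta> y = 0" if y: "y \<notin> (\<Union>a\<in>C. cball a (\<rho> a))" for y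
  proof -
    have "b a y = 0" if a: "a \<in> C" for a
    proof -
      have pos: "\<rho> a > 0" using a C \<rho> by blast
      have "\<rho> a \<le> norm (y - a)" using y a by (auto simp: dist_norm norm_minus_commute)
      then have "(\<rho> a)\<^sup>2 \<le> (norm (y - a))\<^sup>2" using pos by (intro power_mono) auto
      then have "1 \<le> (norm (y - a))\<^sup>2 / (\<rho> a)\<^sup>2" using pos by (simp add: field_simps)
      then show ?thesis by (simp add: b_def)
    qed
    then show ?thesis by (simp add: \<beta>_def h_def)
  qed
  ultimately show thesis by (rule that)
qed


section \<open>Paths of diffeomorphisms\<close>

lemma C1_fam_cases:
  fixes G H :: "real \<Rightarrow> 'a::euclidean_space \<Rightarrow> 'b::euclidean_space"
  assumes G: "C1_fam {a..b} U G" and H: "C1_fam {b..c} U H" and U: "open U"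
    and eq: "\<And>x. x \<in> U \<Longrightarrow> G b x = H b x" and abc: "a \<le> b" "b \<le> c"
  shows "C1_fam {a..c} U (\<lambda>u. if u \<le> b then G u else H u)"
proof (rule C1_famI[where G' = "\<lambda>u x. if u \<le> b then Dif (G u) x else Dif (H u) x"])
  show "((if u \<le> b then G u else H u) has_derivative blinfun_apply (if u \<le> b then Dif (G u) x else Dif (H u) x)) (at x)"
    if "u \<in> {a..c}" "x \<in> U" for u x
    using C1_fam_D[OF G, of u x] C1_fam_D[OF H, of u x] that by auto
  have sub: "{p \<in> {a..c} \<times> U. fst p \<le> b} = {a..b} \<times> U" "{p \<in> {a..c} \<times> U. b \<le> fst p} = {b..c} \<times> U"
    using abc by auto
  have "continuous_on ({a..c} \<times> U) (\<lambda>p. if fst p \<le> b then G (fst p) (snd p) else H (fst p) (snd p))"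
    by (rule continuous_on_cases_le) (use C1_fam_cont[OF G] C1_fam_cont[OF H] eq in \<open>auto simp: sub intro: continuous_intros\<close>)
  then show "continuous_on ({a..c} \<times> U) (\<lambda>p. (if fst p \<le> b then G (fst p) else H (fst p)) (snd p))"
    by (simp add: if_distribR)
  have "Dif (G b) x = Dif (H b) x" if "x \<in> U" for x
    by (rule Dif_cong[OF U that]) (use eq C1_fam_D[OF H] abc that in \<open>auto simp: differentiable_def\<close>)
  then show "continuous_on ({a..c} \<times> U) (\<lambda>p. if fst p \<le> b then Dif (G (fst p)) (snd p) else Dif (H (fst p)) (snd p))"
    by (intro continuous_on_cases_le) (use C1_fam_Dif[OF G] C1_fam_Dif[OF H] in \<open>auto simp: sub intro: continuous_intros\<close>)
qed

lemma compact_tube_less: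
  fixes f :: "'z::t2_space \<times> 'a::t2_space \<Rightarrow> real"
  assumes f: "continuous_on (Z \<times> K) f" and K: "compact K" and z: "z0 \<in> Z" "\<And>y. y \<in> K \<Longrightarrow> f (z0, y) < c"
  obtains U where "open U" "z0 \<in> U" "\<And>z y. z \<in> U \<Longrightarrow> z \<in> Z \<Longrightarrow> y \<in> K \<Longrightarrow> f (z, y) < c"
proof -
  define \<Omega> where "\<Omega> = Z \<times> K \<inter> f -` {..<c}"
  have "openin (prod_topology (top_of_set Z) (top_of_set K)) \<Omega>"
    unfolding prod_topology_subtopology_eu \<Omega>_def by (rule continuous_openin_preimage_gen[OF f]) simp
  moreover have "compactin (top_of_set K) K" using K by (simp add: compactin_subtopology)
  moreover have "z0 \<in> topspace (top_of_set Z)" using z by simp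
  moreover have "{z0} \<times> K \<subseteq> \<Omega>" using z by (auto simp: \<Omega>_def)
  ultimately have "\<exists>U V. openin (top_of_set Z) U \<and> openin (top_of_set K) V \<and> z0 \<in> U \<and> K \<subseteq> V \<and> U \<times> V \<subseteq> \<Omega>"
    by (rule tube_lemma_right)
  then obtain U V where U: "openin (top_of_set Z) U" "z0 \<in> U" and V: "K \<subseteq> V" "U \<times> V \<subseteq> \<Omega>" by blast
  from U(1) obtain W where W: "open W" "U = Z \<inter> W" by (auto simp: openin_open)
  show thesis
  proof (rule that[OF W(1)])
    show "z0 \<in> W" using U W by simp
    show "f (z, y) < c" if "z \<in> W" "z \<in> Z" "y \<in> K" for z y
    proof -
      have "(z, y) \<in> \<Omega>" using that V W by blast
      then show ?thesis by (simp add: \<Omega>_def)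
    qed
  qed
qed

lemma (in C1_retract) Diff_c_compose:
  assumes "\<phi> \<in> Diff_c M" "\<psi> \<in> Diff_c M"
  shows "restrict (\<lambda>x. \<phi> (\<psi> x)) M \<in> Diff_c M"
proof -
  obtain f g K where f: "C1o X f" "\<forall>x\<in>X. f x = \<phi> (r x) \<and> f x \<in> M"
    "C1o X g" "\<forall>x\<in>X. g (r x) = g x \<and> g x \<in> M" "\<forall>x\<in>M. g (\<phi> x) = x \<and> \<phi> (g x) = x"
    "compact K" "K \<subseteq> M" "\<forall>x\<in>M - K. \<phi> x = x"
    by (rule Diff_cE[OF assms(1)])
  obtain f' g' K' where f': "C1o X f'" "\<forall>x\<in>X. f' x = \<psi> (r x) \<and> f' x \<in> M"
    "C1o X g'" "\<forall>x\<in>X. g' (r x) = g' x \<and> g' x \<in> M" "\<forall>x\<in>M. g' (\<psi> x) = x \<and> \<psi> (g' x) = x"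
    "compact K'" "K' \<subseteq> M" "\<forall>x\<in>M - K'. \<psi> x = x"
    by (rule Diff_cE[OF assms(2)])
  have MX: "x \<in> X" if "x \<in> M" for x using that M_sub by blast
  have eq: "f x = \<phi> x" "f' x = \<psi> x" if "x \<in> M" for x using f(2) f'(2) MX[OF that] r_id[OF that] by auto
  have im: "\<phi> x \<in> M" "\<psi> x \<in> M" "g x \<in> M" "g' x \<in> M" if "x \<in> M" for x
    using f(2,4) f'(2,4) MX[OF that] eq[OF that] by metis+
  have "restrict (\<lambda>x. f (f' x)) M \<in> Diff_c M"
  proof (rule Diff_cI[where g = "\<lambda>x. g' (g x)" and K = "K \<union> K'"])
    show "C1o X (\<lambda>x. f (f' x))" by (rule C1o_compose[OF f'(1) f(1)]) (use f' MX in blast)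
    show "C1o X (\<lambda>x. g' (g x))" by (rule C1o_compose[OF f(3) f'(3)]) (use f MX in blast)
    show "compact (K \<union> K')" using f f' by blast
    show "K \<union> K' \<subseteq> M" using f f' by blast
    show "f (f' x) = x" if "x \<in> M - (K \<union> K')" for x using that f(8) f'(8) eq by auto
    fix x assume x: "x \<in> M"
    show "f (f' x) \<in> M" "g' (g x) \<in> M" using x im eq by auto
    show "g' (g (f (f' x))) = x" using eq f'(5) f(5) im x by auto
    show "f (f' (g' (g x))) = x" using eq f'(5) f(5) im x by auto
  qed
  moreover have "restrict (\<lambda>x. f (f' x)) M = restrict (\<lambda>x. \<phi> (\<psi> x)) M"
    using eq im by (intro restrict_ext) simp
  ultimately show ?thesis by simp
qed

text \<open>The condition \<open>G u (r x) = G u x\<close> makes the extension off M canonical, so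
  that families can be composed and differentiated on X. The common compact support is what makes
  the path continuous in the Whitney topology.\<close>

definition (in C1_retract) Diff_path :: "real \<Rightarrow> real \<Rightarrow> (real \<Rightarrow> 'b \<Rightarrow> 'b) \<Rightarrow> bool" where
  "Diff_path a b G \<longleftrightarrow> C1_fam {a..b} X G \<and> (\<forall>u\<in>{a..b}. \<forall>x\<in>X. G u (r x) = G u x \<and> G u x \<in> M) \<and>
     (\<forall>u\<in>{a..b}. restrict (G u) M \<in> Diff_c M) \<and>
     (\<exists>K. compact K \<and> K \<subseteq> M \<and> (\<forall>u\<in>{a..b}. \<forall>x\<in>M - K. G u x = x))"

lemma (in C1_retract) Diff_path_join:
  assumes G: "Diff_path a b G" and H: "Diff_path b c H" and Hb: "\<And>x. x \<in> X \<Longrightarrow> H b x = r x"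
    and abc: "a \<le> b" "b \<le> c"
  shows "Diff_path a c (\<lambda>u. if u \<le> b then G u else (\<lambda>x. H u (G b x)))"
proof -
  obtain K where K: "compact K" "K \<subseteq> M" "\<And>u x. u \<in> {a..b} \<Longrightarrow> x \<in> M - K \<Longrightarrow> G u x = x"
    using G unfolding Diff_path_def by blast
  obtain K' where K': "compact K'" "K' \<subseteq> M" "\<And>u x. u \<in> {b..c} \<Longrightarrow> x \<in> M - K' \<Longrightarrow> H u x = x"
    using H unfolding Diff_path_def by blast
  have G': "C1_fam {a..b} X G" "\<And>u x. u \<in> {a..b} \<Longrightarrow> x \<in> X \<Longrightarrow> G u (r x) = G u x \<and> G u x \<in> M"
    "\<And>u. u \<in> {a..b} \<Longrightarrow> restrict (G u) M \<in> Diff_c M" using G unfolding Diff_path_def by auto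
  have H': "C1_fam {b..c} X H" "\<And>u x. u \<in> {b..c} \<Longrightarrow> x \<in> X \<Longrightarrow> H u (r x) = H u x \<and> H u x \<in> M"
    "\<And>u. u \<in> {b..c} \<Longrightarrow> restrict (H u) M \<in> Diff_c M" using H unfolding Diff_path_def by auto
  have b: "b \<in> {a..b}" using abc by simp
  have HG: "C1_fam {b..c} X (\<lambda>u x. H u (G b x))"
    by (rule C1_fam_compose[OF C1_fam_fixed[OF C1_fam_at[OF G'(1) b]] H'(1)]) (use G' b M_sub in blast)
  have comp: "restrict (\<lambda>x. H u (G b x)) M \<in> Diff_c M" if u: "u \<in> {b..c}" for u
  proof -
    have "restrict (\<lambda>x. H u (G b x)) M = restrict (\<lambda>x. restrict (H u) M (restrict (G b) M x)) M"
      using G'(2)[OF b] M_sub by (intro restrict_ext) auto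
    then show ?thesis using Diff_c_compose[OF H'(3)[OF u] G'(3)[OF b]] by simp
  qed
  show ?thesis
    unfolding Diff_path_def
  proof (intro conjI ballI)
    show "C1_fam {a..c} X (\<lambda>u. if u \<le> b then G u else (\<lambda>x. H u (G b x)))"
    proof (rule C1_fam_cases[OF G'(1) HG open_X _ abc])
      show "G b x = H b (G b x)" if "x \<in> X" for x
        using G'(2)[OF b that] Hb r_id M_sub by auto
    qed
    fix u assume u: "u \<in> {a..c}"
    show "restrict (if u \<le> b then G u else (\<lambda>x. H u (G b x))) M \<in> Diff_c M"
      using G'(3)[of u] comp[of u] u by auto
    fix x assume x: "x \<in> X"
    show "(if u \<le> b then G u else (\<lambda>x. H u (G b x))) (r x) = (if u \<le> b then G u else (\<lambda>x. H u (G b x))) x"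
      using G'(2)[of u x] G'(2)[OF b x] u x by auto
    show "(if u \<le> b then G u else (\<lambda>x. H u (G b x))) x \<in> M"
      using G'(2)[of u x] G'(2)[OF b x] H'(2)[of u "G b x"] u x M_sub by auto
  next
    show "\<exists>K. compact K \<and> K \<subseteq> M \<and> (\<forall>u\<in>{a..c}. \<forall>x\<in>M - K. (if u \<le> b then G u else (\<lambda>x. H u (G b x))) x = x)"
      by (rule exI[of _ "K \<union> K'"]) (use K K' b in auto)
  qed
qed

text \<open>Rebases a path by composing with the inverse of its value at a. A local isotopy is built
  to be the identity at its centre, whereas concatenation asks for paths that are the identity at
  their left end.\<close>

lemma (in C1_retract) Diff_path_inverse_shift:
  assumes s: "Diff_path c d s" and ab: "c \<le> a" "b \<le> d" "a \<le> b"
  obtains G where "Diff_path a b G" "\<And>x. x \<in> X \<Longrightarrow> G a x = r x"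
    "\<And>u x. x \<in> M \<Longrightarrow> G u (s a x) = s u x"
proof -
  obtain K where K: "compact K" "K \<subseteq> M" "\<And>u x. u \<in> {c..d} \<Longrightarrow> x \<in> M - K \<Longrightarrow> s u x = x"
    using s unfolding Diff_path_def by blast
  have s': "C1_fam {c..d} X s" "\<And>u x. u \<in> {c..d} \<Longrightarrow> x \<in> X \<Longrightarrow> s u (r x) = s u x \<and> s u x \<in> M"
    "\<And>u. u \<in> {c..d} \<Longrightarrow> restrict (s u) M \<in> Diff_c M" using s unfolding Diff_path_def by auto
  have a: "a \<in> {c..d}" using ab by simp
  obtain f g K0 where f: "C1o X f" "\<forall>x\<in>X. f x = restrict (s a) M (r x) \<and> f x \<in> M"
    and g: "C1o X g" "\<forall>x\<in>X. g (r x) = g x \<and> g x \<in> M"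
    and gf: "\<forall>x\<in>M. g (restrict (s a) M x) = x \<and> restrict (s a) M (g x) = x"
    and "compact K0" "K0 \<subseteq> M" "\<forall>x\<in>M - K0. restrict (s a) M x = x"
    by (rule Diff_cE[OF s'(3)[OF a]])
  have MX: "x \<in> X" if "x \<in> M" for x using that M_sub by blast
  have gM: "g x \<in> M" if "x \<in> M" for x using g(2) MX[OF that] by blast
  have gs: "g (s a x) = x" "s a (g x) = x" if "x \<in> M" for x
    using gf that gM[OF that] by auto
  have fs: "f x = s a x" if "x \<in> M" for x using f(2) MX[OF that] r_id[OF that] that by auto
  have gK: "g x = x" if "x \<in> M - K" for x using gs(1)[of x] K(3)[OF a that] that by simp
  have gI: "restrict g M \<in> Diff_c M"
  proof (rule Diff_cI[where g = f and K = K])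
    fix x assume x: "x \<in> M"
    show "g x \<in> M" by (rule gM[OF x])
    show "f x \<in> M" using f(2) MX[OF x] by blast
    show "f (g x) = x" using fs gM[OF x] gs(2)[OF x] by simp
    show "g (f x) = x" using fs[OF x] gs(1)[OF x] by simp
  qed (use f g K gK in auto)
  show thesis
  proof (rule that[of "\<lambda>u x. s u (g x)"])
    show "Diff_path a b (\<lambda>u x. s u (g x))"
      unfolding Diff_path_def
    proof (intro conjI ballI)
      show "C1_fam {a..b} X (\<lambda>u x. s u (g x))"
        by (rule C1_fam_compose[OF C1_fam_fixed[OF g(1)] C1_fam_mono[OF s'(1) _ order_refl]]) (use ab g M_sub in auto)
      fix u assume u: "u \<in> {a..b}"
      then have u': "u \<in> {c..d}" using ab by auto
      have "restrict (\<lambda>x. s u (g x)) M = restrict (\<lambda>x. restrict (s u) M (restrict g M x)) M"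
        using g M_sub by (intro restrict_ext) auto
      then show "restrict (\<lambda>x. s u (g x)) M \<in> Diff_c M" using Diff_c_compose[OF s'(3)[OF u'] gI] by simp
      show "s u (g (r x)) = s u (g x)" "s u (g x) \<in> M" if "x \<in> X" for x
        using g that s'(2)[OF u', of "g x"] M_sub by auto
    next
      show "\<exists>K. compact K \<and> K \<subseteq> M \<and> (\<forall>u\<in>{a..b}. \<forall>x\<in>M - K. s u (g x) = x)"
        using K ab gK by (intro exI[of _ K]) auto
    qed
    show "s a (g x) = r x" if "x \<in> X" for x
      using gs(2)[of "r x"] g(2) that r_in[OF that] by simp
  qed (use gs in auto)
qed


section \<open>Isotopy extension\<close>

definition is_emb :: "nat \<Rightarrow> 'b::euclidean_space set \<Rightarrow> (nat \<Rightarrow> 'a::euclidean_space \<Rightarrow> 'b) \<Rightarrow> bool" where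
  "is_emb n M \<psi> \<longleftrightarrow> (\<lambda>i\<in>{..<n}. restrict (\<psi> i) (sphere 0 1)) \<in> Emb n (sphere 0 1) M"

lemma C1_embedding_left_inverse:
  assumes "C1_embedding S M f"
  obtains U \<kappa> where "open U" "f ` S \<subseteq> U" "C1o U \<kappa>" "\<forall>x\<in>S. \<kappa> (f x) = x"
proof -
  have "C1_on (f ` S) (inv_into S f)" "inj_on f S" using assms by (auto simp: C1_embedding_def)
  then obtain U \<kappa> where U: "open U" "f ` S \<subseteq> U" "C1o U \<kappa>" and k: "\<forall>y\<in>f ` S. \<kappa> y = inv_into S f y"
    unfolding C1_on_iff by blast
  have "\<forall>x\<in>S. \<kappa> (f x) = x" using k \<open>inj_on f S\<close> by simp
  with U show thesis by (rule that)
qed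

lemma is_emb_D:
  fixes \<psi> :: "nat \<Rightarrow> 'a::euclidean_space \<Rightarrow> 'b::euclidean_space"
  assumes "is_emb n M \<psi>"
  shows "\<And>i x. i < n \<Longrightarrow> x \<in> sphere 0 1 \<Longrightarrow> \<psi> i x \<in> M"
    and "\<And>i j. i < n \<Longrightarrow> j < n \<Longrightarrow> i \<noteq> j \<Longrightarrow> \<psi> i ` sphere 0 1 \<inter> \<psi> j ` sphere 0 1 = {}"
    and "\<And>i. i < n \<Longrightarrow> C1_embedding (sphere 0 1) M (restrict (\<psi> i) (sphere 0 1))"
proof -
  let ?S = "sphere 0 1 :: 'a set"
  show e: "C1_embedding ?S M (restrict (\<psi> i) ?S)" if "i < n" for i
    using assms that by (auto simp: is_emb_def Emb_def)
  show "\<psi> i x \<in> M" if "i < n" "x \<in> ?S" for i x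
    using e[OF that(1)] that(2) by (auto simp: C1_embedding_def C1_maps_def)
  show "\<psi> i ` ?S \<inter> \<psi> j ` ?S = {}" if "i < n" "j < n" "i \<noteq> j" for i j
    using assms that by (auto simp: is_emb_def Emb_def disjoint_family_on_def)
qed

context C1_retract
begin

lemma local_displacement:
  fixes p :: "real \<Rightarrow> nat \<Rightarrow> 'a::euclidean_space \<Rightarrow> 'b"
  assumes fam: "\<And>i. i < n \<Longrightarrow> C1_fam UNIV (- {0}) (\<lambda>u. p u i)" and emb: "is_emb n M (p t0)"
  obtains \<eta> K where "C1_fam UNIV UNIV \<eta>" "compact K" "\<forall>u y. y \<notin> K \<longrightarrow> \<eta> u y = 0" "\<forall>y. \<eta> t0 y = 0"
    "\<forall>u. \<forall>i<n. \<forall>x\<in>sphere 0 1. \<eta> u (p t0 i x) = p u i x - p t0 i x"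
proof -
  let ?S = "sphere 0 1 :: 'a set"
  have S0: "?S \<subseteq> - {0}" by auto
  define A where "A i = p t0 i ` ?S" for i
  have A: "compact (A i)" if "i < n" for i
    unfolding A_def
    using continuous_on_subset[OF C1o_imp_continuous_on[OF C1_fam_at[OF fam[OF that] UNIV_I]] S0]
    by (intro compact_continuous_image) auto
  have disj: "A i \<inter> A j = {}" if "i < n" "j < n" "i \<noteq> j" for i j
    using is_emb_D(2)[OF emb that] by (simp add: A_def)
  have "\<exists>U \<kappa>. open U \<and> A i \<subseteq> U \<and> C1o U \<kappa> \<and> (\<forall>x\<in>?S. \<kappa> (p t0 i x) = x)" if i: "i < n" for i
  proof -
    obtain U \<kappa> where "open U" "restrict (p t0 i) ?S ` ?S \<subseteq> U" "C1o U \<kappa>" "\<forall>x\<in>?S. \<kappa> (restrict (p t0 i) ?S x) = x"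
      by (rule C1_embedding_left_inverse[OF is_emb_D(3)[OF emb i]])
    then show ?thesis by (intro exI[of _ U] exI[of _ \<kappa>]) (auto simp: A_def)
  qed
  then obtain U \<kappa> where U: "\<And>i. i < n \<Longrightarrow> open (U i)" "\<And>i. i < n \<Longrightarrow> A i \<subseteq> U i" "\<And>i. i < n \<Longrightarrow> C1o (U i) (\<kappa> i)"
      and \<kappa>: "\<And>i x. i < n \<Longrightarrow> x \<in> ?S \<Longrightarrow> \<kappa> i (p t0 i x) = x"
    by metis
  \<comment> \<open>Only points with nonzero \<kappa> i are kept, because \<open>p u i\<close> is
    controlled away from 0. Removing the other spheres ensures that each bump moves only its own
    sphere.\<close>
  define N where "N i = (U i \<inter> \<kappa> i -` (- {0})) - (\<Union>j\<in>{..<n} - {i}. A j)" for i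
  have N: "open (N i)" if "i < n" for i
    unfolding N_def
  proof (intro open_Diff continuous_open_preimage[OF C1o_imp_continuous_on[OF U(3)[OF that]]] U that)
    show "closed (\<Union>j\<in>{..<n} - {i}. A j)"
      by (intro closed_UN ballI compact_imp_closed A) auto
  qed (simp add: open_Compl)
  have AN: "A i \<subseteq> N i" if "i < n" for i
    using disj[OF that] U(2)[OF that] \<kappa>[OF that] by (fastforce simp: N_def A_def)
  have AN0: "A j \<inter> N i = {}" if "i < n" "j < n" "j \<noteq> i" for i j
    using that by (auto simp: N_def)
  have "\<exists>\<beta> K. C1o UNIV \<beta> \<and> compact K \<and> K \<subseteq> N i \<and> (\<forall>y\<in>A i. \<beta> y = (1::real)) \<and> (\<forall>y. y \<notin> K \<longrightarrow> \<beta> y = 0)" if i: "i < n" for i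
    by (rule C1_bump[OF A[OF i] N[OF i] AN[OF i]]) blast
  then have "\<forall>i. \<exists>q. i < n \<longrightarrow> C1o UNIV (fst q) \<and> compact (snd q) \<and> snd q \<subseteq> N i \<and>
      (\<forall>y\<in>A i. fst q y = (1::real)) \<and> (\<forall>y. y \<notin> snd q \<longrightarrow> fst q y = 0)" by simp
  from choice[OF this] obtain q where q: "\<And>i. i < n \<Longrightarrow> C1o UNIV (fst (q i)) \<and> compact (snd (q i)) \<and> snd (q i) \<subseteq> N i \<and>
      (\<forall>y\<in>A i. fst (q i) y = (1::real)) \<and> (\<forall>y. y \<notin> snd (q i) \<longrightarrow> fst (q i) y = 0)"
    by blast
  define \<beta> where "\<beta> i = fst (q i)" for i
  define K where "K i = snd (q i)" for i
  have \<beta>: "\<And>i. i < n \<Longrightarrow> C1o UNIV (\<beta> i)" and K: "\<And>i. i < n \<Longrightarrow> compact (K i)" "\<And>i. i < n \<Longrightarrow> K i \<subseteq> N i"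
    and \<beta>1: "\<And>i y. i < n \<Longrightarrow> y \<in> A i \<Longrightarrow> \<beta> i y = 1" and \<beta>0: "\<And>i y. i < n \<Longrightarrow> y \<notin> K i \<Longrightarrow> \<beta> i y = 0"
    using q unfolding \<beta>_def K_def by blast+
  \<comment> \<open>The extension by zero is C1: \<beta> i already vanishes outside the compact
    \<open>K i\<close> inside the open \<open>N i\<close>.\<close>
  define e where "e i u y = (if y \<in> N i then \<beta> i y *\<^sub>R (p u i (\<kappa> i y) - p t0 i (\<kappa> i y)) else 0)" for i u y
  have e0: "e i u y = 0" if "i < n" "y \<notin> K i" for i u y using \<beta>0[OF that] by (simp add: e_def)
  have e: "C1_fam UNIV UNIV (e i)" if i: "i < n" for i
  proof (rule C1_fam_local)
    fix y :: 'b
    show "\<exists>V. open V \<and> y \<in> V \<and> C1_fam UNIV V (e i)"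
    proof (cases "y \<in> N i")
      case True
      have \<kappa>N: "C1o (N i) (\<kappa> i)" by (rule C1o_mono[OF U(3)[OF i]]) (auto simp: N_def)
      have p1: "C1_fam UNIV (N i) (\<lambda>u y. p u i (\<kappa> i y))"
        by (rule C1_fam_compose[OF C1_fam_fixed[OF \<kappa>N] fam[OF i]]) (auto simp: N_def)
      have p2: "C1_fam UNIV (N i) (\<lambda>u::real. \<lambda>y. p t0 i (\<kappa> i y))"
        by (rule C1_fam_fixed[OF C1_fam_at[OF p1 UNIV_I]])
      have "C1_fam UNIV (N i) (\<lambda>u y. \<beta> i y *\<^sub>R (p u i (\<kappa> i y) - p t0 i (\<kappa> i y)))"
        by (rule C1_fam_scaleR[OF C1_fam_fixed[OF C1o_mono[OF \<beta>[OF i] subset_UNIV]] C1_fam_diff[OF p1 p2]])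
      then have "C1_fam UNIV (N i) (e i)"
        by (rule C1_fam_cong[OF _ N[OF i]]) (simp add: e_def)
      then show ?thesis using True N[OF i] by blast
    next
      case False
      have op: "open (- K i)" by (rule open_Compl[OF compact_imp_closed[OF K(1)[OF i]]])
      have "C1_fam UNIV (- K i) (\<lambda>u::real. \<lambda>y. 0::'b)" by (rule C1_fam_param[OF continuous_on_const])
      then have "C1_fam UNIV (- K i) (e i)"
        by (rule C1_fam_cong[OF _ op]) (use e0[OF i] in simp)
      then show ?thesis using False K(2)[OF i] op by (intro exI[of _ "- K i"]) auto
    qed
  qed
  show thesis
  proof (rule that[of "\<lambda>u y. \<Sum>i<n. e i u y" "\<Union>i<n. K i"])
    show "C1_fam UNIV UNIV (\<lambda>u y. \<Sum>i<n. e i u y)" by (rule C1_fam_sum) (use e in auto)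
    show "compact (\<Union>i<n. K i)" using K by (intro compact_UN) auto
    show "\<forall>u y. y \<notin> (\<Union>i<n. K i) \<longrightarrow> (\<Sum>i<n. e i u y) = 0" using e0 by simp
    show "\<forall>y. (\<Sum>i<n. e i t0 y) = 0" by (intro allI sum.neutral ballI) (simp add: e_def)
    show "\<forall>u. \<forall>i<n. \<forall>x\<in>?S. (\<Sum>j<n. e j u (p t0 i x)) = p u i x - p t0 i x"
    proof (intro allI impI ballI)
      fix u i x assume i: "i < n" and x: "x \<in> ?S"
      have Ai: "p t0 i x \<in> A i" using x by (auto simp: A_def)
      have "(\<Sum>j<n. e j u (p t0 i x)) = (\<Sum>j<n. if j = i then p u i x - p t0 i x else 0)"
      proof (rule sum.cong[OF refl])
        fix j assume "j \<in> {..<n}"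
        then have j: "j < n" by simp
        show "e j u (p t0 i x) = (if j = i then p u i x - p t0 i x else 0)"
        proof (cases "j = i")
          case True
          then show ?thesis using subsetD[OF AN[OF i] Ai] \<beta>1[OF i Ai] \<kappa>[OF i x] by (simp add: e_def)
        next
          case False
          then have "p t0 i x \<notin> N j" using AN0[OF j i] Ai by blast
          then show ?thesis using False by (simp add: e_def)
        qed
      qed
      then show "(\<Sum>j<n. e j u (p t0 i x)) = p u i x - p t0 i x" using i by simp
    qed
  qed
qed

lemma local_isotopy_extension:
  fixes p :: "real \<Rightarrow> nat \<Rightarrow> 'a::euclidean_space \<Rightarrow> 'b"
  assumes fam: "\<And>i. i < n \<Longrightarrow> C1_fam UNIV (- {0}) (\<lambda>u. p u i)" and emb: "\<And>u. is_emb n M (p u)"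
  obtains d s where "d > 0" "Diff_path (t0 - d) (t0 + d) s"
    "\<forall>u i. \<forall>x\<in>sphere 0 1. i < n \<longrightarrow> s u (p t0 i x) = p u i x"
proof -
  obtain \<eta> K0 where \<eta>: "C1_fam UNIV UNIV \<eta>" and K0: "compact K0" "\<forall>u y. y \<notin> K0 \<longrightarrow> \<eta> u y = 0" and \<eta>0: "\<forall>y. \<eta> t0 y = 0"
    and \<eta>p: "\<forall>u. \<forall>i<n. \<forall>x\<in>sphere 0 1. \<eta> u (p t0 i x) = p u i x - p t0 i x"
    by (rule local_displacement[OF fam emb])
  define K where "K = K0 \<inter> M"
  have K: "compact K" "K \<subseteq> M" using K0 closed_M by (auto simp: K_def compact_Int_closed)
  have KX: "UNIV \<times> K \<subseteq> UNIV \<times> X" using K M_sub by auto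
  have \<eta>K: "\<eta> u y = 0" if "y \<in> M - K" for u y using that K0(2) by (auto simp: K_def)
  \<comment> \<open>Three neighbourhoods of t0 follow: U0 keeps displaced points in the tube of
    radius 1/2 on which \<open>near_M\<close> speaks, U1 and U2 give the bounds 1/4 and 1/8 required
    by \<open>near_id_Diff_c\<close>.\<close>
  have "continuous_on (UNIV \<times> K) (\<lambda>q. norm (\<eta> (fst q) (snd q)))"
    by (intro continuous_on_norm continuous_on_subset[OF C1_fam_cont[OF \<eta>]]) auto
  then obtain U0 where U0: "open U0" "t0 \<in> U0" and "\<And>u y. u \<in> U0 \<Longrightarrow> u \<in> UNIV \<Longrightarrow> y \<in> K \<Longrightarrow> norm (\<eta> (fst (u, y)) (snd (u, y))) < 1/4"
    by (rule compact_tube_less[OF _ K(1) UNIV_I, of _ t0 "1/4"]) (use \<eta>0 in auto)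
  then have b0: "norm (\<eta> u y) < 1/4" if "u \<in> U0" "y \<in> M" for u y
    using that \<eta>K[of y u] by (cases "y \<in> K") auto
  \<comment> \<open>On the sphere the sum leaves M and is pushed back by \<open>r\<close>. At the
    points of the given embedding this changes nothing, since there the sum is
    \<open>p u i x\<close>, a point of M.\<close>
  define F where "F u y = r (r y + \<eta> u (r y))" for u y
  have rn: "r y + \<eta> u (r y) \<in> X" if "u \<in> U0" "y \<in> X" for u y
    using near_M[of "r y" "r y + \<eta> u (r y)"] b0[OF that(1) r_in[OF that(2)]] r_in[OF that(2)] by (simp add: dist_norm)
  have r1: "C1_fam Z X (\<lambda>u. r)" for Z :: "real set" by (rule C1_fam_fixed[OF C1_r])
  have \<eta>r: "C1_fam U0 X (\<lambda>u y. \<eta> u (r y))"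
    by (rule C1_fam_compose[OF r1 C1_fam_mono[OF \<eta> subset_UNIV order_refl]]) simp
  have F: "C1_fam U0 X F" unfolding F_def
    by (rule C1_fam_compose[OF C1_fam_add[OF r1 \<eta>r] r1]) (rule rn)
  have FM: "F u y \<in> M" if "u \<in> U0" "y \<in> X" for u y unfolding F_def by (rule r_in[OF rn[OF that]])
  have FK: "F u y = y" if "y \<in> M - K" for u y using that r_id[of y] \<eta>K[OF that] by (simp add: F_def)
  have Ft0: "F t0 y = r y" if "y \<in> X" for y using r_id[OF r_in[OF that]] \<eta>0 by (simp add: F_def)
  define \<zeta> where "\<zeta> u y = F u y - r y" for u y
  have \<zeta>: "C1_fam U0 X \<zeta>" unfolding \<zeta>_def by (rule C1_fam_diff[OF F r1])
  have Dz: "Dif (\<zeta> u) y = 0" if "open V" "y \<in> V" "\<And>z. z \<in> V \<Longrightarrow> \<zeta> u z = 0" for u y V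
  proof -
    have "Dif (\<zeta> u) y = Dif (\<lambda>_. 0) y" by (rule Dif_cong[OF that(1,2)]) (use that(3) in auto)
    also have "\<dots> = 0" by (rule Dif_eqI) (simp add: zero_blinfun.rep_eq)
    finally show ?thesis .
  qed
  have UK: "U0 \<times> K \<subseteq> U0 \<times> X" using K M_sub by auto
  have "continuous_on (U0 \<times> K) (\<lambda>q. norm (\<zeta> (fst q) (snd q)))"
    by (intro continuous_on_norm continuous_on_subset[OF C1_fam_cont[OF \<zeta>] UK])
  then obtain U1 where U1: "open U1" "t0 \<in> U1" and b1: "\<And>u y. u \<in> U1 \<Longrightarrow> u \<in> U0 \<Longrightarrow> y \<in> K \<Longrightarrow> norm (\<zeta> (fst (u, y)) (snd (u, y))) < 1/4"
    by (rule compact_tube_less[OF _ K(1) U0(2), of _ "1/4"]) (use Ft0 K M_sub in \<open>auto simp: \<zeta>_def\<close>)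
  have "continuous_on (U0 \<times> K) (\<lambda>q. norm (Dif (\<zeta> (fst q)) (snd q)))"
    by (intro continuous_on_norm continuous_on_subset[OF C1_fam_Dif[OF \<zeta>] UK])
  moreover have "norm (Dif (\<zeta> (fst (t0, y))) (snd (t0, y))) < 1/8" if "y \<in> K" for y
    using Dz[OF open_X, of y t0] that K M_sub Ft0 by (auto simp: \<zeta>_def)
  ultimately obtain U2 where U2: "open U2" "t0 \<in> U2" and b2: "\<And>u y. u \<in> U2 \<Longrightarrow> u \<in> U0 \<Longrightarrow> y \<in> K \<Longrightarrow> norm (Dif (\<zeta> (fst (u, y))) (snd (u, y))) < 1/8"
    using compact_tube_less[OF _ K(1) U0(2)] by blast
  have "open (U0 \<inter> U1 \<inter> U2)" "t0 \<in> U0 \<inter> U1 \<inter> U2" using U0 U1 U2 by auto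
  then obtain d where d: "d > 0" "cball t0 d \<subseteq> U0 \<inter> U1 \<inter> U2" using open_contains_cball by blast
  have in_d: "u \<in> U0 \<and> u \<in> U1 \<and> u \<in> U2" if "u \<in> {t0 - d..t0 + d}" for u
    using d(2) that by (auto simp: cball_eq_atLeastAtMost)
  have FF: "F u (r y) = F u y" if "y \<in> X" for u y
    using r_id[OF r_in[OF that]] by (simp add: F_def)
  have opK: "open (X \<inter> r -` (- K))"
    by (rule continuous_open_preimage[OF C1o_imp_continuous_on[OF C1_r] open_X]) (simp add: open_Compl compact_imp_closed[OF K(1)])
  have \<zeta>z: "\<zeta> u z = 0" if "z \<in> X \<inter> r -` (- K)" for u z
    using that FK[of "r z" u] r_in[of z] FF[of z u] by (simp add: \<zeta>_def)
  show thesis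
  proof (rule that[OF d(1), of F])
    show "\<forall>u i. \<forall>x\<in>sphere 0 1. i < n \<longrightarrow> F u (p t0 i x) = p u i x"
    proof (intro allI ballI impI)
      fix u i and x :: 'a assume *: "x \<in> sphere 0 1" "i < n"
      have "p t0 i x \<in> M" "p u i x \<in> M" using is_emb_D(1)[OF emb *(2,1)] by auto
      then show "F u (p t0 i x) = p u i x"
        using \<eta>p * by (simp add: F_def r_id)
    qed
    show "Diff_path (t0 - d) (t0 + d) F"
      unfolding Diff_path_def
    proof (intro conjI ballI)
      show "C1_fam {t0 - d..t0 + d} X F" by (rule C1_fam_mono[OF F]) (use in_d in auto)
      show "\<exists>K. compact K \<and> K \<subseteq> M \<and> (\<forall>u\<in>{t0 - d..t0 + d}. \<forall>x\<in>M - K. F u x = x)"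
        using K FK by blast
      fix u assume u: "u \<in> {t0 - d..t0 + d}"
      show "F u (r y) = F u y" "F u y \<in> M" if "y \<in> X" for y using FF FM in_d[OF u] that by auto
      show "restrict (F u) M \<in> Diff_c M"
      proof (rule near_id_Diff_c[of "F u" K])
        show "C1o X (F u)" by (rule C1_fam_at[OF F]) (use in_d[OF u] in simp)
        fix y assume y: "y \<in> M"
        have "norm (\<zeta> u y) \<le> 1/4"
          using b1[of u y] in_d[OF u] FK[of y u] y r_id[OF y] by (cases "y \<in> K") (auto simp: \<zeta>_def)
        then show "norm (F u y - y) \<le> 1/4" using r_id[OF y] by (simp add: \<zeta>_def)
        have "norm (Dif (\<zeta> u) y) \<le> 1/8"
        proof (cases "y \<in> K")
          case False
          then have "Dif (\<zeta> u) y = 0" using Dz[OF opK _ \<zeta>z] y r_id[OF y] M_sub by auto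
          then show ?thesis by simp
        qed (use b2[of u y] in_d[OF u] in auto)
        then show "norm (Dif (\<lambda>y. F u y - r y) y) \<le> 1/8" by (simp add: \<zeta>_def[abs_def])
      qed (use FF FM in_d[OF u] K FK in auto)
    qed
  qed
qed

text \<open>Instead of a finite subdivision, the bisection principle \<open>Bolzano\<close> is
  applied to the existence of an extension over an interval: this property holds on short intervals
  and passes to unions of adjacent ones.\<close>

lemma isotopy_extension:
  fixes p :: "real \<Rightarrow> nat \<Rightarrow> 'a::euclidean_space \<Rightarrow> 'b"
  assumes fam: "\<And>i. i < n \<Longrightarrow> C1_fam {0..1} (- {0}) (\<lambda>u. p u i)" and emb: "\<And>u. u \<in> {0..1} \<Longrightarrow> is_emb n M (p u)"
  obtains G where "Diff_path 0 1 G" "\<forall>x\<in>X. G 0 x = r x"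
    "\<forall>u\<in>{0..1}. \<forall>i<n. \<forall>x\<in>sphere 0 1. G u (p 0 i x) = p u i x"
proof -
  \<comment> \<open>The path is made constant outside the unit interval, so that the two-sided local
    extension is available at 0 and 1 as well.\<close>
  define q where "q u = p (max 0 (min 1 u))" for u
  have fam': "C1_fam UNIV (- {0}) (\<lambda>u. q u i)" if "i < n" for i
    unfolding q_def by (rule C1_fam_reparam[OF fam[OF that]]) (auto intro!: continuous_intros)
  have emb': "is_emb n M (q u)" for u unfolding q_def by (rule emb) auto
  define P where "P a b \<longleftrightarrow> (\<exists>G. Diff_path a b G \<and> (\<forall>x\<in>X. G a x = r x) \<and>
     (\<forall>u\<in>{a..b}. \<forall>i<n. \<forall>x\<in>sphere 0 1. G u (q a i x) = q u i x))" for a b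
  have "P 0 1"
  proof (rule Bolzano)
    fix a b c assume trans: "P a b" "P b c" "a \<le> b" "b \<le> c"
    obtain G where G: "Diff_path a b G" "\<forall>x\<in>X. G a x = r x"
      and Gq: "\<forall>u\<in>{a..b}. \<forall>i<n. \<forall>x\<in>sphere 0 1. G u (q a i x) = q u i x" using trans(1) unfolding P_def by blast
    obtain H where H: "Diff_path b c H" "\<forall>x\<in>X. H b x = r x"
      and Hq: "\<forall>u\<in>{b..c}. \<forall>i<n. \<forall>x\<in>sphere 0 1. H u (q b i x) = q u i x" using trans(2) unfolding P_def by blast
    show "P a c"
      unfolding P_def
    proof (intro exI conjI)
      show "Diff_path a c (\<lambda>u. if u \<le> b then G u else (\<lambda>x. H u (G b x)))"
        by (rule Diff_path_join[OF G(1) H(1)]) (use H(2) trans in auto)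
      show "\<forall>x\<in>X. (if a \<le> b then G a else (\<lambda>x. H a (G b x))) x = r x" using G(2) trans by simp
      show "\<forall>u\<in>{a..c}. \<forall>i<n. \<forall>x\<in>sphere 0 1. (if u \<le> b then G u else (\<lambda>x. H u (G b x))) (q a i x) = q u i x"
        using Gq Hq trans by auto
    qed
  next
    fix t0 :: real
    obtain d s where d: "d > 0" "Diff_path (t0 - d) (t0 + d) s"
      and s: "\<forall>u i. \<forall>x\<in>sphere 0 1. i < n \<longrightarrow> s u (q t0 i x) = q u i x"
      by (rule local_isotopy_extension[OF fam' emb'])
    have "P a b" if ab: "a \<le> t0" "t0 \<le> b" "b - a < d" for a b
    proof -
      obtain G where G: "Diff_path a b G" and Ga: "\<And>x. x \<in> X \<Longrightarrow> G a x = r x"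
        and Gs: "\<And>u x. x \<in> M \<Longrightarrow> G u (s a x) = s u x"
        using Diff_path_inverse_shift[OF d(2), of a b] ab by auto
      have "G u (q a i x) = q u i x" if "i < n" "x \<in> sphere 0 1" for u i x
        using Gs[of "q t0 i x" u] s that is_emb_D(1)[OF emb' that] by simp
      then show ?thesis unfolding P_def using G Ga by blast
    qed
    with d(1) show "\<exists>d>0. \<forall>a b. a \<le> t0 \<and> t0 \<le> b \<and> b - a < d \<longrightarrow> P a b" by blast
  qed simp
  then obtain G where G: "Diff_path 0 1 G" "\<forall>x\<in>X. G 0 x = r x"
    and "\<forall>u\<in>{0..1}. \<forall>i<n. \<forall>x\<in>sphere 0 1. G u (q 0 i x) = q u i x" unfolding P_def by blast
  then show thesis by (intro that[OF G]) (auto simp: q_def)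
qed

end


section \<open>Spaces of embeddings\<close>

definition emb_of :: "nat \<Rightarrow> (nat \<Rightarrow> 'a::euclidean_space \<Rightarrow> 'b::euclidean_space) \<Rightarrow> nat \<Rightarrow> 'a \<Rightarrow> 'b" where
  "emb_of n \<psi> = (\<lambda>i\<in>{..<n}. restrict (\<psi> i) (sphere 0 1))"

lemma is_emb_iff: "is_emb n M \<psi> \<longleftrightarrow> emb_of n \<psi> \<in> Emb n (sphere 0 1) M"
  by (simp add: is_emb_def emb_of_def)

lemma is_embI:
  fixes \<psi> :: "nat \<Rightarrow> 'a::euclidean_space \<Rightarrow> 'b::euclidean_space"
  assumes C: "\<And>i. i < n \<Longrightarrow> C1o (- {0}) (\<psi> i)"
    and M: "\<And>i x. i < n \<Longrightarrow> x \<in> sphere 0 1 \<Longrightarrow> \<psi> i x \<in> M"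
    and inv: "\<And>i. i < n \<Longrightarrow> \<exists>U \<kappa>. open U \<and> C1o U \<kappa> \<and> (\<forall>x\<in>sphere 0 1. \<psi> i x \<in> U \<and> \<kappa> (\<psi> i x) = x)"
    and disj: "\<And>i j x y. i < n \<Longrightarrow> j < n \<Longrightarrow> i \<noteq> j \<Longrightarrow> x \<in> sphere 0 1 \<Longrightarrow> y \<in> sphere 0 1 \<Longrightarrow> \<psi> i x \<noteq> \<psi> j y"
  shows "is_emb n M \<psi>"
proof -
  let ?S = "sphere 0 1 :: 'a set"
  have "C1_embedding ?S M (restrict (\<psi> i) ?S)" if i: "i < n" for i
  proof -
    let ?f = "restrict (\<psi> i) ?S"
    obtain U \<kappa> where U: "open U" "C1o U \<kappa>" "\<forall>x\<in>?S. \<psi> i x \<in> U \<and> \<kappa> (\<psi> i x) = x" using inv[OF i] by blast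
    have inj: "inj_on ?f ?S" by (rule inj_onI) (use U(3) in \<open>metis restrict_apply'\<close>)
    have "C1_on ?S (\<psi> i)" unfolding C1_on_iff
      using C[OF i] by (intro exI[of _ "- {0}"] exI[of _ "\<psi> i"]) (auto simp: open_Compl)
    then have "C1_on ?S ?f" by (rule C1_on_cong) simp
    moreover have "C1_on (?f ` ?S) (inv_into ?S ?f)" unfolding C1_on_iff
    proof (intro exI conjI)
      show "\<forall>y\<in>?f ` ?S. \<kappa> y = inv_into ?S ?f y"
        using U(3) inv_into_f_f[OF inj] by (simp add: image_iff)
    qed (use U in auto)
    ultimately show ?thesis using inj M[OF i] by (auto simp: C1_embedding_def C1_maps_def)
  qed
  then show ?thesis using disj unfolding is_emb_def Emb_def disjoint_family_on_def by fastforce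
qed

lemma continuous_map_Emb:
  fixes p :: "'z::t2_space \<Rightarrow> nat \<Rightarrow> 'a::euclidean_space \<Rightarrow> 'b::euclidean_space"
  assumes D: "DIM('a) \<ge> 2" and fam: "\<And>i. i < n \<Longrightarrow> C1_fam Z (- {0}) (\<lambda>z. p z i)"
    and emb: "\<And>z. z \<in> Z \<Longrightarrow> is_emb n M (p z)"
  shows "continuous_map (top_of_set Z) (Emb_top n (sphere 0 1) M) (\<lambda>z. emb_of n (p z))"
proof -
  interpret S: C1_retract "sphere 0 1 :: 'a set" "- {0}" nrm by (rule C1_retract_sphere[OF D])
  have "continuous_map (top_of_set Z) (C1_topology (sphere 0 1) M) (\<lambda>z. restrict (p z i) (sphere 0 1))" if i: "i < n" for i
    by (rule S.continuous_map_C1_topology[OF fam[OF i], where K = "sphere 0 1"])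
      (use is_emb_D(1)[OF emb i] in auto)
  then have "continuous_map (top_of_set Z) (product_topology (\<lambda>_. C1_topology (sphere 0 1) M) {..<n}) (\<lambda>z. emb_of n (p z))"
    by (auto simp: continuous_map_componentwise emb_of_def)
  then show ?thesis
    using emb by (auto simp: Emb_top_def continuous_map_in_subtopology is_emb_iff)
qed

lemma continuous_map_path_component:
  assumes f: "continuous_map (top_of_set Z) X f" and Z: "path_connected Z" and z: "z0 \<in> Z" "z \<in> Z"
  shows "f z \<in> path_component_of_set X (f z0)"
proof -
  have "path_connectedin (top_of_set Z) Z"
    using Z by (simp add: path_connectedin_subtopology)
  then have "path_connectedin X (f ` Z)" by (rule path_connectedin_continuous_map_image[OF f])
  then have "f ` Z \<subseteq> path_component_of_set X (f z0)" by (rule path_component_of_maximal) (use z in auto)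
  then show ?thesis using z by blast
qed

lemma (in C1_retract) pathin_Diff_path:
  assumes G: "Diff_path 0 1 G" and G0: "\<forall>x\<in>X. G 0 x = r x"
  shows "pathin (Diff_id_top M) (\<lambda>u. restrict (G u) M)" "restrict (G 0) M = (\<lambda>x\<in>M. x)"
proof -
  obtain K where K: "compact K" "K \<subseteq> M" "\<forall>u\<in>{0..1}. \<forall>x\<in>M - K. G u x = x" using G unfolding Diff_path_def by blast
  show 0: "restrict (G 0) M = (\<lambda>x\<in>M. x)" using G0 r_id M_sub by (intro restrict_ext) auto
  let ?f = "\<lambda>u. restrict (G u) M"
  have c: "continuous_map (top_of_set {0..1}) (C1_topology M M) ?f"
    by (rule continuous_map_C1_topology[of _ _ _ K]) (use G K M_sub in \<open>auto simp: Diff_path_def\<close>)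
  then have c2: "continuous_map (top_of_set {0..1}) (subtopology (C1_topology M M) (Diff_c M)) ?f"
    using G by (auto simp: continuous_map_in_subtopology Diff_path_def)
  have "?f u \<in> Diff_id M" if "u \<in> {0..1}" for u
    unfolding Diff_id_def 0[symmetric]
    by (rule continuous_map_path_component[OF c2]) (use that in \<open>auto intro: convex_imp_path_connected\<close>)
  then show "pathin (Diff_id_top M) ?f"
    using c by (auto simp: pathin_def Diff_id_top_def continuous_map_in_subtopology)
qed

text \<open>Weaker than the name: only an ambient diffeomorphism between the two configurations is
  recorded, without a path to the identity. This is what \<open>chart_diffeo\<close> takes in order
  to transport a chart.\<close>

definition isotopic :: "nat \<Rightarrow> 'b::euclidean_space set \<Rightarrow> (nat \<Rightarrow> 'a::euclidean_space \<Rightarrow> 'b) \<Rightarrow> (nat \<Rightarrow> 'a \<Rightarrow> 'b) \<Rightarrow> bool" where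
  "isotopic n M \<psi> \<psi>' \<longleftrightarrow> (\<exists>g\<in>Diff_c M. \<forall>i<n. \<forall>x\<in>sphere 0 1. g (\<psi> i x) = \<psi>' i x)"

context C1_retract
begin

lemma isotopic_trans:
  assumes "isotopic n M \<psi> \<psi>'" "isotopic n M \<psi>' \<psi>''" "\<And>i x. i < n \<Longrightarrow> x \<in> sphere 0 1 \<Longrightarrow> \<psi> i x \<in> M"
  shows "isotopic n M \<psi> \<psi>''"
proof -
  obtain g h where "g \<in> Diff_c M" "h \<in> Diff_c M"
    and *: "\<forall>i<n. \<forall>x\<in>sphere 0 1. g (\<psi> i x) = \<psi>' i x" "\<forall>i<n. \<forall>x\<in>sphere 0 1. h (\<psi>' i x) = \<psi>'' i x"
    using assms unfolding isotopic_def by blast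
  then have "restrict (\<lambda>x. h (g x)) M \<in> Diff_c M" by (intro Diff_c_compose)
  moreover have "\<forall>i<n. \<forall>x\<in>sphere 0 1. restrict (\<lambda>x. h (g x)) M (\<psi> i x) = \<psi>'' i x"
    using * assms(3) by auto
  ultimately show ?thesis unfolding isotopic_def by blast
qed

lemma isotopic_path:
  assumes fam: "\<And>i. i < n \<Longrightarrow> C1_fam {0..1} (- {0}) (\<lambda>u::real. p u i)" and emb: "\<And>u. u \<in> {0..1} \<Longrightarrow> is_emb n M (p u)"
  shows "isotopic n M (p 0) (p 1)"
proof -
  obtain G where G: "Diff_path 0 1 G" "\<forall>x\<in>X. G 0 x = r x"
    and Gp: "\<forall>u\<in>{0..1}. \<forall>i<n. \<forall>x\<in>sphere 0 1. G u (p 0 i x) = p u i x"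
    by (rule isotopy_extension[OF fam emb])
  have "restrict (G 1) M \<in> Diff_c M" using G(1) by (simp add: Diff_path_def)
  moreover have "\<forall>i<n. \<forall>x\<in>sphere 0 1. restrict (G 1) M (p 0 i x) = p 1 i x"
    using Gp is_emb_D(1)[OF emb[of 0]] by auto
  ultimately show ?thesis unfolding isotopic_def by blast
qed

end


section \<open>Charts and affine configurations\<close>

text \<open>On the line w + t v, with v outside T j and w outside the other subspaces, each subspace
  is met for at most one t. The lemma supplies the generic vectors of
  \<open>shrinks_to_align\<close> and \<open>shrinks_to_line\<close>.\<close>

lemma subspace_not_finite_union:
  fixes W :: "'b::euclidean_space set"
  assumes "finite I" "subspace W" "\<And>i. i \<in> I \<Longrightarrow> subspace (T i) \<and> \<not> W \<subseteq> T i"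
  shows "\<exists>w\<in>W. \<forall>i\<in>I. w \<notin> T i"
  using assms(1,3)
proof (induction I rule: finite_induct)
  case empty
  then show ?case using subspace_0[OF assms(2)] by auto
next
  case (insert j I)
  then obtain w where w: "w \<in> W" "\<And>i. i \<in> I \<Longrightarrow> w \<notin> T i" by auto
  obtain v where v: "v \<in> W" "v \<notin> T j" using insert by blast
  have fin: "finite {t::real. w + t *\<^sub>R v \<in> T i}" if i: "i \<in> insert j I" for i
  proof -
    have T: "subspace (T i)" using insert i by blast
    have "s = t" if "w + s *\<^sub>R v \<in> T i" "w + t *\<^sub>R v \<in> T i" for s t
    proof (rule ccontr)
      assume ne: "s \<noteq> t"
      have "(w + s *\<^sub>R v) - (w + t *\<^sub>R v) \<in> T i" using T that by (intro subspace_diff)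
      then have "(s - t) *\<^sub>R v \<in> T i" by (simp add: scaleR_diff_left)
      then have "inverse (s - t) *\<^sub>R (s - t) *\<^sub>R v \<in> T i" by (rule subspace_scale[OF T])
      then have vT: "v \<in> T i" using ne by simp
      then have "(w + s *\<^sub>R v) - s *\<^sub>R v \<in> T i" using T that(1) by (intro subspace_diff subspace_scale)
      then show False using vT v(2) w(2) i by auto
    qed
    then have "\<exists>s. {t. w + t *\<^sub>R v \<in> T i} \<subseteq> {s}" by blast
    then show ?thesis using finite_subset by blast
  qed
  have "finite (\<Union>i\<in>insert j I. {t::real. w + t *\<^sub>R v \<in> T i})" using fin insert by blast
  then obtain t :: real where "t \<notin> (\<Union>i\<in>insert j I. {t. w + t *\<^sub>R v \<in> T i})"
    using ex_new_if_finite[OF infinite_UNIV_char_0] by blast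
  then show ?case
    using w(1) v(1) assms(2) by (intro bexI[of _ "w + t *\<^sub>R v"]) (auto intro: subspace_add subspace_scale)
qed

text \<open>The model space is the subspace \<open>range Q\<close> of the ambient space, since the
  sphere has one dimension less than its type. C is total with values in M, so that families in the
  model can be composed with it without conditions on the domain.\<close>

definition chart :: "'b::euclidean_space set \<Rightarrow> ('b \<Rightarrow> 'b) \<Rightarrow> ('b \<Rightarrow> 'b) \<Rightarrow> ('b \<Rightarrow> 'b) \<Rightarrow> 'b set \<Rightarrow> bool" where
  "chart M Q C Ci V \<longleftrightarrow> linear Q \<and> (\<forall>v. Q (Q v) = Q v) \<and> C1o UNIV C \<and> range C \<subseteq> M \<and>
     open V \<and> C1o V Ci \<and> (\<forall>w\<in>range Q. C w \<in> V \<and> Ci (C w) = w)"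

lemma chart_UNIV: "chart UNIV (\<lambda>v. v) (\<lambda>v. v) (\<lambda>v. v) (UNIV :: 'b::euclidean_space set)"
  by (simp add: chart_def C1o_id linear_id[unfolded id_def])

text \<open>Inverse of the stereographic projection from the pole e, for w orthogonal to e.\<close>

definition stereo :: "'b::euclidean_space \<Rightarrow> 'b \<Rightarrow> 'b" where
  "stereo e w = inverse ((norm w)\<^sup>2 + 1) *\<^sub>R (2 *\<^sub>R w + ((norm w)\<^sup>2 - 1) *\<^sub>R e)"

lemma chart_sphere:
  fixes e :: "'b::euclidean_space"
  assumes e: "norm e = 1"
  defines "Q \<equiv> \<lambda>v. v - (e \<bullet> v) *\<^sub>R e"
    and "Ci \<equiv> \<lambda>y. inverse (1 - e \<bullet> y) *\<^sub>R (y - (e \<bullet> y) *\<^sub>R e)"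
  shows "chart (sphere 0 1) Q (\<lambda>v. stereo e (Q v)) Ci {y. e \<bullet> y \<noteq> 1}"
    "y \<in> sphere 0 1 \<Longrightarrow> e \<bullet> y \<noteq> 1 \<Longrightarrow> Ci y \<in> range Q \<and> stereo e (Q (Ci y)) = y"
    "dim (range Q) = DIM('b) - 1"
proof -
  have ee: "e \<bullet> e = 1" using e by (simp add: dot_square_norm)
  have Qe: "e \<bullet> Q v = 0" for v using ee by (simp add: Q_def inner_diff_right)
  have Qid: "Q v = v" if "e \<bullet> v = 0" for v using that by (simp add: Q_def)
  have QQ: "Q (Q v) = Q v" for v by (rule Qid[OF Qe])
  have linQ: "linear Q" unfolding Q_def
    by (rule linearI) (auto simp: inner_add_right algebra_simps)
  have pos: "(norm w)\<^sup>2 + 1 > 0" for w :: 'b by (simp add: add_nonneg_pos)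
  have ce: "e \<bullet> stereo e w = ((norm w)\<^sup>2 - 1) / ((norm w)\<^sup>2 + 1)" if "e \<bullet> w = 0" for w
    using that ee by (simp add: stereo_def inner_add_right inner_scaleR_right divide_inverse mult.commute del: inverse_mult_distrib)
  have ce1: "1 - e \<bullet> stereo e w = 2 / ((norm w)\<^sup>2 + 1)" if "e \<bullet> w = 0" for w
    using pos[of w] by (simp add: ce[OF that] field_simps)
  have ns: "norm (stereo e w) = 1" if ew: "e \<bullet> w = 0" for w
  proof -
    let ?q = "(norm w)\<^sup>2"
    have "(norm (2 *\<^sub>R w + (?q - 1) *\<^sub>R e))\<^sup>2 = 4 * ?q + (?q - 1)\<^sup>2"
      unfolding power2_norm_eq_inner
      using ew ee by (simp add: inner_add_left inner_add_right inner_commute power2_eq_square algebra_simps)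
    also have "\<dots> = (?q + 1)\<^sup>2" by (simp add: power2_eq_square algebra_simps)
    finally have "norm (2 *\<^sub>R w + (?q - 1) *\<^sub>R e) = ?q + 1"
      using pos[of w] by (simp add: power2_eq_iff_nonneg)
    then show ?thesis using pos[of w] by (simp add: stereo_def abs_of_pos)
  qed
  have inv: "Ci (stereo e w) = w" if ew: "e \<bullet> w = 0" for w
  proof -
    let ?q = "(norm w)\<^sup>2"
    have "stereo e w - (e \<bullet> stereo e w) *\<^sub>R e = (2 / (?q + 1)) *\<^sub>R w"
      by (simp add: ce[OF ew]) (simp add: stereo_def scaleR_add_right divide_inverse mult.commute)
    moreover have "2 / (?q + 1) \<noteq> 0" using pos[of w] by simp
    moreover have "inverse c *\<^sub>R c *\<^sub>R w = w" if "c \<noteq> 0" for c :: real using that by simp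
    ultimately show ?thesis unfolding Ci_def ce1[OF ew] by presburger
  qed
  have ne1: "e \<bullet> stereo e w \<noteq> 1" if "e \<bullet> w = 0" for w using ce1[OF that] pos[of w] by auto
  have inner: "C1o U (\<lambda>y. e \<bullet> y)" for U by (rule C1o_linear[OF bounded_linear_inner_right])
  have "C1o UNIV Q" by (rule C1o_linear) (use linQ linear_conv_bounded_linear in blast)
  moreover have "C1o UNIV (stereo e)"
  proof -
    have n: "C1o UNIV (\<lambda>w::'b. (norm w)\<^sup>2)" using C1o_dist_square[of UNIV "0::'b"] by simp
    have 1: "C1o UNIV (\<lambda>w::'b. inverse ((norm w)\<^sup>2 + 1))"
      by (rule C1o_compose[OF C1o_add[OF n C1o_const] C1o_inverse]) (use pos in \<open>auto simp: less_le\<close>)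
    have 2: "C1o UNIV (\<lambda>w::'b. 2 *\<^sub>R w + ((norm w)\<^sup>2 - 1) *\<^sub>R e)"
      by (rule C1o_add[OF C1o_scaleR[OF C1o_const C1o_id] C1o_scaleR[OF C1o_diff[OF n C1o_const] C1o_const]])
    show ?thesis unfolding stereo_def[abs_def] by (rule C1o_scaleR[OF 1 2])
  qed
  ultimately have "C1o UNIV (\<lambda>v. stereo e (Q v))" by (rule C1o_compose) simp
  note C = this
  have Ci: "C1o {y. e \<bullet> y \<noteq> 1} Ci"
  proof -
    have 1: "C1o {y. e \<bullet> y \<noteq> 1} (\<lambda>y. inverse (1 - e \<bullet> y))"
      by (rule C1o_compose[OF C1o_diff[OF C1o_const inner] C1o_inverse]) auto
    show ?thesis unfolding Ci_def
      by (rule C1o_scaleR[OF 1 C1o_diff[OF C1o_id C1o_scaleR[OF inner C1o_const]]])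
  qed
  show "chart (sphere 0 1) Q (\<lambda>v. stereo e (Q v)) Ci {y. e \<bullet> y \<noteq> 1}"
    unfolding chart_def
  proof (intro conjI allI ballI)
    show "open {y. e \<bullet> y \<noteq> 1}" by (intro open_Collect_neq continuous_intros)
    show "range (\<lambda>v. stereo e (Q v)) \<subseteq> sphere 0 1" using ns[OF Qe] by auto
    fix w assume "w \<in> range Q"
    then have "e \<bullet> w = 0" "Q w = w" using Qe QQ by blast+
    then show "stereo e (Q w) \<in> {y. e \<bullet> y \<noteq> 1}" "Ci (stereo e (Q w)) = w"
      using ne1[of w] inv[of w] by simp_all
  qed (use linQ QQ C Ci in blast)+
  show "dim (range Q) = DIM('b) - 1"
  proof -
    have "range Q = {v. e \<bullet> v = 0}" 
    proof (intro equalityI subsetI)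
      show "v \<in> range Q" if "v \<in> {v. e \<bullet> v = 0}" for v
        using Qid[of v] that by (intro range_eqI[of _ _ v]) simp
    qed (use Qe in blast)
    moreover have "e \<noteq> 0" using e by auto
    ultimately show ?thesis using dim_hyperplane by simp
  qed
  assume y: "y \<in> sphere 0 1" "e \<bullet> y \<noteq> 1"
  define s where "s = e \<bullet> y"
  have s1: "1 - s \<noteq> 0" using y by (simp add: s_def)
  have eCi: "e \<bullet> Ci y = 0" using ee by (simp add: Ci_def inner_diff_right)
  have yy: "y \<bullet> y = 1" using y by (simp add: dot_square_norm)
  have "(norm (y - s *\<^sub>R e))\<^sup>2 = 1 - s * s"
    unfolding power2_norm_eq_inner using ee yy
    by (simp add: inner_diff_left inner_diff_right inner_commute s_def)
  then have "(norm (Ci y))\<^sup>2 = (1 - s * s) / (1 - s)\<^sup>2"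
    by (simp add: Ci_def s_def[symmetric] power_mult_distrib divide_inverse power_inverse)
  also have "\<dots> = ((1 + s) * (1 - s)) / ((1 - s) * (1 - s))" by (simp add: power2_eq_square algebra_simps)
  also have "\<dots> = (1 + s) / (1 - s)" using s1 by (rule nonzero_mult_divide_mult_cancel_right)
  finally have n: "(norm (Ci y))\<^sup>2 = (1 + s) / (1 - s)" .
  have n1: "inverse ((norm (Ci y))\<^sup>2 + 1) = (1 - s) / 2" and n2: "(norm (Ci y))\<^sup>2 - 1 = 2 * s / (1 - s)"
    unfolding n using s1 by (simp_all add: field_simps)
  have "stereo e (Ci y) = y"
    unfolding stereo_def n1 n2
    using s1 by (simp add: Ci_def s_def[symmetric] scaleR_add_right)
  then show "Ci y \<in> range Q \<and> stereo e (Q (Ci y)) = y"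
    using Qid[OF eCi] by (metis rangeI)
qed

text \<open>Images of ellipsoids in the chart. On the unit sphere \<open>nrm\<close> is the
  identity; it puts the family into the form, C1 on the complement of 0, that isotopy extension
  expects.\<close>

definition cfg :: "('b \<Rightarrow> 'b) \<Rightarrow> (nat \<Rightarrow> 'b::euclidean_space) \<Rightarrow> (nat \<Rightarrow> 'a::euclidean_space \<Rightarrow>\<^sub>L 'b) \<Rightarrow> nat \<Rightarrow> 'a \<Rightarrow> 'b" where
  "cfg C a L i x = C (a i + blinfun_apply (L i) (nrm x))"

lemma nrm_sphere: "x \<in> sphere 0 1 \<Longrightarrow> nrm x = x"
  by (simp add: nrm_def)

lemma cfg_fam:
  assumes C: "C1o UNIV C" and a: "continuous_on Z (\<lambda>z. a z i)" and L: "continuous_on Z (\<lambda>z. L z i)"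
  shows "C1_fam Z (- {0}) (\<lambda>z. cfg C (a z) (L z) i)"
proof -
  have "C1_fam Z UNIV (\<lambda>z. blinfun_apply (L z i))"
  proof (rule C1_famI[where G' = "\<lambda>z x. L z i"])
    have L': "continuous_on (Z \<times> UNIV) (\<lambda>p. L (fst p) i)"
      by (rule continuous_on_compose2[OF L]) (auto intro: continuous_intros)
    then show "continuous_on (Z \<times> UNIV) (\<lambda>p. L (fst p) i)" .
    show "continuous_on (Z \<times> UNIV) (\<lambda>p. blinfun_apply (L (fst p) i) (snd p))"
      by (intro continuous_intros L')
  qed (auto intro: bounded_linear_imp_has_derivative blinfun.bounded_linear_right)
  then have "C1_fam Z (- {0}) (\<lambda>z x. blinfun_apply (L z i) (nrm x))"
    by (rule C1_fam_compose[OF C1_fam_fixed[OF C1o_nrm]]) simp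
  then have "C1_fam Z (- {0}) (\<lambda>z x. a z i + blinfun_apply (L z i) (nrm x))"
    by (rule C1_fam_add[OF C1_fam_param[OF a]])
  then show ?thesis unfolding cfg_def
    by (rule C1_fam_compose[OF _ C1_fam_fixed[OF C]]) simp
qed

lemma cfg_emb:
  fixes L :: "nat \<Rightarrow> 'a::euclidean_space \<Rightarrow>\<^sub>L 'b::euclidean_space"
  assumes ch: "chart M Q C Ci V" and a: "\<And>i. i < n \<Longrightarrow> a i \<in> range Q"
    and L: "\<And>i. i < n \<Longrightarrow> inj (blinfun_apply (L i))" "\<And>i x. i < n \<Longrightarrow> blinfun_apply (L i) x \<in> range Q"
    and disj: "\<And>i j x y. i < n \<Longrightarrow> j < n \<Longrightarrow> i \<noteq> j \<Longrightarrow> x \<in> sphere 0 1 \<Longrightarrow> y \<in> sphere 0 1 \<Longrightarrow>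
      a i + blinfun_apply (L i) x \<noteq> a j + blinfun_apply (L j) y"
  shows "is_emb n M (cfg C a L)"
proof (rule is_embI)
  have linQ: "linear Q" and C: "C1o UNIV C" and CM: "range C \<subseteq> M" and V: "open V" and Ci: "C1o V Ci"
    and inv: "\<And>w. w \<in> range Q \<Longrightarrow> C w \<in> V \<and> Ci (C w) = w" using ch by (auto simp: chart_def)
  have sub: "subspace (range Q)" using linQ by (simp add: subspace_UNIV linear_subspace_image)
  have W: "a i + blinfun_apply (L i) x \<in> range Q" if "i < n" for i x
    using subspace_add[OF sub a[OF that] L(2)[OF that]] .
  show "C1o (- {0}) (cfg C a L i)" for i
    using C1_fam_at[OF cfg_fam[OF C, of "{0::real}" "\<lambda>_. a" i "\<lambda>_. L"]] by (auto intro: continuous_on_const)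
  show "cfg C a L i x \<in> M" for i x using CM by (auto simp: cfg_def)
  show "\<exists>U \<kappa>. open U \<and> C1o U \<kappa> \<and> (\<forall>x\<in>sphere 0 1. cfg C a L i x \<in> U \<and> \<kappa> (cfg C a L i x) = x)" if i: "i < n" for i
  proof -
    obtain h where h: "linear h" "\<And>x. h (blinfun_apply (L i) x) = x"
      using linear_injective_left_inverse[OF bounded_linear.linear[OF blinfun.bounded_linear_right] L(1)[OF i]]
      by (metis comp_apply id_apply)
    have "C1o V (\<lambda>y. h (Ci y - a i))"
      by (rule C1o_compose[OF C1o_diff[OF Ci C1o_const] C1o_linear[of h UNIV]]) (use h(1) in \<open>simp_all add: linear_conv_bounded_linear\<close>)
    then show ?thesis
      using V inv[OF W[OF i]] h(2) by (intro exI[of _ V] exI[of _ "\<lambda>y. h (Ci y - a i)"]) (auto simp: cfg_def nrm_def)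
  qed
  show "cfg C a L i x \<noteq> cfg C a L j y" if "i < n" "j < n" "i \<noteq> j" "x \<in> sphere 0 1" "y \<in> sphere 0 1" for i j x y
    using disj[OF that] inv[OF W[OF that(1), of x]] inv[OF W[OF that(2), of y]] that
    unfolding cfg_def nrm_sphere[OF that(4)] nrm_sphere[OF that(5)] by metis
qed


section \<open>Moving small affine spheres\<close>

lemma finite_uniform_lower_bound:
  fixes f :: "'i \<Rightarrow> 'z \<Rightarrow> real"
  assumes "finite I" "\<And>i. i \<in> I \<Longrightarrow> \<exists>m>0. \<forall>z\<in>Z. m \<le> f i z"
  shows "\<exists>m>0. \<forall>i\<in>I. \<forall>z\<in>Z. m \<le> f i z"
  using assms
proof (induction I rule: finite_induct)
  case empty
  then show ?case by (intro exI[of _ 1]) auto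
next
  case (insert j I)
  obtain m where m: "m > 0" "\<forall>i\<in>I. \<forall>z\<in>Z. m \<le> f i z" using insert by blast
  obtain m' where m': "m' > 0" "\<forall>z\<in>Z. m' \<le> f j z" using insert.prems[of j] by blast
  show ?case
  proof (intro exI[of _ "min m m'"] conjI ballI)
    show "min m m' > 0" using m m' by simp
    show "min m m' \<le> f i z" if "i \<in> insert j I" "z \<in> Z" for i z
      using that m(2) m'(2) by (auto intro: min.coboundedI1 min.coboundedI2)
  qed
qed

lemma compact_uniform_lower_bound:
  fixes f :: "'i \<Rightarrow> 'z::topological_space \<Rightarrow> real"
  assumes "finite I" "compact Z" "\<And>i. i \<in> I \<Longrightarrow> continuous_on Z (f i)" "\<And>i z. i \<in> I \<Longrightarrow> z \<in> Z \<Longrightarrow> f i z > 0"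
  shows "\<exists>m>0. \<forall>i\<in>I. \<forall>z\<in>Z. m \<le> f i z"
proof (rule finite_uniform_lower_bound[OF assms(1)])
  fix i assume i: "i \<in> I"
  show "\<exists>m>0. \<forall>z\<in>Z. m \<le> f i z"
  proof (cases "Z = {}")
    case False
    then obtain z0 where "z0 \<in> Z" "\<forall>z\<in>Z. f i z0 \<le> f i z"
      using continuous_attains_inf[OF assms(2) _ assms(3)[OF i]] by blast
    then show ?thesis using assms(4)[OF i] by blast
  qed (auto intro: exI[of _ 1])
qed

text \<open>Asking for all sufficiently small sizes, rather than for one, lets each later move
  shrink the spheres further, as far as its own collisions require.\<close>

definition shrinks_to ::
  "nat \<Rightarrow> 'b::euclidean_space set \<Rightarrow> ('b \<Rightarrow> 'b) \<Rightarrow> (nat \<Rightarrow> 'a::euclidean_space \<Rightarrow> 'b) \<Rightarrow> (nat \<Rightarrow> 'b) \<Rightarrow> (nat \<Rightarrow> 'a \<Rightarrow>\<^sub>L 'b) \<Rightarrow> bool" where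
  "shrinks_to n M C \<phi> a L \<longleftrightarrow> (\<exists>\<delta>0>0. \<forall>\<delta>. 0 < \<delta> \<and> \<delta> \<le> \<delta>0 \<longrightarrow> isotopic n M \<phi> (cfg C a (\<lambda>i. \<delta> *\<^sub>R L i)))"

context C1_retract
begin

text \<open>For small spheres only the centres have to be kept apart. Compactness of the time
  interval bounds the admissible size from below, uniformly along the motion.\<close>

lemma shrinks_to_move:
  fixes L :: "real \<Rightarrow> nat \<Rightarrow> 'a::euclidean_space \<Rightarrow>\<^sub>L 'b" and a :: "real \<Rightarrow> nat \<Rightarrow> 'b"
  assumes ch: "chart M Q C Ci V"
    and ca: "\<And>i. i < n \<Longrightarrow> continuous_on {0..1} (\<lambda>u. a u i)" and cL: "\<And>i. i < n \<Longrightarrow> continuous_on {0..1} (\<lambda>u. L u i)"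
    and aW: "\<And>u i. u \<in> {0..1} \<Longrightarrow> i < n \<Longrightarrow> a u i \<in> range Q"
    and LW: "\<And>u i x. u \<in> {0..1} \<Longrightarrow> i < n \<Longrightarrow> blinfun_apply (L u i) x \<in> range Q"
    and Linj: "\<And>u i. u \<in> {0..1} \<Longrightarrow> i < n \<Longrightarrow> inj (blinfun_apply (L u i))"
    and dist: "\<And>u i j. u \<in> {0..1} \<Longrightarrow> i < n \<Longrightarrow> j < n \<Longrightarrow> i \<noteq> j \<Longrightarrow> a u i \<noteq> a u j"
    and st: "shrinks_to n M C \<phi> (a 0) (L 0)" and \<phi>M: "\<And>i x. i < n \<Longrightarrow> x \<in> sphere 0 1 \<Longrightarrow> \<phi> i x \<in> M"
  shows "shrinks_to n M C \<phi> (a 1) (L 1)"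
proof -
  have linQ: "linear Q" and C: "C1o UNIV C" using ch by (auto simp: chart_def)
  have sub: "subspace (range Q)" using linQ by (simp add: subspace_UNIV linear_subspace_image)
  let ?I = "{(i, j). i < n \<and> j < n \<and> i \<noteq> j}"
  \<comment> \<open>Spheres scaled by \<delta> stay disjoint as long as \<delta> does not exceed
    this ratio; the 1 keeps the denominator positive and makes the final estimate strict.\<close>
  let ?f = "\<lambda>p u. norm (a u (fst p) - a u (snd p)) / (1 + norm (L u (fst p)) + norm (L u (snd p)))"
  have "\<exists>m>0. \<forall>p\<in>?I. \<forall>u\<in>{0..1}. m \<le> ?f p u"
  proof (rule compact_uniform_lower_bound)
    have "?I \<subseteq> {..<n} \<times> {..<n}" by auto
    then show "finite ?I" by (rule finite_subset) simp
    show "continuous_on {0..1} (?f p)" if "p \<in> ?I" for p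
      using that by (intro continuous_intros ca cL) (auto simp: add_nonneg_eq_0_iff)
    show "?f p u > 0" if "p \<in> ?I" "u \<in> {0..1}" for p u
      using dist[OF that(2), of "fst p" "snd p"] that(1) by (intro divide_pos_pos) (auto simp: add_pos_nonneg)
  qed simp
  then obtain m where m: "m > 0" "\<And>i j u. i < n \<Longrightarrow> j < n \<Longrightarrow> i \<noteq> j \<Longrightarrow> u \<in> {0..1} \<Longrightarrow>
       m \<le> norm (a u i - a u j) / (1 + norm (L u i) + norm (L u j))" by fastforce
  obtain \<delta>0 where \<delta>0: "\<delta>0 > 0" "\<And>\<delta>. 0 < \<delta> \<Longrightarrow> \<delta> \<le> \<delta>0 \<Longrightarrow> isotopic n M \<phi> (cfg C (a 0) (\<lambda>i. \<delta> *\<^sub>R L 0 i))"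
    using st unfolding shrinks_to_def by blast
  have "isotopic n M \<phi> (cfg C (a 1) (\<lambda>i. \<delta> *\<^sub>R L 1 i))" if \<delta>: "0 < \<delta>" "\<delta> \<le> \<delta>0" "\<delta> \<le> m" for \<delta>
  proof (rule isotopic_trans[OF \<delta>0(2)[OF \<delta>(1,2)] _ \<phi>M])
    show "isotopic n M (cfg C (a 0) (\<lambda>i. \<delta> *\<^sub>R L 0 i)) (cfg C (a 1) (\<lambda>i. \<delta> *\<^sub>R L 1 i))"
    proof (rule isotopic_path[of n "\<lambda>u. cfg C (a u) (\<lambda>i. \<delta> *\<^sub>R L u i)"])
      show "C1_fam {0..1} (- {0}) (\<lambda>u. cfg C (a u) (\<lambda>i. \<delta> *\<^sub>R L u i) i)" if "i < n" for i
        by (rule cfg_fam[where a = a and L = "\<lambda>u i. \<delta> *\<^sub>R L u i", OF C]) (intro continuous_intros ca cL that)+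
      fix u :: real assume u: "u \<in> {0..1}"
      show "is_emb n M (cfg C (a u) (\<lambda>i. \<delta> *\<^sub>R L u i))"
      proof (rule cfg_emb[OF ch aW[OF u]])
        show "inj (blinfun_apply (\<delta> *\<^sub>R L u i))" if "i < n" for i
          using Linj[OF u that] \<delta>(1) by (auto simp: inj_on_def scaleR_blinfun.rep_eq)
        show "blinfun_apply (\<delta> *\<^sub>R L u i) x \<in> range Q" if "i < n" for i x
          using LW[OF u that] sub by (simp add: scaleR_blinfun.rep_eq subspace_scale)
        fix i j and x y :: 'a assume ij: "i < n" "j < n" "i \<noteq> j" and xy: "x \<in> sphere 0 1" "y \<in> sphere 0 1"
        show "a u i + blinfun_apply (\<delta> *\<^sub>R L u i) x \<noteq> a u j + blinfun_apply (\<delta> *\<^sub>R L u j) y"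
        proof
          assume "a u i + blinfun_apply (\<delta> *\<^sub>R L u i) x = a u j + blinfun_apply (\<delta> *\<^sub>R L u j) y"
          then have "a u i - a u j = \<delta> *\<^sub>R (blinfun_apply (L u j) y - blinfun_apply (L u i) x)"
            by (simp add: scaleR_blinfun.rep_eq algebra_simps)
          then have "norm (a u i - a u j) = \<delta> * norm (blinfun_apply (L u j) y - blinfun_apply (L u i) x)" using \<delta> by simp
          also have "\<dots> \<le> \<delta> * (norm (L u j) + norm (L u i))"
            using norm_blinfun[of "L u j" y] norm_blinfun[of "L u i" x] xy \<delta>
            by (intro mult_left_mono order_trans[OF norm_triangle_ineq4] add_mono) auto
          also have "\<dots> < \<delta> * (1 + norm (L u i) + norm (L u j))" using \<delta> by simp
          also have "\<dots> \<le> m * (1 + norm (L u i) + norm (L u j))" using \<delta> by (intro mult_right_mono) auto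
          also have "\<dots> \<le> norm (a u i - a u j)"
            using m(2)[OF ij u] by (simp add: pos_le_divide_eq add_pos_nonneg)
          finally show False by simp
        qed
      qed
    qed
  qed
  then show ?thesis unfolding shrinks_to_def using m(1) \<delta>0(1) by (intro exI[of _ "min m \<delta>0"]) auto
qed

text \<open>A vector \<open>w\<close> outside all ranges can replace the value of each \<open>L i\<close> at a basis vector along a
  straight line without losing injectivity; this connects any two injective linear maps into a
  space of one dimension more.\<close>

lemma shrinks_to_align:
  fixes L :: "nat \<Rightarrow> 'a::euclidean_space \<Rightarrow>\<^sub>L 'b"
  assumes n: "n > 0" and ch: "chart M Q C Ci V" and dimW: "dim (range Q) > DIM('a)"
    and a: "\<And>i. i < n \<Longrightarrow> a i \<in> range Q" "\<And>i j. i < n \<Longrightarrow> j < n \<Longrightarrow> i \<noteq> j \<Longrightarrow> a i \<noteq> a j"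
    and L: "\<And>i x. i < n \<Longrightarrow> blinfun_apply (L i) x \<in> range Q" "\<And>i. i < n \<Longrightarrow> inj (blinfun_apply (L i))"
    and st: "shrinks_to n M C \<phi> a L" and \<phi>M: "\<And>i x. i < n \<Longrightarrow> x \<in> sphere 0 1 \<Longrightarrow> \<phi> i x \<in> M"
  obtains K :: "'a \<Rightarrow>\<^sub>L 'b" where "range (blinfun_apply K) \<subseteq> range Q" "inj (blinfun_apply K)" "shrinks_to n M C \<phi> a (\<lambda>_. K)"
proof -
  have linQ: "linear Q" using ch by (auto simp: chart_def)
  have sub: "subspace (range Q)" using linQ by (simp add: subspace_UNIV linear_subspace_image)
  have "\<exists>L'. (\<forall>i<n. inj (blinfun_apply (L' i)) \<and> range (blinfun_apply (L' i)) \<subseteq> range Q) \<and>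
      (\<forall>b\<in>B. \<forall>i<n. \<forall>j<n. blinfun_apply (L' i) b = blinfun_apply (L' j) b) \<and> shrinks_to n M C \<phi> a L'"
    if "finite B" "B \<subseteq> (Basis :: 'a set)" for B
    using that
  proof (induction B rule: finite_induct)
    case empty
    have "\<forall>i<n. inj (blinfun_apply (L i)) \<and> range (blinfun_apply (L i)) \<subseteq> range Q"
      using L by blast
    then show ?case using st by (intro exI[of _ L]) simp
  next
    case (insert b B)
    have "B \<subseteq> Basis" using insert.prems by simp
    from insert.IH[OF this] obtain L1 where *: "(\<forall>i<n. inj (blinfun_apply (L1 i)) \<and> range (blinfun_apply (L1 i)) \<subseteq> range Q) \<and>
      (\<forall>b\<in>B. \<forall>i<n. \<forall>j<n. blinfun_apply (L1 i) b = blinfun_apply (L1 j) b) \<and> shrinks_to n M C \<phi> a L1"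
      by (rule exE)
    note L1' = conjunct1[OF *] conjunct1[OF conjunct2[OF *]] conjunct2[OF conjunct2[OF *]]
    have L1: "inj (blinfun_apply (L1 i))" "blinfun_apply (L1 i) x \<in> range Q" if "i < n" for i x
      using L1'(1)[rule_format, OF that] by (simp_all add: subset_iff)
    have "\<exists>w\<in>range Q. \<forall>i\<in>{..<n}. w \<notin> range (blinfun_apply (L1 i))"
    proof (rule subspace_not_finite_union[OF _ sub])
      fix i assume "i \<in> {..<n}"
      have lin: "linear (blinfun_apply (L1 i))" by (rule bounded_linear.linear[OF blinfun.bounded_linear_right])
      have "dim (range (blinfun_apply (L1 i))) \<le> DIM('a)"
        using dim_image_le[OF lin, of UNIV] by simp
      then have "\<not> range Q \<subseteq> range (blinfun_apply (L1 i))"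
        using dim_subset[of "range Q" "range (blinfun_apply (L1 i))"] dimW by auto
      then show "subspace (range (blinfun_apply (L1 i))) \<and> \<not> range Q \<subseteq> range (blinfun_apply (L1 i))"
        using lin by (simp add: subspace_UNIV linear_subspace_image)
    qed simp
    then obtain w where w: "w \<in> range Q" "\<And>i. i < n \<Longrightarrow> w \<notin> range (blinfun_apply (L1 i))" by auto
    \<comment> \<open>A rank one change that affects only the basis vector b: values already aligned
      on B stay aligned by orthogonality, and at u = 1 every index sends b to w.\<close>
    define N where "N u i = L1 i + u *\<^sub>R (blinfun_scaleR_left (w - blinfun_apply (L1 i) b) o\<^sub>L blinfun_inner_left b)" for u i
    have N: "blinfun_apply (N u i) x = blinfun_apply (L1 i) x + (u * (x \<bullet> b)) *\<^sub>R (w - blinfun_apply (L1 i) b)" for u i x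
      by (simp add: N_def plus_blinfun.rep_eq scaleR_blinfun.rep_eq inner_commute)
    have NW: "blinfun_apply (N u i) x \<in> range Q" if "i < n" for u i x
      unfolding N using sub L1(2)[OF that] w(1) by (intro subspace_add subspace_scale subspace_diff)
    have Ninj: "inj (blinfun_apply (N u i))" if i: "i < n" for u i
    proof (rule injI)
      fix x y assume "blinfun_apply (N u i) x = blinfun_apply (N u i) y"
      then have 0: "blinfun_apply (N u i) (x - y) = 0" by (simp add: blinfun.diff_right)
      \<comment> \<open>Two points with the same image would put c w into the range of
        \<open>L1 i\<close>, which excludes w; so c = 0.\<close>
      define c where "c = u * ((x - y) \<bullet> b)"
      have e1: "c *\<^sub>R w = blinfun_apply (L1 i) (c *\<^sub>R b - (x - y))"
        using 0 unfolding N c_def[symmetric] by (simp add: blinfun.diff_right blinfun.add_right blinfun.scaleR_right algebra_simps)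
      have "c = 0"
      proof (rule ccontr)
        assume c: "c \<noteq> 0"
        have "w = inverse c *\<^sub>R (c *\<^sub>R w)" using c by simp
        also have "\<dots> = blinfun_apply (L1 i) (inverse c *\<^sub>R (c *\<^sub>R b - (x - y)))"
          unfolding e1 by (rule blinfun.scaleR_right[symmetric])
        finally have "w \<in> range (blinfun_apply (L1 i))" by (rule range_eqI)
        then show False using w(2)[OF i] by contradiction
      qed
      then have "blinfun_apply (L1 i) x = blinfun_apply (L1 i) y"
        using 0 unfolding N c_def[symmetric] by (simp add: blinfun.diff_right)
      then show "x = y" by (rule injD[OF L1(1)[OF i]])
    qed
    have N0: "N 0 = L1" by (simp add: N_def fun_eq_iff)
    have N2: "shrinks_to n M C \<phi> a (N 1)"
    proof (rule shrinks_to_move[OF ch, where a = "\<lambda>_. a" and L = N])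
      show "continuous_on {0..1} (\<lambda>u. N u i)" for i
        unfolding N_def by (intro continuous_intros)
      show "shrinks_to n M C \<phi> a (N 0)" unfolding N0 by (rule L1'(3))
      show "\<phi> i x \<in> M" if "i < n" "x \<in> sphere 0 1" for i x using \<phi>M that by blast
      show "a i \<noteq> a j" if "i < n" "j < n" "i \<noteq> j" for i j by (rule a(2)[OF that])
    qed (rule continuous_on_const, rule a(1), assumption, rule NW, assumption, rule Ninj, assumption)
    have N1: "blinfun_apply (N 1 i) b' = blinfun_apply (N 1 j) b'" if "b' \<in> insert b B" "i < n" "j < n" for b' i j
    proof (cases "b' = b")
      case True
      then have "b' \<bullet> b = 1" using insert.prems by (simp add: inner_same_Basis)
      then show ?thesis using True by (simp add: N)
    next
      case False
      then have "b' \<in> B" using that(1) by simp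
      moreover have "b' \<bullet> b = 0"
        by (rule inner_not_same_Basis[OF _ _ False]) (use insert.prems \<open>b' \<in> B\<close> in auto)
      moreover have "blinfun_apply (L1 i) b' = blinfun_apply (L1 j) b'"
        using bspec[OF L1'(2) \<open>b' \<in> B\<close>] that(2,3) by blast
      ultimately show ?thesis unfolding N by simp
    qed
    have N3: "inj (blinfun_apply (N 1 i)) \<and> range (blinfun_apply (N 1 i)) \<subseteq> range Q" if "i < n" for i
      by (intro conjI image_subsetI Ninj[OF that] NW[OF that])
    have "(\<forall>i<n. inj (blinfun_apply (N 1 i)) \<and> range (blinfun_apply (N 1 i)) \<subseteq> range Q) \<and>
      (\<forall>b\<in>insert b B. \<forall>i<n. \<forall>j<n. blinfun_apply (N 1 i) b = blinfun_apply (N 1 j) b) \<and> shrinks_to n M C \<phi> a (N 1)"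
      by (intro conjI allI impI ballI N1 N2) (rule N3[THEN conjunct1] N3[THEN conjunct2], assumption)+
    then show ?case by (intro exI[of _ "N 1"])
  qed
  from this[OF finite_Basis order_refl]
  obtain L' where *: "(\<forall>i<n. inj (blinfun_apply (L' i)) \<and> range (blinfun_apply (L' i)) \<subseteq> range Q) \<and>
      (\<forall>b\<in>(Basis::'a set). \<forall>i<n. \<forall>j<n. blinfun_apply (L' i) b = blinfun_apply (L' j) b) \<and> shrinks_to n M C \<phi> a L'"
    by (rule exE)
  note L' = conjunct1[OF *] conjunct1[OF conjunct2[OF *]] conjunct2[OF conjunct2[OF *]]
  have L0: "L' i = L' 0" if "i < n" for i
  proof (rule blinfun_euclidean_eqI)
    show "blinfun_apply (L' i) b = blinfun_apply (L' 0) b" if "b \<in> Basis" for b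
      using bspec[OF L'(2) that] \<open>i < n\<close> n by blast
  qed
  have "isotopic n M \<phi> (cfg C a (\<lambda>i. \<delta> *\<^sub>R L' i)) = isotopic n M \<phi> (cfg C a (\<lambda>i. \<delta> *\<^sub>R L' 0))" for \<delta>
    unfolding isotopic_def cfg_def
    by (intro bex_cong refl all_cong ball_cong) (simp add: L0[symmetric])
  then have "shrinks_to n M C \<phi> a (\<lambda>_. L' 0)" using L'(3) by (simp add: shrinks_to_def)
  with L'(1) n show thesis by (intro that[of "L' 0"]) auto
qed

text \<open>Straight motions of the centres may collide. The detour along v, with a different speed
  for each index, prevents this when v lies outside every plane spanned by an initial and a final
  difference of centres; such v exist from dimension 3 on.\<close>

lemma shrinks_to_line:
  fixes K :: "'a::euclidean_space \<Rightarrow>\<^sub>L 'b"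
  assumes ch: "chart M Q C Ci V" and dimW: "dim (range Q) \<ge> 3"
    and a: "\<And>i. i < n \<Longrightarrow> a i \<in> range Q" "\<And>i j. i < n \<Longrightarrow> j < n \<Longrightarrow> i \<noteq> j \<Longrightarrow> a i \<noteq> a j"
    and t: "\<And>i. i < n \<Longrightarrow> t i \<in> range Q" "\<And>i j. i < n \<Longrightarrow> j < n \<Longrightarrow> i \<noteq> j \<Longrightarrow> t i \<noteq> t j"
    and K: "range (blinfun_apply K) \<subseteq> range Q" "inj (blinfun_apply K)"
    and st: "shrinks_to n M C \<phi> a (\<lambda>_. K)" and \<phi>M: "\<And>i x. i < n \<Longrightarrow> x \<in> sphere 0 1 \<Longrightarrow> \<phi> i x \<in> M"
  shows "shrinks_to n M C \<phi> t (\<lambda>_. K)"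
proof -
  have linQ: "linear Q" using ch by (auto simp: chart_def)
  have sub: "subspace (range Q)" using linQ by (simp add: subspace_UNIV linear_subspace_image)
  let ?T = "\<lambda>p. span {a (fst p) - a (snd p), t (fst p) - t (snd p)}"
  have "\<exists>v\<in>range Q. \<forall>p\<in>{..<n} \<times> {..<n}. v \<notin> ?T p"
  proof (rule subspace_not_finite_union[OF _ sub])
    fix p
    let ?x = "a (fst p) - a (snd p)" and ?y = "t (fst p) - t (snd p)"
    have "dim {?x, ?y} \<le> card {?x, ?y}" by (rule dim_le_card') simp
    also have "\<dots> \<le> 2" by (cases "?x = ?y") simp_all
    finally have "dim (?T p) \<le> 2" unfolding dim_span .
    then show "subspace (?T p) \<and> \<not> range Q \<subseteq> ?T p"
      using dim_subset[of "range Q" "?T p"] dimW by auto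
  qed simp
  then obtain v where v': "v \<in> range Q" "\<forall>p\<in>{..<n} \<times> {..<n}. v \<notin> ?T p" by (elim bexE)
  have v: "v \<in> range Q" "v \<notin> span {a i - a j, t i - t j}" if "i < n" "j < n" for i j
    using v'(1) bspec[OF v'(2), of "(i, j)"] that by simp_all
  define A where "A u i = (1 - u) *\<^sub>R a i + u *\<^sub>R t i + (u * (1 - u) * real i) *\<^sub>R v" for u :: real and i
  have "shrinks_to n M C \<phi> (A 1) (\<lambda>_. K)"
  proof (rule shrinks_to_move[OF ch, where a = A and L = "\<lambda>_ _. K"])
    show "continuous_on {0..1} (\<lambda>u. A u i)" for i unfolding A_def by (intro continuous_intros)
    show "A u i \<in> range Q" if "i < n" for u i
      unfolding A_def using sub a(1)[OF that] t(1)[OF that] v'(1) by (intro subspace_add subspace_scale)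
    show "A u i \<noteq> A u j" if u: "u \<in> {0..1}" and ij: "i < n" "j < n" "i \<noteq> j" for u i j
    proof
      assume "A u i = A u j"
      define c where "c = u * (1 - u) * (real j - real i)"
      have e: "c *\<^sub>R v = (1 - u) *\<^sub>R (a i - a j) + u *\<^sub>R (t i - t j)"
        using \<open>A u i = A u j\<close> by (simp add: A_def c_def algebra_simps)
      show False
      proof (cases "c = 0")
        case True
        then have "u = 0 \<or> u = 1" using ij by (simp add: c_def)
        then show False using e True a(2)[OF ij] t(2)[OF ij] by auto
      next
        case False
        have "v = inverse c *\<^sub>R (c *\<^sub>R v)" using False by simp
        also have "\<dots> \<in> span {a i - a j, t i - t j}"
          unfolding e by (intro span_scale span_add) (auto intro: span_base)
        finally show False using v(2) ij by blast
      qed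
    qed
    show "shrinks_to n M C \<phi> (A 0) (\<lambda>_. K)" 
    proof -
      have "A 0 = a" by (simp add: A_def fun_eq_iff)
      then show ?thesis using st by simp
    qed
  qed (use K \<phi>M in \<open>auto intro: continuous_on_const\<close>)
  moreover have "A 1 = t" by (simp add: A_def fun_eq_iff)
  ultimately show ?thesis by simp
qed

end


section \<open>Shrinking disks to affine spheres\<close>

context C1_retract
begin

text \<open>Inside its disk each sphere is shrunk concentrically until it lies in the chart near the
  image of the centre. There, dividing by the scale deforms it into its linearization at the centre,
  an affine sphere.\<close>

lemma chart_full_isotopy:
  fixes f \<kappa> :: "nat \<Rightarrow> _" and \<phi> :: "nat \<Rightarrow> 'a::euclidean_space \<Rightarrow> 'b"
  assumes ch: "chart M Q C Ci V" and full: "\<And>y. y \<in> M \<inter> V \<Longrightarrow> Ci y \<in> range Q \<and> C (Ci y) = y"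
    and f: "\<And>i. i < n \<Longrightarrow> open (U i) \<and> cball 0 1 \<subseteq> U i \<and> C1o (U i) (f i)"
    and \<kappa>: "\<And>i. i < n \<Longrightarrow> open (P i) \<and> C1o (P i) (\<kappa> i)"
      "\<And>i x. i < n \<Longrightarrow> x \<in> cball 0 1 \<Longrightarrow> f i x \<in> M \<and> f i x \<in> P i \<and> \<kappa> i (f i x) = x"
    and disj: "\<And>i j x y. i < n \<Longrightarrow> j < n \<Longrightarrow> i \<noteq> j \<Longrightarrow> x \<in> cball 0 1 \<Longrightarrow> y \<in> cball 0 1 \<Longrightarrow> f i x \<noteq> f j y"
    and \<phi>: "\<And>i x. i < n \<Longrightarrow> x \<in> sphere 0 1 \<Longrightarrow> f i x = \<phi> i x"
    and V0: "\<And>i. i < n \<Longrightarrow> f i 0 \<in> V"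
  obtains a and L :: "nat \<Rightarrow> 'a \<Rightarrow>\<^sub>L 'b" where
    "\<forall>i<n. a i \<in> range Q \<and> range (blinfun_apply (L i)) \<subseteq> range Q \<and> inj (blinfun_apply (L i))"
    "\<forall>i<n. \<forall>j<n. i \<noteq> j \<longrightarrow> a i \<noteq> a j" "shrinks_to n M C \<phi> a L"
proof -
  have linQ: "linear Q" and QQ: "\<And>v. Q (Q v) = Q v" and C: "C1o UNIV C" and CM: "range C \<subseteq> M"
    and V: "open V" and Ci: "C1o V Ci" and inv: "\<And>w. w \<in> range Q \<Longrightarrow> C w \<in> V \<and> Ci (C w) = w"
    using ch by (auto simp: chart_def)
  have sub: "subspace (range Q)" using linQ by (simp add: subspace_UNIV linear_subspace_image)
  define R where "R = ball 0 1 \<inter> (\<Inter>i\<in>{..<n}. ball 0 1 \<inter> f i -` V)"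
  have fb: "C1o (ball 0 1) (f i)" if "i < n" for i
    by (rule C1o_mono[of "U i"]) (use f[OF that] ball_subset_cball in auto)
  have "open R" unfolding R_def
    by (intro open_Int open_INT open_ball ballI continuous_open_preimage[OF C1o_imp_continuous_on[OF fb]] V) auto
  moreover have "0 \<in> R" using V0 by (auto simp: R_def)
  ultimately obtain \<rho> where \<rho>: "\<rho> > 0" "ball 0 \<rho> \<subseteq> R" by (rule openE)
  have \<rho>1: "ball 0 \<rho> \<subseteq> ball (0::'a) 1" using \<rho>(2) by (auto simp: R_def)
  have \<rho>c: "x \<in> cball 0 1" if "x \<in> ball 0 \<rho>" for x :: 'a using \<rho>1 that by auto
  have fV: "f i x \<in> V" if "i < n" "x \<in> ball 0 \<rho>" for i x
    using subsetD[OF \<rho>(2) that(2)] that(1) unfolding R_def by blast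
  define \<xi> where "\<xi> i x = Ci (f i x)" for i x
  have \<xi>: "C1o (ball 0 \<rho>) (\<xi> i)" if "i < n" for i
    unfolding \<xi>_def by (rule C1o_compose[OF C1o_mono[OF fb[OF that] \<rho>1] Ci]) (rule fV[OF that])
  have C\<xi>: "\<xi> i x \<in> range Q" "C (\<xi> i x) = f i x" if "i < n" "x \<in> ball 0 \<rho>" for i x
    using full[of "f i x"] fV[OF that] \<kappa>(2)[OF that(1) \<rho>c[OF that(2)]] by (auto simp: \<xi>_def)
  define a where "a i = \<xi> i 0" for i
  define L where "L i = Dif (\<xi> i) 0" for i
  have 0: "0 \<in> ball (0::'a) \<rho>" using \<rho> by simp
  have aQ: "a i \<in> range Q" "C (a i) = f i 0" if "i < n" for i using C\<xi>[OF that 0] by (auto simp: a_def)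
  have adist: "a i \<noteq> a j" if "i < n" "j < n" "i \<noteq> j" for i j
    using disj[OF that, of 0 0] aQ(2)[OF that(1)] aQ(2)[OF that(2)] by auto
  have LQ: "blinfun_apply (L i) v \<in> range Q" if i: "i < n" for i v
  proof -
    have bQ: "C1o UNIV Q" by (rule C1o_linear) (use linQ in \<open>simp add: linear_conv_bounded_linear\<close>)
    have DQ: "Dif Q x = Blinfun Q" for x
      using linQ by (intro Dif_eqI) (simp add: linear_conv_bounded_linear bounded_linear_Blinfun_apply bounded_linear_imp_has_derivative)
    have Q\<xi>: "Q (\<xi> i x) = \<xi> i x" if x: "x \<in> ball 0 \<rho>" for x
    proof -
      obtain v where "\<xi> i x = Q v" using C\<xi>(1)[OF i x] by blast
      then show ?thesis using QQ by simp
    qed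
    have "C1o (ball 0 \<rho>) (\<lambda>x. Q (\<xi> i x))" by (rule C1o_compose[OF \<xi>[OF i] bQ]) simp
    then have dQ: "(\<lambda>x. Q (\<xi> i x)) differentiable (at 0)" using 0 by (simp add: C1o_def)
    have "L i = Dif (\<lambda>x. Q (\<xi> i x)) 0" unfolding L_def
      by (rule Dif_cong[OF open_ball 0 Q\<xi> dQ])
    also have "\<dots> = Blinfun Q o\<^sub>L L i"
      unfolding L_def using Dif_compose[OF \<xi>[OF i] bQ 0] DQ by simp
    finally have "blinfun_apply (L i) v = blinfun_apply (Blinfun Q o\<^sub>L L i) v" by simp
    also have "\<dots> = Q (blinfun_apply (L i) v)"
      using linQ by (simp add: linear_conv_bounded_linear bounded_linear_Blinfun_apply)
    finally show ?thesis by (rule range_eqI)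
  qed
  \<comment> \<open>Near 0 the map \<kappa> i after C is a C1 left inverse of \<xi> i, so the
    derivative at 0 has a left inverse.\<close>
  have Linj: "inj (blinfun_apply (L i))" if i: "i < n" for i
  proof -
    define T where "T = UNIV \<inter> C -` P i"
    have T: "open T" unfolding T_def
      by (rule continuous_open_preimage[OF C1o_imp_continuous_on[OF C] open_UNIV]) (use \<kappa>(1)[OF i] in simp)
    have kC: "C1o T (\<lambda>w. \<kappa> i (C w))"
      by (rule C1o_compose[OF C1o_mono[OF C subset_UNIV]]) (use \<kappa>(1)[OF i] in \<open>auto simp: T_def\<close>)
    have \<xi>T: "\<xi> i x \<in> T \<and> \<kappa> i (C (\<xi> i x)) = x" if "x \<in> ball 0 \<rho>" for x
      using \<kappa>(2)[OF i \<rho>c[OF that]] C\<xi>(2)[OF i that] by (simp add: T_def)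
    have "Dif (\<lambda>x. \<kappa> i (C (\<xi> i x))) 0 = Dif (\<lambda>x. x) 0"
      by (rule Dif_cong[OF open_ball 0]) (use \<xi>T in auto)
    then have "Dif (\<lambda>w. \<kappa> i (C w)) (a i) o\<^sub>L L i = id_blinfun"
      using Dif_compose[OF \<xi>[OF i] kC 0] \<xi>T[OF 0] by (simp add: a_def L_def)
    then have "blinfun_apply (Dif (\<lambda>w. \<kappa> i (C w)) (a i)) (blinfun_apply (L i) x) = x" for x
      by (metis blinfun_apply_blinfun_compose blinfun_apply_id_blinfun id_apply)
    then show ?thesis by (metis injI)
  qed
  \<comment> \<open>A constant with norm (\<xi> i y - a i) \<le> B * norm y near 0; the 1 absorbs
    the remainder of the linear approximation. The bound is invariant under rescaling, so throughout
    the deformation the spheres stay within B \<delta> of their centres.\<close>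
  define B where "B = 1 + (\<Sum>i<n. norm (L i))"
  have B: "norm (L i) + 1 \<le> B" if "i < n" for i
    using member_le_sum[of i "{..<n}" "\<lambda>i. norm (L i)"] that by (simp add: B_def)
  have B1: "B \<ge> 1" by (simp add: B_def sum_nonneg)
  have "eventually (\<lambda>y. \<forall>i\<in>{..<n}. norm (\<xi> i y - a i) \<le> B * norm y) (nhds 0)"
  proof (rule eventually_ball_finite)
    show "\<forall>i\<in>{..<n}. eventually (\<lambda>y. norm (\<xi> i y - a i) \<le> B * norm y) (nhds 0)"
    proof
      fix i assume "i \<in> {..<n}"
      then have i: "i < n" by simp
      have "\<exists>d>0. \<forall>y\<in>UNIV. norm (y - 0) < d \<longrightarrow> norm (\<xi> i y - \<xi> i 0 - blinfun_apply (L i) (y - 0)) \<le> 1 * norm (y - 0)"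
        using conjunct2[OF C1o_D[OF \<xi>[OF i] 0, unfolded has_derivative_within_alt], rule_format, OF zero_less_one]
        unfolding L_def by blast
      then obtain d where d: "d > 0" "\<And>y. norm y < d \<Longrightarrow> norm (\<xi> i y - a i - blinfun_apply (L i) y) \<le> norm y"
        by (auto simp: a_def)
      have "norm (\<xi> i y - a i) \<le> B * norm y" if "norm y < d" for y
      proof -
        have "norm (\<xi> i y - a i) \<le> norm (\<xi> i y - a i - blinfun_apply (L i) y) + norm (blinfun_apply (L i) y)"
          using norm_triangle_ineq[of "\<xi> i y - a i - blinfun_apply (L i) y" "blinfun_apply (L i) y"] by simp
        also have "\<dots> \<le> norm y + norm (L i) * norm y" using d(2)[OF that] norm_blinfun[of "L i" y] by simp
        also have "\<dots> = (norm (L i) + 1) * norm y" by (simp add: algebra_simps)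
        also have "\<dots> \<le> B * norm y" using B[OF i] by (intro mult_right_mono) auto
        finally show ?thesis .
      qed
      then show "eventually (\<lambda>y. norm (\<xi> i y - a i) \<le> B * norm y) (nhds 0)"
        unfolding eventually_nhds_metric using d(1) by (intro exI[of _ d]) simp
    qed
  qed simp
  then obtain \<rho>2 where \<rho>2: "\<rho>2 > 0" "\<And>y i. norm y < \<rho>2 \<Longrightarrow> i < n \<Longrightarrow> norm (\<xi> i y - a i) \<le> B * norm y"
    unfolding eventually_nhds_metric by auto
  \<comment> \<open>With a one-point parameter space the compactness lemma is a minimum over
    finitely many pairs.\<close>
  have "\<exists>m>0. \<forall>p\<in>{(i, j). i < n \<and> j < n \<and> i \<noteq> j}. \<forall>z\<in>{0::real}. m \<le> norm (a (fst p) - a (snd p))"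
  proof (rule compact_uniform_lower_bound)
    have "{(i, j). i < n \<and> j < n \<and> i \<noteq> j} \<subseteq> {..<n} \<times> {..<n}" by auto
    then show "finite {(i, j). i < n \<and> j < n \<and> i \<noteq> j}" by (rule finite_subset) simp
  qed (use adist in \<open>auto intro: continuous_on_const\<close>)
  then obtain m where m: "m > 0" "\<And>i j. i < n \<Longrightarrow> j < n \<Longrightarrow> i \<noteq> j \<Longrightarrow> m \<le> norm (a i - a j)" by fastforce
  \<comment> \<open>The normalized remainder. By the convention that the inverse of 0 is 0 its value
    at z = 0 is 0, which is also its limit by differentiability; so \<open>q i\<close> is continuous
    at 0.\<close>
  define q where "q i z = inverse (norm z) *\<^sub>R (\<xi> i z - a i - blinfun_apply (L i) z)" for i z
  have qc: "continuous_on (ball 0 \<rho>) (q i)" if i: "i < n" for i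
  proof (rule continuous_at_imp_continuous_on, rule ballI)
    fix z :: 'a assume z: "z \<in> ball 0 \<rho>"
    show "isCont (q i) z"
    proof (cases "z = 0")
      case True
      have "((\<lambda>h. norm (\<xi> i (0 + h) - \<xi> i 0 - blinfun_apply (L i) h) / norm h) \<longlongrightarrow> 0) (at 0)"
        using C1o_D[OF \<xi>[OF i] 0] unfolding has_derivative_at L_def by simp
      then have "((\<lambda>h. norm (q i h)) \<longlongrightarrow> 0) (at 0)"
        by (simp add: q_def a_def divide_inverse mult.commute)
      then have "(q i \<longlongrightarrow> 0) (at 0)" by (rule tendsto_norm_zero_cancel)
      then show ?thesis using True by (simp add: isCont_def q_def)
    next
      case False
      have "isCont (\<xi> i) z"
        using has_derivative_continuous[OF C1o_D[OF \<xi>[OF i] z]] .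
      then show ?thesis unfolding q_def using False by (intro continuous_intros) auto
    qed
  qed
  \<comment> \<open>\<open>H \<delta> i u y\<close> is \<open>a i + (\<xi> i (u \<delta> y) - a i) / u\<close>, written so that it extends continuously
    to \<open>u = 0\<close>, where it is the linearization at 0.\<close>
  define H where "H \<delta> i u y = a i + \<delta> *\<^sub>R (blinfun_apply (L i) y + norm y *\<^sub>R q i ((u * \<delta>) *\<^sub>R y))" for \<delta> u :: real and i y
  have Hu: "H \<delta> i u y = a i + inverse u *\<^sub>R (\<xi> i ((u * \<delta>) *\<^sub>R y) - a i)" if "0 < u" "0 < \<delta>" for \<delta> i u y
  proof (cases "y = 0")
    case True
    then show ?thesis by (simp add: H_def a_def blinfun.zero_right)
  next
    case False
    then have "\<delta> * norm y * inverse (u * \<delta> * norm y) = inverse u" using that by (simp add: field_simps)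
    then have "\<delta> *\<^sub>R norm y *\<^sub>R q i ((u * \<delta>) *\<^sub>R y) = inverse u *\<^sub>R (\<xi> i ((u * \<delta>) *\<^sub>R y) - a i - (u * \<delta>) *\<^sub>R blinfun_apply (L i) y)"
      using that by (simp add: q_def blinfun.scaleR_right abs_mult)
    then show ?thesis using that by (simp add: H_def scaleR_add_right scaleR_diff_right)
  qed
  have H0: "H \<delta> i 0 y = a i + \<delta> *\<^sub>R blinfun_apply (L i) y" for \<delta> i y by (simp add: H_def q_def a_def blinfun.zero_right)
  have main: "isotopic n M \<phi> (cfg C a (\<lambda>i. \<delta> *\<^sub>R L i))"
    if \<delta>: "0 < \<delta>" "\<delta> < \<rho>" "\<delta> < \<rho>2" "2 * B * \<delta> < m" for \<delta>
  proof -
    have \<delta>1: "\<delta> < 1" 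
    proof -
      obtain b :: 'a where "b \<in> Basis" using nonempty_Basis by blast
      then have "norm (\<delta> *\<^sub>R b) = \<delta>" using \<delta>(1) by simp
      then have "\<delta> *\<^sub>R b \<in> ball 0 \<rho>" using \<delta>(2) by simp
      then have "\<delta> *\<^sub>R b \<in> ball 0 1" using \<rho>1 by blast
      then show ?thesis using \<open>norm (\<delta> *\<^sub>R b) = \<delta>\<close> by simp
    qed
    have Yb: "(u * \<delta>) *\<^sub>R y \<in> ball 0 \<rho>" if "u \<in> {0..1}" "y \<in> ball 0 (\<rho> / \<delta>)" for u and y :: 'a
    proof -
      have "norm ((u * \<delta>) *\<^sub>R y) = u * (\<delta> * norm y)" using that \<delta> by (simp add: abs_mult)
      also have "\<dots> \<le> 1 * (\<delta> * norm y)" using that \<delta> by (intro mult_right_mono) auto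
      also have "\<dots> < \<rho>" using that \<delta> by (simp add: field_simps)
      finally show ?thesis by simp
    qed
    have cy: "continuous_on ({0..1} \<times> ball 0 (\<rho> / \<delta>)) (\<lambda>p. (fst p * \<delta>) *\<^sub>R (snd p :: 'a))"
      by (intro continuous_intros)
    \<comment> \<open>For u > 0 the chain rule gives \<delta> times the derivative of \<xi> i at u
      \<delta> y. The same expression is correct at u = 0, so its joint continuity follows from that
      of \<open>Dif (\<xi> i)\<close>.\<close>
    have HF: "C1_fam {0..1} (ball 0 (\<rho> / \<delta>)) (H \<delta> i)" if i: "i < n" for i
    proof (rule C1_famI[where G' = "\<lambda>u y. \<delta> *\<^sub>R Dif (\<xi> i) ((u * \<delta>) *\<^sub>R y)"])
      have cq: "continuous_on ({0..1} \<times> ball 0 (\<rho> / \<delta>)) (\<lambda>p. q i ((fst p * \<delta>) *\<^sub>R snd p))"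
        by (rule continuous_on_compose2[OF qc[OF i] cy]) (use Yb in auto)
      show "continuous_on ({0..1} \<times> ball 0 (\<rho> / \<delta>)) (\<lambda>p. H \<delta> i (fst p) (snd p))"
        unfolding H_def by (intro continuous_intros cq)
      show "continuous_on ({0..1} \<times> ball 0 (\<rho> / \<delta>)) (\<lambda>p. \<delta> *\<^sub>R Dif (\<xi> i) ((fst p * \<delta>) *\<^sub>R snd p))"
        by (intro continuous_intros continuous_on_compose2[OF C1o_Dif[OF \<xi>[OF i]] cy]) (use Yb in auto)
      fix u :: real and y :: 'a assume u: "u \<in> {0..1}" and y: "y \<in> ball 0 (\<rho> / \<delta>)"
      show "(H \<delta> i u has_derivative blinfun_apply (\<delta> *\<^sub>R Dif (\<xi> i) ((u * \<delta>) *\<^sub>R y))) (at y)"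
      proof (cases "u = 0")
        case True
        have "((\<lambda>y. a i + \<delta> *\<^sub>R blinfun_apply (L i) y) has_derivative (\<lambda>v. \<delta> *\<^sub>R blinfun_apply (L i) v)) (at y)"
          by (auto intro!: derivative_eq_intros)
        moreover have "(\<lambda>y. a i + \<delta> *\<^sub>R blinfun_apply (L i) y) = H \<delta> i u" using True H0 by auto
        moreover have "(\<lambda>v. \<delta> *\<^sub>R blinfun_apply (L i) v) = blinfun_apply (\<delta> *\<^sub>R Dif (\<xi> i) ((u * \<delta>) *\<^sub>R y))"
          using True by (simp add: fun_eq_iff L_def scaleR_blinfun.rep_eq)
        ultimately show ?thesis by simp
      next
        case False
        then have u0: "u > 0" using u by simp
        have "((\<lambda>y. \<xi> i ((u * \<delta>) *\<^sub>R y)) has_derivative (\<lambda>v. blinfun_apply (Dif (\<xi> i) ((u * \<delta>) *\<^sub>R y)) ((u * \<delta>) *\<^sub>R v))) (at y)"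
          by (rule has_derivative_compose[of "\<lambda>y. (u * \<delta>) *\<^sub>R y" "\<lambda>v. (u * \<delta>) *\<^sub>R v" y UNIV "\<xi> i", OF _ C1o_D[OF \<xi>[OF i] Yb[OF u y]]])
            (auto intro!: derivative_eq_intros)
        then have "((\<lambda>y. a i + inverse u *\<^sub>R (\<xi> i ((u * \<delta>) *\<^sub>R y) - a i)) has_derivative
            (\<lambda>v. inverse u *\<^sub>R blinfun_apply (Dif (\<xi> i) ((u * \<delta>) *\<^sub>R y)) ((u * \<delta>) *\<^sub>R v))) (at y)"
          by (auto intro!: derivative_eq_intros)
        moreover have "(\<lambda>y. a i + inverse u *\<^sub>R (\<xi> i ((u * \<delta>) *\<^sub>R y) - a i)) = H \<delta> i u"
          using Hu[OF u0 \<delta>(1)] by auto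
        moreover have "(\<lambda>v. inverse u *\<^sub>R blinfun_apply (Dif (\<xi> i) ((u * \<delta>) *\<^sub>R y)) ((u * \<delta>) *\<^sub>R v)) =
            blinfun_apply (\<delta> *\<^sub>R Dif (\<xi> i) ((u * \<delta>) *\<^sub>R y))"
          using u0 by (simp add: fun_eq_iff blinfun.scaleR_right scaleR_blinfun.rep_eq)
        ultimately show ?thesis by simp
      qed
    qed
    have nY: "nrm x \<in> ball 0 (\<rho> / \<delta>)" if "x \<in> - {0}" for x :: 'a
      using norm_nrm[of x] that \<delta> by simp
    define p2 where "p2 u i x = C (H \<delta> i u (nrm x))" for u i x
    have p2F: "C1_fam {0..1} (- {0}) (\<lambda>u. p2 u i)" if i: "i < n" for i
    proof -
      have "C1_fam {0..1} (- {0}) (\<lambda>u x. H \<delta> i u (nrm x))"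
        by (rule C1_fam_compose[OF C1_fam_fixed[OF C1o_nrm] HF[OF i]]) (rule nY)
      then show ?thesis unfolding p2_def by (rule C1_fam_compose[OF _ C1_fam_fixed[OF C]]) simp
    qed
    have HQ: "H \<delta> i u y \<in> range Q" "norm (H \<delta> i u y - a i) \<le> B * \<delta>" if i: "i < n" and u: "u \<in> {0..1}" and y: "norm y = 1" for i u y
    proof -
      have yb: "y \<in> ball 0 (\<rho> / \<delta>)" using y \<delta> by simp
      have "H \<delta> i u y \<in> range Q \<and> norm (H \<delta> i u y - a i) \<le> B * \<delta>"
      proof (cases "u = 0")
        case True
        have "norm (\<delta> *\<^sub>R blinfun_apply (L i) y) \<le> \<delta> * norm (L i)"
          using norm_blinfun[of "L i" y] y \<delta>(1) by simp
        also have "\<dots> \<le> \<delta> * B" using B[OF i] \<delta>(1) by simp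
        finally show ?thesis using True sub aQ[OF i] LQ[OF i] by (simp add: H0 subspace_add subspace_scale mult.commute)
      next
        case False
        then have u0: "u > 0" using u by simp
        have "H \<delta> i u y \<in> range Q"
          unfolding Hu[OF u0 \<delta>(1)]
          using sub aQ(1)[OF i] C\<xi>(1)[OF i Yb[OF u yb]] by (intro subspace_add subspace_scale subspace_diff)
        have nn: "norm ((u * \<delta>) *\<^sub>R y) = u * \<delta>" using u0 \<delta> y by simp
        have "u * \<delta> \<le> 1 * \<delta>" by (rule mult_right_mono) (use u \<delta> in auto)
        then have "norm ((u * \<delta>) *\<^sub>R y) < \<rho>2" unfolding nn using \<delta>(3) by simp
        from \<rho>2(2)[OF this i] have "norm (\<xi> i ((u * \<delta>) *\<^sub>R y) - a i) \<le> B * (u * \<delta>)"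
          unfolding nn .
        then have "inverse u * norm (\<xi> i ((u * \<delta>) *\<^sub>R y) - a i) \<le> inverse u * (B * (u * \<delta>))"
          using u0 by (intro mult_left_mono) auto
        moreover have "inverse u * (B * (u * \<delta>)) = B * \<delta>" using u0 by simp
        moreover have "norm (H \<delta> i u y - a i) = inverse u * norm (\<xi> i ((u * \<delta>) *\<^sub>R y) - a i)"
          unfolding Hu[OF u0 \<delta>(1)] using u0 by simp
        ultimately have "norm (H \<delta> i u y - a i) \<le> B * \<delta>" by simp
        with \<open>H \<delta> i u y \<in> range Q\<close> show ?thesis by blast
      qed
      then show "H \<delta> i u y \<in> range Q" "norm (H \<delta> i u y - a i) \<le> B * \<delta>" by auto
    qed
    have p2E: "is_emb n M (p2 u)" if u: "u \<in> {0..1}" for u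
    proof (rule is_embI)
      show "C1o (- {0}) (p2 u i)" if "i < n" for i by (rule C1_fam_at[OF p2F[OF that] u])
      show "p2 u i x \<in> M" for i x using CM by (auto simp: p2_def)
      show "\<exists>U \<kappa>. open U \<and> C1o U \<kappa> \<and> (\<forall>x\<in>sphere 0 1. p2 u i x \<in> U \<and> \<kappa> (p2 u i x) = x)" if i: "i < n" for i
      proof (cases "u = 0")
        case True
        obtain h where h: "linear h" "\<And>x. h (blinfun_apply (L i) x) = x"
          using linear_injective_left_inverse[OF bounded_linear.linear[OF blinfun.bounded_linear_right] Linj[OF i]]
          by (metis comp_apply id_apply)
        have "C1o V (\<lambda>y. inverse \<delta> *\<^sub>R h (Ci y - a i))"
          by (rule C1o_scaleR[OF C1o_const C1o_compose[OF C1o_diff[OF Ci C1o_const] C1o_linear[of h UNIV]]])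
            (use h(1) in \<open>simp_all add: linear_conv_bounded_linear\<close>)
        moreover have "p2 u i x \<in> V \<and> inverse \<delta> *\<^sub>R h (Ci (p2 u i x) - a i) = x" if "x \<in> sphere 0 1" for x
        proof -
          have "H \<delta> i u x \<in> range Q" by (rule HQ(1)[OF i u]) (use that in simp)
          from inv[OF this] show ?thesis
            using that h(2) \<delta>(1) True by (simp add: p2_def nrm_sphere[OF that] H0 linear_cmul[OF h(1)])
        qed
        ultimately show ?thesis using V by blast
      next
        case False
        then have u0: "u > 0" using u by simp
        \<comment> \<open>A left inverse for u > 0: undo the division by u in the chart, return to
          M, apply the left inverse \<kappa> i of the disk, and divide by u \<delta>.\<close>
        define W where "W = V \<inter> (\<lambda>y. C (a i + u *\<^sub>R (Ci y - a i))) -` P i"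
        have cW: "C1o V (\<lambda>y. C (a i + u *\<^sub>R (Ci y - a i)))"
          by (rule C1o_compose[OF C1o_add[OF C1o_const C1o_scaleR[OF C1o_const C1o_diff[OF Ci C1o_const]]] C]) simp
        have W: "open W" unfolding W_def
          by (rule continuous_open_preimage[OF C1o_imp_continuous_on[OF cW] V]) (use \<kappa>(1)[OF i] in simp)
        have WV: "W \<subseteq> V" by (auto simp: W_def)
        have "C1o W (\<lambda>y. inverse (u * \<delta>) *\<^sub>R \<kappa> i (C (a i + u *\<^sub>R (Ci y - a i))))"
          by (rule C1o_scaleR[OF C1o_const C1o_compose[OF C1o_mono[OF cW WV] conjunct2[OF \<kappa>(1)[OF i]]]]) (simp add: W_def)
        moreover have "p2 u i x \<in> W \<and> inverse (u * \<delta>) *\<^sub>R \<kappa> i (C (a i + u *\<^sub>R (Ci (p2 u i x) - a i))) = x"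
          if x: "x \<in> sphere 0 1" for x
        proof -
          have xb: "(u * \<delta>) *\<^sub>R x \<in> ball 0 \<rho>" by (rule Yb[OF u]) (use x \<delta> in simp)
          have "H \<delta> i u x \<in> range Q" by (rule HQ(1)[OF i u]) (use x in simp)
          from inv[OF this] have c: "p2 u i x \<in> V" "Ci (p2 u i x) = H \<delta> i u x" by (simp_all add: p2_def nrm_sphere[OF x])
          have "C (a i + u *\<^sub>R (Ci (p2 u i x) - a i)) = C (\<xi> i ((u * \<delta>) *\<^sub>R x))"
            unfolding c(2) Hu[OF u0 \<delta>(1)] using u0 by simp
          also have "\<dots> = f i ((u * \<delta>) *\<^sub>R x)" by (rule C\<xi>(2)[OF i xb])
          finally have e: "C (a i + u *\<^sub>R (Ci (p2 u i x) - a i)) = f i ((u * \<delta>) *\<^sub>R x)" .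
          have "u * \<delta> \<noteq> 0" using u0 \<delta>(1) by simp
          then have "inverse (u * \<delta>) *\<^sub>R ((u * \<delta>) *\<^sub>R x) = x" unfolding scaleR_scaleR by (simp only: left_inverse scaleR_one not_False_eq_True)
          then show ?thesis
            using c(1) \<kappa>(2)[OF i \<rho>c[OF xb]] by (simp add: W_def e del: scaleR_scaleR inverse_mult_distrib)
        qed
        ultimately show ?thesis using W by blast
      qed
      fix i j and x y :: 'a assume ij: "i < n" "j < n" "i \<noteq> j" and xy: "x \<in> sphere 0 1" "y \<in> sphere 0 1"
      show "p2 u i x \<noteq> p2 u j y"
      proof
        assume e: "p2 u i x = p2 u j y"
        have n1: "norm x = 1" "norm y = 1" using xy by auto
        have "H \<delta> i u x = H \<delta> j u y"
          using e inv[OF HQ(1)[OF ij(1) u n1(1)]] inv[OF HQ(1)[OF ij(2) u n1(2)]]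
          unfolding p2_def nrm_sphere[OF xy(1)] nrm_sphere[OF xy(2)] by metis
        then have "a i - a j = (H \<delta> j u y - a j) - (H \<delta> i u x - a i)" by simp
        then have "norm (a i - a j) \<le> norm (H \<delta> j u y - a j) + norm (H \<delta> i u x - a i)"
          using norm_triangle_ineq4 by metis
        also have "\<dots> \<le> 2 * B * \<delta>" using HQ(2)[OF ij(1) u n1(1)] HQ(2)[OF ij(2) u n1(2)] by simp
        finally show False using m(2)[OF ij] \<delta>(4) by simp
      qed
    qed
    \<comment> \<open>The concentric stage: the radius goes from 1 down to \<delta>, where p2 at u =
      1 takes over.\<close>
    define p1 where "p1 u i x = f i ((1 - u * (1 - \<delta>)) *\<^sub>R nrm x)" for u i x
    have s: "\<delta> \<le> 1 - u * (1 - \<delta>)" "1 - u * (1 - \<delta>) \<le> 1" if "u \<in> {0..1}" for u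
    proof -
      have "u * (1 - \<delta>) \<le> 1 * (1 - \<delta>)" by (rule mult_right_mono) (use that \<delta>1 in auto)
      then show "\<delta> \<le> 1 - u * (1 - \<delta>)" by simp
      have "0 \<le> u * (1 - \<delta>)" using that \<delta>1 by simp
      then show "1 - u * (1 - \<delta>) \<le> 1" by simp
    qed
    have sc: "(1 - u * (1 - \<delta>)) *\<^sub>R nrm x \<in> cball 0 1" if "u \<in> {0..1}" "x \<noteq> 0" for u and x :: 'a
      using s[OF that(1)] norm_nrm[OF that(2)] \<delta>(1) by simp
    have p1F: "C1_fam {0..1} (- {0}) (\<lambda>u. p1 u i)" if i: "i < n" for i
    proof -
      have "C1_fam {0..1} (- {0}) (\<lambda>(u::real) (x::'a). (1 - u * (1 - \<delta>)) *\<^sub>R nrm x)"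
        by (rule C1_fam_scaleR[OF C1_fam_param C1_fam_fixed[OF C1o_nrm]]) (intro continuous_intros)
      then show ?thesis unfolding p1_def
        by (rule C1_fam_compose[OF _ C1_fam_fixed[of "U i"]]) (use f[OF i] sc in auto)
    qed
    have p1E: "is_emb n M (p1 u)" if u: "u \<in> {0..1}" for u
    proof (rule is_embI)
      let ?s = "1 - u * (1 - \<delta>)"
      have s0: "?s > 0" using s[OF u] \<delta>(1) by simp
      have px: "p1 u i x = f i (?s *\<^sub>R x)" "?s *\<^sub>R x \<in> cball 0 1" if x: "x \<in> sphere 0 1" for i x
      proof -
        have "x \<noteq> 0" using x by auto
        from sc[OF u this] show "p1 u i x = f i (?s *\<^sub>R x)" "?s *\<^sub>R x \<in> cball 0 1"
          by (simp_all only: p1_def nrm_sphere[OF x])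
      qed
      show "C1o (- {0}) (p1 u i)" if "i < n" for i by (rule C1_fam_at[OF p1F[OF that] u])
      show "p1 u i x \<in> M" if "i < n" "x \<in> sphere 0 1" for i x
        using px[OF that(2)] \<kappa>(2)[OF that(1)] by metis
      show "\<exists>U \<kappa>. open U \<and> C1o U \<kappa> \<and> (\<forall>x\<in>sphere 0 1. p1 u i x \<in> U \<and> \<kappa> (p1 u i x) = x)" if i: "i < n" for i
      proof (intro exI conjI ballI)
        show "open (P i)" using \<kappa>(1)[OF i] by simp
        show "C1o (P i) (\<lambda>y. inverse ?s *\<^sub>R \<kappa> i y)" using \<kappa>(1)[OF i] by (intro C1o_scaleR C1o_const) simp
        fix x :: 'a assume x: "x \<in> sphere 0 1"
        show "p1 u i x \<in> P i" "inverse ?s *\<^sub>R \<kappa> i (p1 u i x) = x"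
          using px[OF x] \<kappa>(2)[OF i px(2)[OF x]] s0 by simp_all
      qed
      show "p1 u i x \<noteq> p1 u j y" if "i < n" "j < n" "i \<noteq> j" "x \<in> sphere 0 1" "y \<in> sphere 0 1" for i j x y
        using disj[OF that(1-3) px(2)[OF that(4)] px(2)[OF that(5)]] px(1)[OF that(4)] px(1)[OF that(5)] by simp
    qed
    have i1: "isotopic n M (p1 0) (p1 1)" by (rule isotopic_path[OF p1F p1E])
    have "isotopic n M (p2 (1 - 0)) (p2 (1 - 1))"
    proof (rule isotopic_path[of n "\<lambda>u. p2 (1 - u)"])
      show "C1_fam {0..1} (- {0}) (\<lambda>u. p2 (1 - u) i)" if "i < n" for i
        by (rule C1_fam_reparam[OF p2F[OF that]]) (auto intro: continuous_intros)
      show "is_emb n M (p2 (1 - u))" if "u \<in> {0..1}" for u by (rule p2E) (use that in auto)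
    qed
    then have i2: "isotopic n M (p2 1) (p2 0)" by simp
    have e0: "p1 0 i x = \<phi> i x" if "i < n" "x \<in> sphere 0 1" for i x
      using \<phi>[OF that] by (simp add: p1_def nrm_sphere[OF that(2)])
    have e1: "p1 1 i x = p2 1 i x" if "i < n" "x \<in> sphere 0 1" for i x
    proof -
      have "\<delta> *\<^sub>R x \<in> ball 0 \<rho>" using that \<delta> by simp
      from C\<xi>(2)[OF that(1) this] show ?thesis
        by (simp add: p1_def p2_def nrm_sphere[OF that(2)] Hu[OF zero_less_one \<delta>(1)])
    qed
    have e2: "p2 0 i x = cfg C a (\<lambda>i. \<delta> *\<^sub>R L i) i x" for i x
      by (simp add: p2_def cfg_def H0 scaleR_blinfun.rep_eq)
    have i1': "isotopic n M \<phi> (p2 1)" using i1 e0 e1 unfolding isotopic_def by auto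
    have "isotopic n M \<phi> (p2 0)"
    proof (rule isotopic_trans[OF i1' i2])
      show "\<phi> i x \<in> M" if "i < n" "x \<in> sphere 0 1" for i x
        using is_emb_D(1)[OF p1E[of 0] that] e0[OF that] by simp
    qed
    then show ?thesis using e2 unfolding isotopic_def by simp
  qed
  \<comment> \<open>The halves, and 4 B in place of 2 B, turn \<delta> \<le> \<delta>0 into the
    strict inequalities of \<open>main\<close>.\<close>
  define \<delta>0 where "\<delta>0 = min (min (\<rho> / 2) (\<rho>2 / 2)) (m / (4 * B))"
  have "\<delta>0 > 0" using \<rho>(1) \<rho>2(1) m(1) B1 by (simp add: \<delta>0_def)
  moreover have "isotopic n M \<phi> (cfg C a (\<lambda>i. \<delta> *\<^sub>R L i))" if "0 < \<delta>" "\<delta> \<le> \<delta>0" for \<delta>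
  proof (rule main)
    have "\<delta> \<le> m / (4 * B)" using that by (simp add: \<delta>0_def)
    then have "4 * B * \<delta> \<le> m" using B1 by (simp add: field_simps)
    then show "2 * B * \<delta> < m" using m(1) by simp
  qed (use that \<rho>(1) \<rho>2(1) in \<open>simp_all add: \<delta>0_def\<close>)
  ultimately have "shrinks_to n M C \<phi> a L" unfolding shrinks_to_def by blast
  then show thesis using aQ(1) LQ Linj adist by (intro that[of a L]) blast+
qed

end


section \<open>Unlinked spheres in standard position\<close>

context C1_retract
begin

text \<open>Pulls the chart back along g: a configuration that g makes affine in the old chart is
  itself affine in the new one.\<close>

lemma chart_diffeo:
  assumes ch: "chart M Q C Ci V" and g: "g \<in> Diff_c M"
  obtains C' Ci' V' where "chart M Q C' Ci' V'" "\<forall>w. C' w \<in> M \<and> g (C' w) = C w"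
proof -
  have linQ: "linear Q" and QQ: "\<And>v. Q (Q v) = Q v" and C: "C1o UNIV C" and CM: "\<And>w. C w \<in> M"
    and V: "open V" and Ci: "C1o V Ci" and inv: "\<And>w. w \<in> range Q \<Longrightarrow> C w \<in> V \<and> Ci (C w) = w"
    using ch by (auto simp: chart_def)
  obtain f h K where f: "C1o X f" "\<forall>x\<in>X. f x = g (r x) \<and> f x \<in> M"
    and h: "C1o X h" "\<forall>x\<in>X. h (r x) = h x \<and> h x \<in> M" and gh: "\<forall>x\<in>M. h (g x) = x \<and> g (h x) = x"
    and "compact K" "K \<subseteq> M" "\<forall>x\<in>M - K. g x = x"
    by (rule Diff_cE[OF g])
  have CX: "C w \<in> X" for w using CM M_sub by blast
  have hC: "h (C w) \<in> M" "g (h (C w)) = C w" for w using h(2) CX gh CM by blast+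
  have fh: "f (h (C w)) = C w" for w
    using f(2) hC[of w] M_sub r_id[OF hC(1)] by auto
  define V' where "V' = X \<inter> f -` V"
  have V': "open V'" unfolding V'_def
    by (rule continuous_open_preimage[OF C1o_imp_continuous_on[OF f(1)] open_X V])
  have fV: "C1o V' f" by (rule C1o_mono[OF f(1)]) (auto simp: V'_def)
  show thesis
  proof (rule that[of "\<lambda>w. h (C w)" "\<lambda>y. Ci (f y)" V'])
    show "chart M Q (\<lambda>w. h (C w)) (\<lambda>y. Ci (f y)) V'"
      unfolding chart_def
    proof (intro conjI allI ballI)
      show "C1o UNIV (\<lambda>w. h (C w))" by (rule C1o_compose[OF C h(1)]) (rule CX)
      show "C1o V' (\<lambda>y. Ci (f y))" by (rule C1o_compose[OF fV Ci]) (simp add: V'_def)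
      show "range (\<lambda>w. h (C w)) \<subseteq> M" using hC by auto
      fix w assume w: "w \<in> range Q"
      have "h (C w) \<in> X" using hC M_sub by blast
      then show "h (C w) \<in> V'" using inv[OF w] fh by (simp add: V'_def)
      show "Ci (f (h (C w))) = w" using inv[OF w] fh by simp
    qed (fact linQ QQ V')+
    show "\<forall>w. h (C w) \<in> M \<and> g (h (C w)) = C w" using hC by blast
  qed
qed

text \<open>The chart is adapted to \<phi>, so the base point itself is not moved. K is common to
  all indices, which makes a permutation of centres a permutation of parameterized spheres, and
  \<open>norm K < 1/2\<close> keeps spheres with centres at distance at least 1 disjoint.\<close>

lemma unlinked_standard_position:
  fixes \<phi> :: "nat \<Rightarrow> 'a::euclidean_space \<Rightarrow> 'b"
  assumes u: "unlinked n M \<phi>" and n: "n > 0"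
    and charts: "\<And>F. finite F \<Longrightarrow> F \<subseteq> M \<Longrightarrow> \<exists>Q C Ci V. chart M Q C Ci V \<and> dim (range Q) = DIM('a) + 1 \<and>
        F \<subseteq> V \<and> (\<forall>y\<in>M \<inter> V. Ci y \<in> range Q \<and> C (Ci y) = y)"
    and D: "DIM('a) \<ge> 2"
  obtains Q C Ci V and K :: "'a \<Rightarrow>\<^sub>L 'b" and e1 e2 e3 where "chart M Q C Ci V"
    "range (blinfun_apply K) \<subseteq> range Q" "inj (blinfun_apply K)" "norm K < 1/2"
    "\<forall>i<n. \<forall>x\<in>sphere 0 1. \<phi> i x = C (real i *\<^sub>R e1 + blinfun_apply K x)"
    "e1 \<in> range Q" "e2 \<in> range Q" "e3 \<in> range Q" "norm e1 = 1" "norm e2 = 1" "norm e3 = 1"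
    "e1 \<bullet> e2 = 0" "e1 \<bullet> e3 = 0" "e2 \<bullet> e3 = 0"
proof -
  let ?S = "sphere 0 1 :: 'a set" and ?B = "cball 0 1 :: 'a set"
  obtain \<psi> where \<psi>: "\<psi> \<in> Emb n ?B M" and \<psi>\<phi>: "\<forall>i<n. \<forall>x\<in>?S. \<psi> i x = \<phi> i x" and \<phi>E: "\<phi> \<in> Emb n ?S M"
    using u unfolding unlinked_def by blast
  have emb: "C1_embedding ?B M (\<psi> i)" if "i < n" for i using \<psi> that by (simp add: Emb_def)
  have \<psi>M: "\<psi> i x \<in> M" if "i < n" "x \<in> ?B" for i x
    using emb[OF that(1)] that(2) by (auto simp: C1_embedding_def C1_maps_def)
  have \<psi>d: "\<psi> i x \<noteq> \<psi> j y" if "i < n" "j < n" "i \<noteq> j" "x \<in> ?B" "y \<in> ?B" for i j x y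
    using \<psi> that unfolding Emb_def disjoint_family_on_def by blast
  have \<phi>M: "\<phi> i x \<in> M" if "i < n" "x \<in> ?S" for i x
    using \<psi>\<phi> \<psi>M[OF that(1), of x] that by auto
  have "\<forall>i. \<exists>q. i < n \<longrightarrow> open (fst q) \<and> ?B \<subseteq> fst q \<and> C1o (fst q) (snd q) \<and> (\<forall>x\<in>?B. snd q x = \<psi> i x)"
    using emb unfolding C1_embedding_def C1_maps_def C1_on_iff by fastforce
  from choice[OF this] obtain q where q: "\<forall>i. i < n \<longrightarrow> open (fst (q i)) \<and> ?B \<subseteq> fst (q i) \<and>
      C1o (fst (q i)) (snd (q i)) \<and> (\<forall>x\<in>?B. snd (q i) x = \<psi> i x)" by (rule exE)
  have "\<forall>i. \<exists>p. i < n \<longrightarrow> open (fst p) \<and> C1o (fst p) (snd p) \<and> (\<forall>x\<in>?B. \<psi> i x \<in> fst p \<and> snd p (\<psi> i x) = x)"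
  proof
    fix i
    show "\<exists>p. i < n \<longrightarrow> open (fst p) \<and> C1o (fst p) (snd p) \<and> (\<forall>x\<in>?B. \<psi> i x \<in> fst p \<and> snd p (\<psi> i x) = x)"
    proof (cases "i < n")
      case True
      obtain U \<kappa> where "open U" "\<psi> i ` ?B \<subseteq> U" "C1o U \<kappa>" "\<forall>x\<in>?B. \<kappa> (\<psi> i x) = x"
        by (rule C1_embedding_left_inverse[OF emb[OF True]])
      then show ?thesis by (intro exI[of _ "(U, \<kappa>)"]) auto
    qed simp
  qed
  from choice[OF this] obtain p where p: "\<forall>i. i < n \<longrightarrow> open (fst (p i)) \<and> C1o (fst (p i)) (snd (p i)) \<and>
      (\<forall>x\<in>?B. \<psi> i x \<in> fst (p i) \<and> snd (p i) (\<psi> i x) = x)" by (rule exE)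
  have "finite ((\<lambda>i. \<psi> i 0) ` {..<n})" "(\<lambda>i. \<psi> i 0) ` {..<n} \<subseteq> M" using \<psi>M by auto
  from charts[OF this] obtain Q C Ci V where ch: "chart M Q C Ci V" and dQ: "dim (range Q) = DIM('a) + 1"
    and FV: "(\<lambda>i. \<psi> i 0) ` {..<n} \<subseteq> V" and full: "\<forall>y\<in>M \<inter> V. Ci y \<in> range Q \<and> C (Ci y) = y"
    by (elim exE conjE)
  have linQ: "linear Q" using ch by (simp add: chart_def)
  have sub: "subspace (range Q)" using linQ by (simp add: subspace_UNIV linear_subspace_image)
  obtain a and L :: "nat \<Rightarrow> 'a \<Rightarrow>\<^sub>L 'b" where aL: "\<forall>i<n. a i \<in> range Q \<and> range (blinfun_apply (L i)) \<subseteq> range Q \<and> inj (blinfun_apply (L i))"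
    and adist: "\<forall>i<n. \<forall>j<n. i \<noteq> j \<longrightarrow> a i \<noteq> a j" and sh: "shrinks_to n M C \<phi> a L"
  proof (rule chart_full_isotopy[OF ch, of n "\<lambda>i. fst (q i)" "\<lambda>i. snd (q i)" "\<lambda>i. fst (p i)" "\<lambda>i. snd (p i)" \<phi>])
    show "\<And>y. y \<in> M \<inter> V \<Longrightarrow> Ci y \<in> range Q \<and> C (Ci y) = y" using full by blast
    show "open (fst (q i)) \<and> ?B \<subseteq> fst (q i) \<and> C1o (fst (q i)) (snd (q i))" if "i < n" for i
      using q that by blast
    have qi: "snd (q i) x = \<psi> i x" if "i < n" "x \<in> ?B" for i x using q that by blast
    show "open (fst (p i)) \<and> C1o (fst (p i)) (snd (p i))" if "i < n" for i using p that by blast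
    show "snd (q i) x \<in> M \<and> snd (q i) x \<in> fst (p i) \<and> snd (p i) (snd (q i) x) = x" if "i < n" "x \<in> ?B" for i x
      unfolding qi[OF that] using p \<psi>M[OF that] that by blast
    show "snd (q i) x \<noteq> snd (q j) y" if "i < n" "j < n" "i \<noteq> j" "x \<in> ?B" "y \<in> ?B" for i j x y
      unfolding qi[OF that(1,4)] qi[OF that(2,5)] by (rule \<psi>d[OF that])
    show "snd (q i) x = \<phi> i x" if "i < n" "x \<in> ?S" for i x
    proof -
      have "x \<in> ?B" using that by auto
      from qi[OF that(1) this] show ?thesis using \<psi>\<phi> that by simp
    qed
    show "snd (q i) 0 \<in> V" if "i < n" for i
      using qi[OF that, of 0] FV that by auto
  qed (rule that)
  have dW: "dim (range Q) > DIM('a)" "dim (range Q) \<ge> 3" using dQ D by auto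
  obtain K0 :: "'a \<Rightarrow>\<^sub>L 'b" where K0: "range (blinfun_apply K0) \<subseteq> range Q" "inj (blinfun_apply K0)" "shrinks_to n M C \<phi> a (\<lambda>_. K0)"
  proof (rule shrinks_to_align[OF n ch dW(1), of a L \<phi>])
    show "a i \<in> range Q" if "i < n" for i using aL that by blast
    show "a i \<noteq> a j" if "i < n" "j < n" "i \<noteq> j" for i j using adist that by blast
    show "blinfun_apply (L i) x \<in> range Q" if "i < n" for i x using aL that by blast
    show "inj (blinfun_apply (L i))" if "i < n" for i using aL that by blast
    show "\<phi> i x \<in> M" if "i < n" "x \<in> ?S" for i x by (rule \<phi>M[OF that])
  qed (rule sh, rule that)
  obtain B where B: "B \<subseteq> range Q" "pairwise orthogonal B" "\<And>x. x \<in> B \<Longrightarrow> norm x = 1" "card B = dim (range Q)"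
    using orthonormal_basis_subspace[OF sub] by metis
  have "3 \<le> card B" using B(4) dW by simp
  then obtain E where "E \<subseteq> B" "card E = 3" by (rule obtain_subset_with_card_n)
  then obtain e1 e2 e3 where e: "e1 \<in> B" "e2 \<in> B" "e3 \<in> B" "e1 \<noteq> e2" "e1 \<noteq> e3" "e2 \<noteq> e3"
    by (auto simp: card_3_iff)
  have eo: "e1 \<bullet> e2 = 0" "e1 \<bullet> e3 = 0" "e2 \<bullet> e3 = 0" using B(2) e by (auto simp: pairwise_def orthogonal_def)
  have eQ: "e1 \<in> range Q" "e2 \<in> range Q" "e3 \<in> range Q" and en: "norm e1 = 1" "norm e2 = 1" "norm e3 = 1"
    using B e by auto
  have "e1 \<noteq> 0" using en by auto
  have "shrinks_to n M C \<phi> (\<lambda>i. real i *\<^sub>R e1) (\<lambda>_. K0)"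
  proof (rule shrinks_to_line[OF ch dW(2), of n a])
    show "a i \<in> range Q" if "i < n" for i using aL that by blast
    show "a i \<noteq> a j" if "i < n" "j < n" "i \<noteq> j" for i j using adist that by blast
    show "real i *\<^sub>R e1 \<in> range Q" for i by (rule subspace_scale[OF sub eQ(1)])
    show "real i *\<^sub>R e1 \<noteq> real j *\<^sub>R e1" if "i \<noteq> j" for i j using that \<open>e1 \<noteq> 0\<close> by simp
    show "\<phi> i x \<in> M" if "i < n" "x \<in> ?S" for i x by (rule \<phi>M[OF that])
  qed (fact K0)+
  then obtain \<delta>0 where \<delta>0: "\<delta>0 > 0" "\<forall>\<delta>. 0 < \<delta> \<and> \<delta> \<le> \<delta>0 \<longrightarrow> isotopic n M \<phi> (cfg C (\<lambda>i. real i *\<^sub>R e1) (\<lambda>i. \<delta> *\<^sub>R K0))"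
    unfolding shrinks_to_def by blast
  define \<delta> where "\<delta> = min \<delta>0 (1 / (2 * (norm K0 + 1)))"
  have pos: "norm K0 + 1 > 0" by (simp add: add_nonneg_pos)
  have \<delta>: "\<delta> > 0" "\<delta> \<le> \<delta>0" using \<delta>0(1) pos by (auto simp: \<delta>_def)
  define K where "K = \<delta> *\<^sub>R K0"
  have nK: "norm K < 1/2"
  proof -
    have "norm K = \<delta> * norm K0" using \<delta> by (simp add: K_def)
    also have "\<dots> < \<delta> * (norm K0 + 1)" using \<delta> by simp
    also have "\<dots> \<le> 1 / (2 * (norm K0 + 1)) * (norm K0 + 1)" using pos by (intro mult_right_mono) (auto simp: \<delta>_def)
    also have "\<dots> = 1/2" using pos by simp
    finally show ?thesis .
  qed
  have KQ: "range (blinfun_apply K) \<subseteq> range Q"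
  proof
    fix w assume "w \<in> range (blinfun_apply K)"
    then obtain x where "w = \<delta> *\<^sub>R blinfun_apply K0 x" by (auto simp: K_def scaleR_blinfun.rep_eq)
    then show "w \<in> range Q" using subspace_scale[OF sub subsetD[OF K0(1) rangeI]] by simp
  qed
  have Kinj: "inj (blinfun_apply K)"
    using K0(2) \<delta>(1) by (simp add: K_def inj_on_def scaleR_blinfun.rep_eq)
  obtain g where g: "g \<in> Diff_c M" "\<forall>i<n. \<forall>x\<in>?S. g (\<phi> i x) = cfg C (\<lambda>i. real i *\<^sub>R e1) (\<lambda>i. K) i x"
    using \<delta>0(2) \<delta> unfolding isotopic_def K_def by blast
  obtain C' Ci' V' where C': "chart M Q C' Ci' V'" "\<forall>w. C' w \<in> M \<and> g (C' w) = C w"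
    by (rule chart_diffeo[OF ch g(1)])
  have inj: "inj_on g M" using g(1) by (simp add: Diff_c_def Bij_def bij_betw_def)
  have eq: "\<forall>i<n. \<forall>x\<in>?S. \<phi> i x = C' (real i *\<^sub>R e1 + blinfun_apply K x)"
  proof (intro allI impI ballI)
    fix i x assume i: "i < n" and x: "x \<in> ?S"
    show "\<phi> i x = C' (real i *\<^sub>R e1 + blinfun_apply K x)"
    proof (rule inj_onD[OF inj _ \<phi>M[OF i x]])
      have "g (\<phi> i x) = C (real i *\<^sub>R e1 + blinfun_apply K x)"
        using g(2) i x by (simp add: cfg_def nrm_sphere)
      then show "g (\<phi> i x) = g (C' (real i *\<^sub>R e1 + blinfun_apply K x))" using C'(2) by simp
      show "C' (real i *\<^sub>R e1 + blinfun_apply K x) \<in> M" using C'(2) by blast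
    qed
  qed
  show thesis by (rule that[OF C'(1) KQ Kinj nK eq eQ en eo])
qed

end


section \<open>Monodromy of configurations\<close>

text \<open>Sheets are cut out by balls around the points of E z with radius half their least
  distance: for z' close to z, each ball contains exactly one point of E z', and every point of E z'
  lies in one of the balls.\<close>

lemma covering_space_finite_sets:
  fixes E :: "'z::real_normed_vector \<Rightarrow> 'b::euclidean_space set" and n :: nat
  assumes n: "n > 0"
    and loc: "\<And>z. z \<in> Z \<Longrightarrow> \<exists>p. inj_on p {..<n} \<and> E z = p ` {..<n} \<and>
      (\<forall>\<epsilon>>0. \<exists>U. open U \<and> z \<in> U \<and> (\<forall>z'\<in>U \<inter> Z. \<exists>p'. E z' = p' ` {..<n} \<and> (\<forall>i<n. dist (p i) (p' i) < \<epsilon>)))"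
  shows "covering_space {(z, v). z \<in> Z \<and> v \<in> E z} fst Z"
proof (rule covering_spaceI)
  let ?C = "{(z, v). z \<in> Z \<and> v \<in> E z}"
  show "continuous_on ?C fst" by (intro continuous_intros)
  show "fst ` ?C = Z"
  proof
    show "Z \<subseteq> fst ` ?C"
    proof
      fix z assume z: "z \<in> Z"
      obtain p where "E z = p ` {..<n}" using loc[OF z] by blast
      then have "(z, p 0) \<in> ?C" using z n by auto
      then show "z \<in> fst ` ?C" by force
    qed
  qed auto
  fix z assume z: "z \<in> Z"
  obtain p where p: "inj_on p {..<n}" "E z = p ` {..<n}"
    and pn: "\<forall>\<epsilon>>0. \<exists>U. open U \<and> z \<in> U \<and> (\<forall>z'\<in>U \<inter> Z. \<exists>p'. E z' = p' ` {..<n} \<and> (\<forall>i<n. dist (p i) (p' i) < \<epsilon>))"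
    using loc[OF z] by blast
  have "\<exists>m>0. \<forall>q\<in>{(i, j). i < n \<and> j < n \<and> i \<noteq> j}. \<forall>t\<in>{0::real}. m \<le> dist (p (fst q)) (p (snd q))"
  proof (rule compact_uniform_lower_bound)
    have "{(i, j). i < n \<and> j < n \<and> i \<noteq> j} \<subseteq> {..<n} \<times> {..<n}" by auto
    then show "finite {(i, j). i < n \<and> j < n \<and> i \<noteq> j}" by (rule finite_subset) simp
    show "dist (p (fst q)) (p (snd q)) > 0" if "q \<in> {(i, j). i < n \<and> j < n \<and> i \<noteq> j}" for q
      using that p(1) by (auto simp: inj_on_def)
  qed (auto intro: continuous_on_const)
  then obtain m where m: "m > 0" and "\<forall>q\<in>{(i, j). i < n \<and> j < n \<and> i \<noteq> j}. m \<le> dist (p (fst q)) (p (snd q))" by auto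
  then have mp: "m \<le> dist (p i) (p j)" if "i < n" "j < n" "i \<noteq> j" for i j
    using that by auto
  define B where "B i = ball (p i) (m / 2)" for i
  have disj: "B i \<inter> B j = {}" if "i < n" "j < n" "i \<noteq> j" for i j
  proof -
    have False if "x \<in> B i" "x \<in> B j" for x
      using mp[OF \<open>i < n\<close> \<open>j < n\<close> \<open>i \<noteq> j\<close>] that dist_triangle2[of "p i" "p j" x] by (auto simp: B_def)
    then show ?thesis by blast
  qed
  obtain U where U: "open U" "z \<in> U" and Up: "\<forall>z'\<in>U \<inter> Z. \<exists>p'. E z' = p' ` {..<n} \<and> (\<forall>i<n. dist (p i) (p' i) < m / 2)"
    using pn m by (meson half_gt_zero)
  define T where "T = Z \<inter> U"
  have ex1: "\<exists>w\<in>E z'. w \<in> B i" if z': "z' \<in> T" and i: "i < n" for z' i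
  proof -
    obtain p' where p': "E z' = p' ` {..<n}" "\<forall>i<n. dist (p i) (p' i) < m / 2"
      using Up z' unfolding T_def by blast
    then show ?thesis using i by (intro bexI[of _ "p' i"]) (auto simp: B_def)
  qed
  have uniq: "w = w'" if z': "z' \<in> T" and i: "i < n" and w: "w \<in> E z'" "w \<in> B i" "w' \<in> E z'" "w' \<in> B i" for z' i w w'
  proof -
    obtain p' where p': "E z' = p' ` {..<n}" "\<forall>i<n. dist (p i) (p' i) < m / 2"
      using Up z' unfolding T_def by blast
    have "v = p' i" if v: "v \<in> E z'" "v \<in> B i" for v
    proof -
      obtain k where k: "k < n" "v = p' k" using v(1) p'(1) by auto
      then have "v \<in> B k" using p'(2) by (simp add: B_def)
      then have "k = i" using disj[OF k(1) i] v(2) by auto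
      then show ?thesis using k by simp
    qed
    then show ?thesis using w by metis
  qed
  have cover: "\<exists>i<n. w \<in> B i" if z': "z' \<in> T" and w: "w \<in> E z'" for z' w
  proof -
    obtain p' where p': "E z' = p' ` {..<n}" "\<forall>i<n. dist (p i) (p' i) < m / 2"
      using Up z' unfolding T_def by blast
    then show ?thesis using w by (auto simp: B_def)
  qed
  define sh where "sh i = ?C \<inter> (U \<times> B i)" for i
  show "\<exists>T. z \<in> T \<and> openin (top_of_set Z) T \<and> (\<exists>v. \<Union> v = ?C \<inter> fst -` T \<and> (\<forall>u\<in>v. openin (top_of_set ?C) u) \<and>
      pairwise disjnt v \<and> (\<forall>u\<in>v. \<exists>q. homeomorphism u T fst q))"
  proof (intro exI[of _ T] exI[of _ "sh ` {..<n}"] conjI ballI)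
    show "z \<in> T" using z U by (simp add: T_def)
    show "openin (top_of_set Z) T" unfolding T_def using U by (simp add: openin_open_Int)
    show "\<Union> (sh ` {..<n}) = ?C \<inter> fst -` T"
    proof
      show "\<Union> (sh ` {..<n}) \<subseteq> ?C \<inter> fst -` T" by (auto simp: sh_def T_def)
      show "?C \<inter> fst -` T \<subseteq> \<Union> (sh ` {..<n})" using cover by (fastforce simp: sh_def T_def)
    qed
    show "openin (top_of_set ?C) u" if "u \<in> sh ` {..<n}" for u
      using that U by (auto simp: sh_def B_def intro!: openin_open_Int open_Times)
    show "pairwise disjnt (sh ` {..<n})"
      using disj by (fastforce simp: pairwise_def disjnt_def sh_def)
    fix u assume "u \<in> sh ` {..<n}"
    then obtain i where i: "i < n" "u = sh i" by auto
    define s where "s z' = (SOME w. w \<in> E z' \<and> w \<in> B i)" for z'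
    have s: "s z' \<in> E z'" "s z' \<in> B i" if "z' \<in> T" for z'
      using someI_ex[of "\<lambda>w. w \<in> E z' \<and> w \<in> B i"] ex1[OF that i(1)] unfolding s_def by blast+
    have su: "w = s z'" if "z' \<in> T" "w \<in> E z'" "w \<in> B i" for z' w
      using uniq[OF that(1) i(1) that(2,3) s[OF that(1)]] .
    \<comment> \<open>At z1 the points may be listed in another order than at z. The radius e' keeps
      the point close to s z1 inside B i, where s z' is the only candidate.\<close>
    have cs: "continuous_on T s"
      unfolding continuous_on_iff
    proof (intro ballI allI impI)
      fix z1 and e :: real assume z1: "z1 \<in> T" and e: "e > 0"
      then have z1Z: "z1 \<in> Z" "z1 \<in> U" by (auto simp: T_def)
      obtain p1 where p1: "E z1 = p1 ` {..<n}"
        and pn1: "\<forall>\<epsilon>>0. \<exists>U. open U \<and> z1 \<in> U \<and> (\<forall>z'\<in>U \<inter> Z. \<exists>p'. E z' = p' ` {..<n} \<and> (\<forall>i<n. dist (p1 i) (p' i) < \<epsilon>))"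
        using loc[OF z1Z(1)] by blast
      obtain k where k: "k < n" "s z1 = p1 k" using s(1)[OF z1] p1 by auto
      have "open (B i)" by (simp add: B_def)
      then obtain e' where e': "e' > 0" "ball (s z1) e' \<subseteq> B i" using s(2)[OF z1] by (meson openE)
      have "min e e' > 0" using e e' by simp
      then obtain U1 where U1: "open U1" "z1 \<in> U1"
        "\<forall>z'\<in>U1 \<inter> Z. \<exists>p'. E z' = p' ` {..<n} \<and> (\<forall>i<n. dist (p1 i) (p' i) < min e e')" using pn1 by blast
      obtain d where d: "d > 0" "ball z1 d \<subseteq> U1" using U1 by (meson openE)
      have "dist (s z') (s z1) < e" if z': "z' \<in> T" "dist z' z1 < d" for z'
      proof -
        have "z' \<in> U1 \<inter> Z" using z' d by (auto simp: T_def dist_commute)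
        then obtain p' where p': "E z' = p' ` {..<n}" "\<forall>i<n. dist (p1 i) (p' i) < min e e'" using U1(3) by blast
        have dk: "dist (s z1) (p' k) < min e e'" using p'(2) k by simp
        then have "p' k \<in> B i" using e' by auto
        then have "p' k = s z'" using su[OF z'(1)] p'(1) k by auto
        then show ?thesis using dk by (simp add: dist_commute)
      qed
      then show "\<exists>d>0. \<forall>x'\<in>T. dist x' z1 < d \<longrightarrow> dist (s x') (s z1) < e" using d(1) by blast
    qed
    have "homeomorphism u T fst (\<lambda>z'. (z', s z'))"
      unfolding homeomorphism_def
    proof (intro conjI ballI)
      show "continuous_on u fst" by (intro continuous_intros)
      show "continuous_on T (\<lambda>z'. (z', s z'))" by (intro continuous_intros cs)
      show "(fst q, s (fst q)) = q" if "q \<in> u" for q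
        using that su by (auto simp: i sh_def T_def)
      show "fst ` u = T"
      proof
        show "T \<subseteq> fst ` u"
        proof
          fix z' assume z': "z' \<in> T"
          then have "(z', s z') \<in> u" using s[OF z'] by (auto simp: i sh_def T_def)
          then show "z' \<in> fst ` u" by force
        qed
      qed (auto simp: i sh_def T_def)
      show "(\<lambda>z'. (z', s z')) ` T = u"
      proof
        show "(\<lambda>z'. (z', s z')) ` T \<subseteq> u" using s by (auto simp: i sh_def T_def)
        show "u \<subseteq> (\<lambda>z'. (z', s z')) ` T" using su by (auto simp: i sh_def T_def image_iff)
      qed
    qed simp
    then show "\<exists>q. homeomorphism u T fst q" by blast
  qed
qed

text \<open>The boundary gives two paths between opposite corners: A on the left side and then
  constant on the top, or constant on the bottom and then A' on the right side. They are homotopic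
  in the convex square, so their lifts in the covering end at the same point.\<close>

lemma monodromy_square:
  fixes E :: "real \<times> real \<Rightarrow> 'b::euclidean_space set" and n :: nat
  assumes n: "n > 0"
    and loc: "\<And>z. z \<in> {0..1} \<times> {0..1} \<Longrightarrow> \<exists>p. inj_on p {..<n} \<and> E z = p ` {..<n} \<and>
      (\<forall>\<epsilon>>0. \<exists>U. open U \<and> z \<in> U \<and> (\<forall>z'\<in>U \<inter> {0..1} \<times> {0..1}. \<exists>p'. E z' = p' ` {..<n} \<and> (\<forall>i<n. dist (p i) (p' i) < \<epsilon>)))"
    and A: "continuous_on {0..1} A" "\<And>t. t \<in> {0..1} \<Longrightarrow> A t \<in> E (0, t)"
    and A': "continuous_on {0..1} A'" "\<And>t. t \<in> {0..1} \<Longrightarrow> A' t \<in> E (1, t)"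
    and A0: "A' 0 = A 0" "\<And>s. s \<in> {0..1} \<Longrightarrow> A 0 \<in> E (s, 0)" and A1: "\<And>s. s \<in> {0..1} \<Longrightarrow> A 1 \<in> E (s, 1)"
  shows "A' 1 = A 1"
proof -
  let ?Z = "{0..1} \<times> {0..1} :: (real \<times> real) set"
  let ?C = "{(z, v). z \<in> ?Z \<and> v \<in> E z}"
  have cov: "covering_space ?C fst ?Z" by (rule covering_space_finite_sets[OF n loc])
  let ?h1 = "(\<lambda>t. ((0, t), A t)) +++ (\<lambda>s. ((s, 1), A 1))"
  let ?h2 = "(\<lambda>s. ((s, 0), A 0)) +++ (\<lambda>t. ((1, t), A' t))"
  have ph: "path (\<lambda>t. ((0::real, t), A t))" "path (\<lambda>s. ((s, 1::real), A 1))" "path (\<lambda>s. ((s, 0::real), A 0))" "path (\<lambda>t. ((1::real, t), A' t))"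
    unfolding path_def by (intro continuous_intros A A')+
  have p: "path ?h1" "path ?h2"
    using ph by (intro path_join_imp; simp add: pathstart_def pathfinish_def A0)+
  have im: "path_image ?h1 \<subseteq> ?C" "path_image ?h2 \<subseteq> ?C"
    by (intro subset_path_image_join; use A A' A0 A1 in \<open>auto simp: path_image_def\<close>)+
  have pf: "path (fst \<circ> ?h1)" "path (fst \<circ> ?h2)"
    using p by (auto intro!: path_continuous_image continuous_intros)
  have imf: "path_image (fst \<circ> ?h1) \<subseteq> ?Z" "path_image (fst \<circ> ?h2) \<subseteq> ?Z"
    using im unfolding path_image_compose by auto
  have ends: "pathstart (fst \<circ> ?h2) = pathstart (fst \<circ> ?h1)" "pathfinish (fst \<circ> ?h2) = pathfinish (fst \<circ> ?h1)"
    by (simp_all add: pathstart_compose pathfinish_compose) (simp_all add: pathstart_def pathfinish_def)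
  have cx: "convex ?Z" by (intro convex_Times convex_real_interval)
  have hom: "homotopic_paths ?Z (fst \<circ> ?h1) (fst \<circ> ?h2)"
  proof (rule homotopic_paths_linear[OF pf ends])
    show "closed_segment ((fst \<circ> ?h1) t) ((fst \<circ> ?h2) t) \<subseteq> ?Z" if "t \<in> {0..1}" for t
      by (rule closed_segment_subset[OF _ _ cx]) (use imf that in \<open>auto simp: path_image_def\<close>)
  qed
  have "pathfinish ?h1 = pathfinish ?h2"
    by (rule covering_space_monodromy[OF cov pf(1) imf(1) pf(2) imf(2) hom p(1) im(1) _ p(2) im(2)])
      (auto simp: pathstart_def joinpaths_def)
  then show ?thesis by (simp add: pathfinish_def joinpaths_def)
qed

lemma conf_class_eqD:
  assumes "conf_class n \<psi>' = conf_class n \<psi>"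
  obtains \<pi> where "\<pi> permutes {..<n}" "\<psi>' = \<psi> \<circ> \<pi>"
proof -
  have "\<psi>' \<circ> id \<in> conf_class n \<psi>'" unfolding conf_class_def using permutes_id by blast
  then have "\<psi>' \<in> conf_class n \<psi>" using assms by simp
  then show thesis using that by (auto simp: conf_class_def)
qed

lemma conf_class_comp:
  assumes "\<pi> permutes {..<n}"
  shows "conf_class n (\<psi> \<circ> \<pi>) = conf_class n \<psi>"
proof -
  have *: "\<exists>\<pi>'. \<pi>' permutes {..<n} \<and> \<psi> \<circ> \<sigma> = \<psi> \<circ> \<pi> \<circ> \<pi>'" if "\<sigma> permutes {..<n}" for \<sigma>
  proof (intro exI conjI)
    show "inv_into UNIV \<pi> \<circ> \<sigma> permutes {..<n}" by (intro permutes_compose that permutes_inv assms)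
    show "\<psi> \<circ> \<sigma> = \<psi> \<circ> \<pi> \<circ> (inv_into UNIV \<pi> \<circ> \<sigma>)"
      using permutes_inverses(1)[OF assms] by (simp add: fun_eq_iff)
  qed
  have "\<exists>\<pi>'. \<pi>' permutes {..<n} \<and> \<psi> \<circ> \<pi> \<circ> \<sigma> = \<psi> \<circ> \<pi>'" if "\<sigma> permutes {..<n}" for \<sigma>
    using permutes_compose[OF that assms] by (intro exI[of _ "\<pi> \<circ> \<sigma>"]) (simp add: comp_assoc)
  with * show ?thesis unfolding conf_class_def by blast
qed

text \<open>Reduces spheres to points: one marked point on each sphere is tracked, and the order of
  the spheres is forgotten.\<close>

definition fibre :: "nat \<Rightarrow> 'c \<Rightarrow> (nat \<Rightarrow> 'c \<Rightarrow> 'b) set \<Rightarrow> 'b set" where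
  "fibre n x0 c = {\<psi> i x0 | \<psi> i. \<psi> \<in> c \<and> i < n}"

lemma fibre_conf_class: "fibre n x0 (conf_class n \<psi>) = (\<lambda>i. \<psi> i x0) ` {..<n}"
proof
  show "fibre n x0 (conf_class n \<psi>) \<subseteq> (\<lambda>i. \<psi> i x0) ` {..<n}"
    using permutes_in_image by (fastforce simp: fibre_def conf_class_def)
  have "\<psi> \<in> conf_class n \<psi>" unfolding conf_class_def using permutes_id[of "{..<n}"] by (metis (mono_tags, lifting) comp_id mem_Collect_eq)
  then show "(\<lambda>i. \<psi> i x0) ` {..<n} \<subseteq> fibre n x0 (conf_class n \<psi>)"
    by (auto simp: fibre_def)
qed

lemma continuous_map_Emb_eval:
  fixes x0 :: "'a::euclidean_space" and M :: "'b::euclidean_space set"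
  assumes "x0 \<in> S" "i < n"
  shows "continuous_map (Emb_top n S M) euclidean (\<lambda>\<psi>. \<psi> i x0)"
proof -
  have "continuous_map (product_topology (\<lambda>_. C1_topology S M) {..<n}) (C1_topology S M) (\<lambda>\<psi>. \<psi> i)"
    by (rule continuous_map_product_projection) (use assms in simp)
  from continuous_map_compose[OF this continuous_map_C1_eval[OF assms(1)]]
  show ?thesis unfolding Emb_top_def by (simp add: o_def continuous_map_from_subtopology)
qed

lemma conf_fibre_local:
  fixes \<phi> :: "nat \<Rightarrow> 'a::euclidean_space \<Rightarrow> 'b::euclidean_space" and H :: "'z::topological_space \<Rightarrow> _"
  assumes H: "continuous_map (top_of_set Z) (Conf_top n M \<phi>) H" and z: "z \<in> Z" and x0: "x0 \<in> sphere 0 1"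
  shows "\<exists>p. inj_on p {..<n} \<and> fibre n x0 (H z) = p ` {..<n} \<and>
      (\<forall>\<epsilon>>0. \<exists>U. open U \<and> z \<in> U \<and> (\<forall>z'\<in>U \<inter> Z. \<exists>p'. fibre n x0 (H z') = p' ` {..<n} \<and> (\<forall>i<n. dist (p i) (p' i) < \<epsilon>)))"
proof -
  define Y where "Y = subtopology (Emb_top n (sphere 0 1) M) (path_component_of_set (Emb_top n (sphere 0 1) M) \<phi>)"
  have q: "quotient_map Y (Conf_top n M \<phi>) (conf_class n)"
    unfolding Conf_top_def Y_def by (rule quotient_map_quotient_topology)
  have top: "topspace (Conf_top n M \<phi>) = conf_class n ` topspace Y"
    using q by (simp add: quotient_map_def)
  have YE: "topspace Y \<subseteq> Emb n (sphere 0 1) M" by (auto simp: Y_def Emb_top_def)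
  have Hz: "H z' \<in> conf_class n ` topspace Y" if "z' \<in> Z" for z'
    using H that top by (auto simp: continuous_map_def)
  then obtain \<psi> where \<psi>: "\<psi> \<in> topspace Y" "H z = conf_class n \<psi>" using z by blast
  define p where "p i = \<psi> i x0" for i
  have "inj_on p {..<n}"
  proof (rule inj_onI)
    fix i j assume ij: "i \<in> {..<n}" "j \<in> {..<n}" "p i = p j"
    show "i = j"
    proof (rule ccontr)
      assume "i \<noteq> j"
      have "\<psi> \<in> Emb n (sphere 0 1) M" using \<psi>(1) YE by blast
      then have "disjoint_family_on (\<lambda>i. \<psi> i ` sphere 0 1) {..<n}" by (simp add: Emb_def)
      then have "\<psi> i ` sphere 0 1 \<inter> \<psi> j ` sphere 0 1 = {}"
        using ij(1,2) \<open>i \<noteq> j\<close> unfolding disjoint_family_on_def by blast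
      moreover have "\<psi> i x0 \<in> \<psi> i ` sphere 0 1" "\<psi> j x0 \<in> \<psi> j ` sphere 0 1" using x0 by blast+
      ultimately show False using ij(3) unfolding p_def by (metis IntI empty_iff)
    qed
  qed
  moreover have "fibre n x0 (H z) = p ` {..<n}" by (simp add: \<psi> fibre_conf_class p_def)
  moreover have "\<exists>U. open U \<and> z \<in> U \<and> (\<forall>z'\<in>U \<inter> Z. \<exists>p'. fibre n x0 (H z') = p' ` {..<n} \<and> (\<forall>i<n. dist (p i) (p' i) < \<epsilon>))"
    if \<epsilon>: "\<epsilon> > 0" for \<epsilon>
  proof -
    \<comment> \<open>The quotient topology decides whether this set of classes is open: its
      preimage is the union, over all relabellings, of conditions on the values at x0.\<close>
    define O0 where "O0 = {c \<in> topspace (Conf_top n M \<phi>). \<exists>\<psi>'\<in>c. \<forall>i<n. dist (p i) (\<psi>' i x0) < \<epsilon>}"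
    have evY: "continuous_map Y euclidean (\<lambda>\<psi>'. \<psi>' i x0)" if "i < n" for i
      unfolding Y_def by (rule continuous_map_from_subtopology[OF continuous_map_Emb_eval[OF x0 that]])
    have op1: "openin Y {\<psi>' \<in> topspace Y. \<forall>i<n. dist (p i) (\<psi>' (\<pi> i) x0) < \<epsilon>}" if \<pi>: "\<pi> permutes {..<n}" for \<pi>
    proof -
      have "openin Y (topspace Y \<inter> (\<Inter>i\<in>{..<n}. {\<psi>' \<in> topspace Y. \<psi>' (\<pi> i) x0 \<in> ball (p i) \<epsilon>}))"
      proof (rule openin_Int_Inter[where \<F> = "(\<lambda>i. {\<psi>' \<in> topspace Y. \<psi>' (\<pi> i) x0 \<in> ball (p i) \<epsilon>}) ` {..<n}"])
        fix S assume "S \<in> (\<lambda>i. {\<psi>' \<in> topspace Y. \<psi>' (\<pi> i) x0 \<in> ball (p i) \<epsilon>}) ` {..<n}"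
        then obtain i where i: "i < n" "S = {\<psi>' \<in> topspace Y. \<psi>' (\<pi> i) x0 \<in> ball (p i) \<epsilon>}" by auto
        have "\<pi> i < n" using permutes_in_image[OF \<pi>, of i] i by simp
        then show "openin Y S" unfolding i(2)
          by (intro openin_continuous_map_preimage[OF evY]) auto
      qed auto
      moreover have "topspace Y \<inter> (\<Inter>i\<in>{..<n}. {\<psi>' \<in> topspace Y. \<psi>' (\<pi> i) x0 \<in> ball (p i) \<epsilon>}) =
          {\<psi>' \<in> topspace Y. \<forall>i<n. dist (p i) (\<psi>' (\<pi> i) x0) < \<epsilon>}" by auto
      ultimately show ?thesis by simp
    qed
    have "{\<psi>' \<in> topspace Y. conf_class n \<psi>' \<in> O0} = (\<Union>\<pi>\<in>{\<pi>. \<pi> permutes {..<n}}. {\<psi>' \<in> topspace Y. \<forall>i<n. dist (p i) (\<psi>' (\<pi> i) x0) < \<epsilon>})"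
      using top by (auto simp: O0_def conf_class_def)
    then have "openin Y {\<psi>' \<in> topspace Y. conf_class n \<psi>' \<in> O0}"
      using op1 by (auto intro: openin_Union)
    moreover have "O0 \<subseteq> topspace (Conf_top n M \<phi>)" by (auto simp: O0_def)
    ultimately have "openin (Conf_top n M \<phi>) O0"
      using q unfolding quotient_map_def by blast
    then have "openin (top_of_set Z) {z' \<in> topspace (top_of_set Z). H z' \<in> O0}"
      by (rule openin_continuous_map_preimage[OF H])
    then obtain U where U: "open U" "{z' \<in> Z. H z' \<in> O0} = Z \<inter> U" by (auto simp: openin_open)
    have "\<psi> \<in> H z" using \<psi>(2) permutes_id[of "{..<n}"] unfolding conf_class_def by (metis (mono_tags, lifting) comp_id mem_Collect_eq)
    moreover have "\<forall>i<n. dist (p i) (\<psi> i x0) < \<epsilon>" using \<epsilon> by (simp add: p_def)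
    moreover have "H z \<in> topspace (Conf_top n M \<phi>)" using Hz[OF z] top by simp
    ultimately have "H z \<in> O0" unfolding O0_def by blast
    then have "z \<in> U" using U z by blast
    moreover have "\<exists>p'. fibre n x0 (H z') = p' ` {..<n} \<and> (\<forall>i<n. dist (p i) (p' i) < \<epsilon>)" if z': "z' \<in> U \<inter> Z" for z'
    proof -
      have "H z' \<in> O0" using U z' by blast
      then obtain \<psi>' where \<psi>': "\<psi>' \<in> H z'" "\<forall>i<n. dist (p i) (\<psi>' i x0) < \<epsilon>" by (auto simp: O0_def)
      obtain \<psi>1 where \<psi>1: "H z' = conf_class n \<psi>1" using Hz z' by blast
      then obtain \<pi> where "\<pi> permutes {..<n}" "\<psi>' = \<psi>1 \<circ> \<pi>" using \<psi>'(1) by (auto simp: conf_class_def)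
      then have "H z' = conf_class n \<psi>'" using \<psi>1 conf_class_comp by metis
      then show ?thesis using \<psi>'(2) by (intro exI[of _ "\<lambda>i. \<psi>' i x0"]) (simp add: fibre_conf_class)
    qed
    ultimately show ?thesis using U(1) by blast
  qed
  ultimately show ?thesis by blast
qed


section \<open>Motions by translations\<close>

definition ramp :: "real \<Rightarrow> real" where "ramp x = max 0 (min 1 x)"

lemma continuous_on_ramp [continuous_intros]:
  "continuous_on S f \<Longrightarrow> continuous_on S (\<lambda>x. ramp (f x))"
  unfolding ramp_def by (intro continuous_intros)

text \<open>A motion of points first spreads them out (\<open>spread\<close> rises to 1), then moves them horizontally
  (\<open>slide\<close> rises to 1), then gathers them.\<close>

definition spread :: "real \<Rightarrow> real" where "spread t = min (ramp (5 * t - 1)) (ramp (4 - 5 * t))"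
definition slide :: "real \<Rightarrow> real" where "slide t = ramp (5 * t - 2)"
text \<open>A cutoff in the time of the loop. It is 1 except near the two ends, where planar motions
  rest, and it makes the lifting along \<open>e3\<close> vanish at the base point.\<close>

definition bump :: "real \<Rightarrow> real" where "bump t = min (ramp (10 * t)) (ramp (10 - 10 * t))"

text \<open>Sliding takes place for t between 2/5 and 3/5, and throughout this interval the points
  are fully spread.\<close>

lemma slide_spread: "slide t = 0 \<or> slide t = 1 \<or> spread t = 1"
  by (auto simp: slide_def spread_def ramp_def)

lemma slide_spread_ends:
  "t \<le> 1/5 \<Longrightarrow> slide t = 0 \<and> spread t = 0" "t \<ge> 4/5 \<Longrightarrow> slide t = 1 \<and> spread t = 0"
  by (auto simp: slide_def spread_def ramp_def)

lemma bump_middle: "t \<le> 1/10 \<or> t \<ge> 9/10 \<or> bump t = 1" "bump 0 = 0" "bump 1 = 0"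
  by (auto simp: bump_def ramp_def)

lemma continuous_on_slide [continuous_intros]: "continuous_on S f \<Longrightarrow> continuous_on S (\<lambda>x. slide (f x))"
  and continuous_on_spread [continuous_intros]: "continuous_on S f \<Longrightarrow> continuous_on S (\<lambda>x. spread (f x))"
  and continuous_on_bump [continuous_intros]: "continuous_on S f \<Longrightarrow> continuous_on S (\<lambda>x. bump (f x))"
  unfolding slide_def spread_def bump_def by (intro continuous_intros; simp)+

lemma loop_class_eq:
  assumes "homotopic_with (\<lambda>p. p 0 = x \<and> p 1 = x) (top_of_set {0..1}) X \<gamma> \<delta>"
  shows "loop_class X x \<gamma> = loop_class X x \<delta>"
  unfolding loop_class_def using assms homotopic_with_trans homotopic_with_sym by blast

lemma join_loops_homotopic:
  assumes \<gamma>: "homotopic_with (\<lambda>p. p 0 = x \<and> p 1 = x) (top_of_set {0..1}) X \<gamma> \<gamma>'"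
    and \<delta>: "homotopic_with (\<lambda>p. p 0 = x \<and> p 1 = x) (top_of_set {0..1}) X \<delta> \<delta>'"
  shows "homotopic_with (\<lambda>p. p 0 = x \<and> p 1 = x) (top_of_set {0..1}) X (join_loops \<gamma> \<delta>) (join_loops \<gamma>' \<delta>')"
proof -
  let ?I = "{0..1::real}"
  obtain h where h: "continuous_map (prod_topology (top_of_set ?I) (top_of_set ?I)) X h"
    "\<forall>t. h (0, t) = \<gamma> t" "\<forall>t. h (1, t) = \<gamma>' t" "\<forall>s\<in>?I. h (s, 0) = x \<and> h (s, 1) = x"
    using \<gamma> unfolding homotopic_with_def by blast
  obtain k where k: "continuous_map (prod_topology (top_of_set ?I) (top_of_set ?I)) X k"
    "\<forall>t. k (0, t) = \<delta> t" "\<forall>t. k (1, t) = \<delta>' t" "\<forall>s\<in>?I. k (s, 0) = x \<and> k (s, 1) = x"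
    using \<delta> unfolding homotopic_with_def by blast
  let ?Z = "?I \<times> ?I"
  have pt: "prod_topology (top_of_set ?I) (top_of_set ?I) = top_of_set ?Z"
    by (rule prod_topology_subtopology_eu)
  define H where "H z = (if snd z \<le> 1/2 then h (fst z, 2 * snd z) else k (fst z, 2 * snd z - 1))" for z
  have "continuous_map (top_of_set ?Z) X H"
    unfolding H_def
  proof (rule continuous_map_cases_le)
    show "continuous_map (top_of_set ?Z) euclideanreal snd" "continuous_map (top_of_set ?Z) euclideanreal (\<lambda>z. 1/2)"
      by (auto intro: continuous_intros)
    let ?A = "{z \<in> topspace (top_of_set ?Z). snd z \<le> 1/2}" and ?B = "{z \<in> topspace (top_of_set ?Z). 1/2 \<le> snd z}"
    have "continuous_map (subtopology (top_of_set ?Z) ?A) (top_of_set ?Z) (\<lambda>z. (fst z, 2 * snd z))"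
      unfolding subtopology_subtopology continuous_map_in_subtopology by (auto intro!: continuous_intros)
    from continuous_map_compose[OF this h(1)[unfolded pt]]
    show "continuous_map (subtopology (top_of_set ?Z) ?A) X (\<lambda>z. h (fst z, 2 * snd z))" by (simp add: o_def)
    have "continuous_map (subtopology (top_of_set ?Z) ?B) (top_of_set ?Z) (\<lambda>z. (fst z, 2 * snd z - 1))"
      unfolding subtopology_subtopology continuous_map_in_subtopology by (auto intro!: continuous_intros)
    from continuous_map_compose[OF this k(1)[unfolded pt]]
    show "continuous_map (subtopology (top_of_set ?Z) ?B) X (\<lambda>z. k (fst z, 2 * snd z - 1))" by (simp add: o_def)
    show "h (fst z, 2 * snd z) = k (fst z, 2 * snd z - 1)" if "z \<in> topspace (top_of_set ?Z)" "snd z = 1/2" for z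
    proof -
      have z: "z = (fst z, 1/2)" using that(2) by (simp add: prod_eq_iff)
      have "fst z \<in> ?I" using that(1) by auto
      then have "h (fst z, 1) = k (fst z, 0)" using h(4) k(4) by simp
      moreover have e: "2 * snd z = 1" using that(2) by simp
      ultimately show ?thesis unfolding e by simp
    qed
  qed
  then show ?thesis
    unfolding homotopic_with_def pt
    by (intro exI[of _ H]) (use h k in \<open>auto simp: H_def join_loops_def fun_eq_iff\<close>)
qed

locale standard_config = C1_retract M X r for M X :: "'b::euclidean_space set" and r +
  fixes Q C Ci V and K :: "'a::euclidean_space \<Rightarrow>\<^sub>L 'b" and e1 e2 e3 :: 'b and n :: nat and \<phi> :: "nat \<Rightarrow> 'a \<Rightarrow> 'b"
  assumes ch: "chart M Q C Ci V" and KQ: "range (blinfun_apply K) \<subseteq> range Q" and Kinj: "inj (blinfun_apply K)"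
    and nK: "norm K < 1/2" and \<phi>_eq: "\<forall>i<n. \<forall>x\<in>sphere 0 1. \<phi> i x = C (real i *\<^sub>R e1 + blinfun_apply K x)"
    and eQ: "e1 \<in> range Q" "e2 \<in> range Q" "e3 \<in> range Q" and en: "norm e1 = 1" "norm e2 = 1" "norm e3 = 1"
    and eo: "e1 \<bullet> e2 = 0" "e1 \<bullet> e3 = 0" "e2 \<bullet> e3 = 0"
    and \<phi>E: "\<phi> \<in> Emb n (sphere 0 1) M" and D: "DIM('a) \<ge> 2" and n0: "n > 0"
begin

definition cf :: "(nat \<Rightarrow> 'b) \<Rightarrow> nat \<Rightarrow> 'a \<Rightarrow> 'b" where
  "cf v = emb_of n (cfg C v (\<lambda>_. K))"

text \<open>The distance 1 exceeds twice the norm of K, so translates of the ellipsoid to separated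
  centres are disjoint.\<close>

definition separated :: "(nat \<Rightarrow> 'b) \<Rightarrow> bool" where
  "separated v \<longleftrightarrow> (\<forall>i<n. v i \<in> range Q) \<and> (\<forall>i<n. \<forall>j<n. i \<noteq> j \<longrightarrow> 1 \<le> norm (v i - v j))"

lemma subQ: "subspace (range Q)"
  using ch by (simp add: chart_def subspace_UNIV linear_subspace_image)

lemma C1o_C: "C1o UNIV C" using ch by (simp add: chart_def)

lemma separated_emb:
  assumes "separated v"
  shows "is_emb n M (cfg C v (\<lambda>_. K))"
proof (rule cfg_emb[OF ch])
  fix i j and x y :: 'a assume ij: "i < n" "j < n" "i \<noteq> j" and xy: "x \<in> sphere 0 1" "y \<in> sphere 0 1"
  show "v i + blinfun_apply K x \<noteq> v j + blinfun_apply K y"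
  proof
    assume "v i + blinfun_apply K x = v j + blinfun_apply K y"
    then have "v i - v j = blinfun_apply K (y - x)" by (simp add: blinfun.diff_right algebra_simps)
    then have "norm (v i - v j) \<le> norm K * norm (y - x)" by (simp add: norm_blinfun)
    also have "\<dots> \<le> norm K * 2" using norm_triangle_ineq4[of y x] xy by (intro mult_left_mono) auto
    also have "\<dots> < 1" using nK by simp
    finally have "norm (v i - v j) < 1" .
    moreover have "1 \<le> norm (v i - v j)" using assms ij unfolding separated_def by blast
    ultimately show False by simp
  qed
qed (use assms KQ Kinj in \<open>auto simp: separated_def\<close>)

lemma cf_base: "cf (\<lambda>i. real i *\<^sub>R e1) = \<phi>"
proof
  fix i
  show "cf (\<lambda>i. real i *\<^sub>R e1) i = \<phi> i"
  proof (cases "i < n")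
    case True
    have "\<phi> i \<in> extensional (sphere 0 1)"
      using \<phi>E True by (auto simp: Emb_def C1_embedding_def C1_maps_def PiE_def)
    then have "\<phi> i = restrict (\<phi> i) (sphere 0 1)" by (simp add: extensional_restrict)
    also have "\<dots> = cf (\<lambda>i. real i *\<^sub>R e1) i"
      using True \<phi>_eq by (auto simp: cf_def emb_of_def cfg_def nrm_sphere intro!: restrict_ext)
    finally show ?thesis by simp
  next
    case False
    then show ?thesis using \<phi>E by (auto simp: cf_def emb_of_def Emb_def extensional_def)
  qed
qed

lemma cf_cong: "(\<And>i. i < n \<Longrightarrow> v i = w i) \<Longrightarrow> cf v = cf w"
  by (auto simp: cf_def emb_of_def cfg_def restrict_def fun_eq_iff)

text \<open>Relabelling the centres is precomposition with the permutation because every index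
  carries the same shape K.\<close>

lemma cf_comp:
  assumes "\<pi> permutes {..<n}"
  shows "cf (v \<circ> \<pi>) = cf v \<circ> \<pi>"
proof
  fix i
  have "\<pi> i < n \<longleftrightarrow> i < n" using permutes_in_image[OF assms, of i] by simp
  then show "cf (v \<circ> \<pi>) i = (cf v \<circ> \<pi>) i" by (auto simp: cf_def emb_of_def cfg_def restrict_def)
qed

abbreviation "ConfT \<equiv> Conf_top n M \<phi>"
abbreviation "bp \<equiv> conf_class n \<phi>"

text \<open>Configurations are classes in the path component of \<phi> only; the path connected
  parameter space, with \<phi> at \<open>z0\<close>, keeps the family in it.\<close>

lemma continuous_map_conf:
  fixes v :: "'z::t2_space \<Rightarrow> nat \<Rightarrow> 'b"
  assumes v: "\<And>i. i < n \<Longrightarrow> continuous_on Z (\<lambda>z. v z i)" and sep: "\<And>z. z \<in> Z \<Longrightarrow> separated (v z)"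
    and Z: "path_connected Z" "z0 \<in> Z" "\<And>i. i < n \<Longrightarrow> v z0 i = real i *\<^sub>R e1"
  shows "continuous_map (top_of_set Z) ConfT (\<lambda>z. conf_class n (cf (v z)))"
proof -
  let ?E = "Emb_top n (sphere 0 1 :: 'a set) M"
  have c: "continuous_map (top_of_set Z) ?E (\<lambda>z. cf (v z))"
    unfolding cf_def
  proof (rule continuous_map_Emb[OF D])
    show "C1_fam Z (- {0}) (\<lambda>z. cfg C (v z) (\<lambda>_. K) i)" if "i < n" for i
      by (rule cfg_fam[where a = v and L = "\<lambda>_ _. K", OF C1o_C v[OF that] continuous_on_const])
  qed (rule separated_emb[OF sep])
  have z0: "cf (v z0) = \<phi>" using cf_cong[OF Z(3)] cf_base by simp
  have "cf (v z) \<in> path_component_of_set ?E \<phi>" if "z \<in> Z" for z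
    using continuous_map_path_component[OF c Z(1) Z(2) that] z0 by simp
  then have 1: "continuous_map (top_of_set Z) (subtopology ?E (path_component_of_set ?E \<phi>)) (\<lambda>z. cf (v z))"
    using c unfolding continuous_map_in_subtopology by auto
  have 2: "continuous_map (subtopology ?E (path_component_of_set ?E \<phi>)) ConfT (conf_class n)"
    unfolding Conf_top_def by (rule quotient_imp_continuous_map[OF quotient_map_quotient_topology])
  show ?thesis using continuous_map_compose[OF 1 2] by (simp add: o_def)
qed

text \<open>Resting near both ends leaves room for the displacement along \<open>e3\<close> to vanish at the ends
  of a homotopy of motions.\<close>

definition planar_motion :: "(real \<Rightarrow> nat \<Rightarrow> 'b) \<Rightarrow> bool" where
  "planar_motion v \<longleftrightarrow> (\<forall>i<n. continuous_on {0..1} (\<lambda>t. v t i)) \<and>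
     (\<forall>t\<in>{0..1}. separated (v t) \<and> (\<forall>i<n. e3 \<bullet> v t i = 0)) \<and>
     (\<forall>t\<in>{0..1}. \<forall>i<n. (t \<le> 1/10 \<longrightarrow> v t i = v 0 i) \<and> (9/10 \<le> t \<longrightarrow> v t i = v 1 i)) \<and>
     (\<forall>i<n. v 0 i = real i *\<^sub>R e1)"

definition lp :: "(real \<Rightarrow> nat \<Rightarrow> 'b) \<Rightarrow> real \<Rightarrow> (nat \<Rightarrow> 'a \<Rightarrow> 'b) set" where
  "lp v t = conf_class n (cf (v t))"

lemma norm_ge_coordinate:
  assumes "norm (e::'b) = 1"
  shows "\<bar>e \<bullet> w\<bar> \<le> norm w"
  using Cauchy_Schwarz_ineq2[of e w] assms by simp

lemma real_dist_ge1: "i \<noteq> j \<Longrightarrow> 1 \<le> \<bar>real i - real j\<bar>"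
  by linarith

text \<open>In the homotopy parameter, the spheres are first lifted along \<open>e3\<close> to
  distinct heights, then moved from v to w by linear interpolation, then lowered. At both ends of
  time the labelled positions of v and w agree and \<open>bump\<close> vanishes, so the base point
  is kept.\<close>

lemma planar_homotopic:
  assumes v: "planar_motion v" and w: "planar_motion w" and vw: "\<And>i. i < n \<Longrightarrow> v 1 i = w 1 i"
    and fin: "conf_class n (cf (v 1)) = bp"
  shows "homotopic_with (\<lambda>p. p 0 = bp \<and> p 1 = bp) (top_of_set {0..1}) ConfT (lp v) (lp w)"
proof -
  let ?I = "{0..1::real}"
  define H where "H z i = (1 - slide (fst z)) *\<^sub>R v (snd z) i + slide (fst z) *\<^sub>R w (snd z) i +
      (spread (fst z) * bump (snd z) * real i) *\<^sub>R e3" for z :: "real \<times> real" and i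
  have ends: "v t i = w t i" if "i < n" "t \<in> ?I" "t \<le> 1/10 \<or> 9/10 \<le> t" for t i
    using that v w vw[OF that(1)] unfolding planar_motion_def by metis
  have v0: "v 0 i = real i *\<^sub>R e1" "w 0 i = real i *\<^sub>R e1" if "i < n" for i
    using that v w unfolding planar_motion_def by blast+
  have sv: "separated (v t)" "separated (w t)" and e3v: "\<And>i. i < n \<Longrightarrow> e3 \<bullet> v t i = 0" "\<And>i. i < n \<Longrightarrow> e3 \<bullet> w t i = 0" if "t \<in> ?I" for t
    using that v w unfolding planar_motion_def by blast+
  have e33: "e3 \<bullet> e3 = 1" using en by (simp add: dot_square_norm)
  have sep: "separated (H z)" if z: "z \<in> ?I \<times> ?I" for z
  proof -
    obtain s t where st: "z = (s, t)" "s \<in> ?I" "t \<in> ?I" using z by auto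
    have "H z i \<in> range Q" if "i < n" for i
      unfolding H_def using sv[OF st(3)] that eQ st
      by (intro subspace_add[OF subQ] subspace_scale[OF subQ]) (auto simp: separated_def)
    moreover have "1 \<le> norm (H z i - H z j)" if ij: "i < n" "j < n" "i \<noteq> j" for i j
    proof -
      have e3H: "e3 \<bullet> (H z i - H z j) = spread s * bump t * (real i - real j)"
        using e3v[OF st(3)] ij e33 by (simp add: H_def st inner_diff_right inner_add_right algebra_simps)
      \<comment> \<open>Adding a multiple of \<open>e3\<close> to a difference orthogonal to
        \<open>e3\<close> can only lengthen it.\<close>
      have vH: "1 \<le> norm (H z i - H z j)"
        if u: "H z i - H z j = u i - u j + c *\<^sub>R e3" "separated u" "e3 \<bullet> u i = 0" "e3 \<bullet> u j = 0" for u c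
      proof -
        have "(norm (u i - u j))\<^sup>2 \<le> (norm (H z i - H z j))\<^sup>2"
          unfolding u(1) power2_norm_eq_inner
          using u(3,4) e33 by (simp add: inner_add_left inner_add_right inner_diff_left inner_diff_right inner_commute)
        then have "norm (u i - u j) \<le> norm (H z i - H z j)" by (rule power2_le_imp_le) simp
        moreover have "1 \<le> norm (u i - u j)" using u(2) ij by (simp add: separated_def)
        ultimately show ?thesis by simp
      qed
      \<comment> \<open>While the interpolation runs, the spheres are at full height, except near
        the ends of time; there v and w coincide and the interpolation is constant.\<close>
      consider "slide s = 0" | "slide s = 1" | "t \<le> 1/10 \<or> 9/10 \<le> t" | "spread s = 1" "bump t = 1"
        using slide_spread[of s] bump_middle(1)[of t] by blast
      then show ?thesis
      proof cases
        case 1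
        show ?thesis
          by (rule vH[of "v t" "spread s * bump t * (real i - real j)"])
            (use 1 sv[OF st(3)] e3v[OF st(3)] ij in \<open>auto simp: H_def st algebra_simps\<close>)
      next
        case 2
        show ?thesis
          by (rule vH[of "w t" "spread s * bump t * (real i - real j)"])
            (use 2 sv[OF st(3)] e3v[OF st(3)] ij in \<open>auto simp: H_def st algebra_simps\<close>)
      next
        case 3
        have "v t i = w t i" "v t j = w t j" using ends ij st 3 by auto
        then show ?thesis
          by (intro vH[of "v t" "spread s * bump t * (real i - real j)"])
            (use sv[OF st(3)] e3v[OF st(3)] ij in \<open>auto simp: H_def st algebra_simps\<close>)
      next
        case 4
        then have "\<bar>e3 \<bullet> (H z i - H z j)\<bar> = \<bar>real i - real j\<bar>" using e3H by simp
        then show ?thesis using norm_ge_coordinate[OF en(3), of "H z i - H z j"] real_dist_ge1[OF ij(3)] by simp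
      qed
    qed
    ultimately show ?thesis by (simp add: separated_def)
  qed
  have "continuous_map (top_of_set (?I \<times> ?I)) ConfT (\<lambda>z. conf_class n (cf (H z)))"
  proof (rule continuous_map_conf[of _ H "(0,0)"])
    fix i assume i: "i < n"
    have cv: "continuous_on ?I (\<lambda>t. v t i)" "continuous_on ?I (\<lambda>t. w t i)"
      using v w i unfolding planar_motion_def by blast+
    have "continuous_on (?I \<times> ?I) (\<lambda>z. v (snd z) i)" "continuous_on (?I \<times> ?I) (\<lambda>z. w (snd z) i)"
      by (rule continuous_on_compose2[OF cv(1)] continuous_on_compose2[OF cv(2)], auto intro: continuous_intros)+
    then show "continuous_on (?I \<times> ?I) (\<lambda>z. H z i)" unfolding H_def by (intro continuous_intros)
    show "H (0, 0) i = real i *\<^sub>R e1"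
      using slide_spread_ends(1)[of 0] v0[OF i] by (simp add: H_def)
  qed (use sep in \<open>auto intro!: convex_imp_path_connected convex_Times\<close>)
  then have c: "continuous_map (prod_topology (top_of_set ?I) (top_of_set ?I)) ConfT (\<lambda>z. conf_class n (cf (H z)))"
    by (simp add: prod_topology_subtopology_eu)
  have P: "conf_class n (cf (H (s, 0))) = bp" "conf_class n (cf (H (s, 1))) = bp" for s
  proof -
    have mix: "(1 - c) *\<^sub>R x + c *\<^sub>R x = x" for c :: real and x :: 'b
      by (simp add: scaleR_left_distrib[symmetric])
    have "H (s, 0) i = real i *\<^sub>R e1" if "i < n" for i
    proof -
      have "H (s, 0) i = (1 - slide s) *\<^sub>R v 0 i + slide s *\<^sub>R w 0 i" by (simp add: H_def bump_middle)
      then show ?thesis unfolding v0[OF that] mix .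
    qed
    then show "conf_class n (cf (H (s, 0))) = bp" using cf_cong[of "H (s, 0)"] cf_base by metis
    have "H (s, 1) i = v 1 i" if "i < n" for i
    proof -
      have "H (s, 1) i = (1 - slide s) *\<^sub>R v 1 i + slide s *\<^sub>R w 1 i" by (simp add: H_def bump_middle)
      then show ?thesis unfolding vw[OF that, symmetric] mix .
    qed
    then show "conf_class n (cf (H (s, 1))) = bp" using cf_cong[of "H (s, 1)"] fin by metis
  qed
  have H0: "conf_class n (cf (H (0, t))) = lp v t" for t
    using slide_spread_ends(1)[of 0] unfolding lp_def by (intro arg_cong[where f = "conf_class n"] cf_cong) (simp add: H_def)
  have H1: "conf_class n (cf (H (1, t))) = lp w t" for t
    using slide_spread_ends(2)[of 1] unfolding lp_def by (intro arg_cong[where f = "conf_class n"] cf_cong) (simp add: H_def)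
  show ?thesis
    unfolding homotopic_with_def
    by (intro exI[of _ "\<lambda>z. conf_class n (cf (H z))"]) (use c H0 H1 P in simp)
qed

text \<open>Sphere i travels at height i in the direction \<open>e2\<close>, so that spheres can
  pass each other while they change places along \<open>e1\<close>.\<close>

definition pm :: "(nat \<Rightarrow> nat) \<Rightarrow> real \<Rightarrow> nat \<Rightarrow> 'b" where
  "pm \<pi> t i = ((1 - slide t) * real i + slide t * real (\<pi> i)) *\<^sub>R e1 + (spread t * real i) *\<^sub>R e2"

lemma pm_planar:
  assumes \<pi>: "\<pi> permutes {..<n}"
  shows "planar_motion (pm \<pi>)"
proof -
  have sep: "separated (pm \<pi> t)" for t
  proof -
    have "pm \<pi> t i \<in> range Q" for i
      unfolding pm_def using eQ by (intro subspace_add[OF subQ] subspace_scale[OF subQ])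
    moreover have "1 \<le> norm (pm \<pi> t i - pm \<pi> t j)" if ij: "i \<noteq> j" for i j
    proof -
      let ?w = "pm \<pi> t i - pm \<pi> t j"
      have c1: "e1 \<bullet> ?w = (1 - slide t) * (real i - real j) + slide t * (real (\<pi> i) - real (\<pi> j))"
        using eo en by (simp add: pm_def inner_diff_right inner_add_right dot_square_norm algebra_simps)
      have c2: "e2 \<bullet> ?w = spread t * (real i - real j)"
        using eo en by (simp add: pm_def inner_diff_right inner_add_right dot_square_norm inner_commute algebra_simps)
      have "\<pi> i \<noteq> \<pi> j" using permutes_inj[OF \<pi>] ij by (auto simp: inj_def)
      consider "slide t = 0" | "slide t = 1" | "spread t = 1" using slide_spread[of t] by blast
      then show ?thesis
      proof cases
        case 1
        then show ?thesis using norm_ge_coordinate[OF en(1), of ?w] c1 real_dist_ge1[OF ij] by simp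
      next
        case 2
        then show ?thesis using norm_ge_coordinate[OF en(1), of ?w] c1 real_dist_ge1[OF \<open>\<pi> i \<noteq> \<pi> j\<close>] by simp
      next
        case 3
        then show ?thesis using norm_ge_coordinate[OF en(2), of ?w] c2 real_dist_ge1[OF ij] by simp
      qed
    qed
    ultimately show ?thesis by (simp add: separated_def)
  qed
  have "continuous_on {0..1} (\<lambda>t. pm \<pi> t i)" for i unfolding pm_def by (intro continuous_intros)
  moreover have "e3 \<bullet> pm \<pi> t i = 0" for t i
    using eo by (simp add: pm_def inner_add_right inner_commute)
  moreover have "pm \<pi> t i = pm \<pi> 0 i" if "t \<le> 1/10" for t i
    using slide_spread_ends(1)[of t] slide_spread_ends(1)[of 0] that by (simp add: pm_def)
  moreover have "pm \<pi> t i = pm \<pi> 1 i" if "9/10 \<le> t" for t i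
    using slide_spread_ends(2)[of t] slide_spread_ends(2)[of 1] that by (simp add: pm_def)
  moreover have "pm \<pi> 0 i = real i *\<^sub>R e1" for i
    using slide_spread_ends(1)[of 0] by (simp add: pm_def)
  ultimately show ?thesis using sep unfolding planar_motion_def by blast
qed

lemma pm_ends: "pm \<pi> 0 i = real i *\<^sub>R e1" "pm \<pi> 1 i = real (\<pi> i) *\<^sub>R e1"
  using slide_spread_ends(1)[of 0] slide_spread_ends(2)[of 1] by (simp_all add: pm_def)

lemma cf_pm_1:
  assumes "\<pi> permutes {..<n}"
  shows "cf (pm \<pi> 1) = \<phi> \<circ> \<pi>"
proof -
  have "pm \<pi> 1 = (\<lambda>i. real i *\<^sub>R e1) \<circ> \<pi>" by (simp add: fun_eq_iff pm_ends)
  then show ?thesis using cf_comp[OF assms] cf_base by simp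
qed

definition \<Theta> :: "(nat \<Rightarrow> nat) \<Rightarrow> (real \<Rightarrow> (nat \<Rightarrow> 'a \<Rightarrow> 'b) set) set" where
  "\<Theta> \<pi> = loop_class ConfT bp (lp (pm \<pi>))"

lemma lp_pm_loop:
  assumes "\<pi> permutes {..<n}"
  shows "homotopic_with (\<lambda>p. p 0 = bp \<and> p 1 = bp) (top_of_set {0..1}) ConfT (lp (pm \<pi>)) (lp (pm \<pi>))"
  by (rule planar_homotopic[OF pm_planar[OF assms] pm_planar[OF assms]])
    (simp_all add: cf_pm_1[OF assms] conf_class_comp[OF assms])

lemma \<Theta>_self: "\<pi> permutes {..<n} \<Longrightarrow> lp (pm \<pi>) \<in> \<Theta> \<pi>"
  using lp_pm_loop by (simp add: \<Theta>_def loop_class_def)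

lemma \<Theta>_carrier:
  assumes "\<pi> permutes {..<n}"
  shows "\<Theta> \<pi> \<in> carrier (motion_group n M \<phi>)"
proof -
  note h = lp_pm_loop[OF assms]
  have "pathin ConfT (lp (pm \<pi>))"
    using homotopic_with_imp_continuous_maps[OF h] by (simp add: pathin_def)
  moreover have "lp (pm \<pi>) 0 = bp" "lp (pm \<pi>) 1 = bp"
    using homotopic_with_imp_property[OF h] by auto
  ultimately show ?thesis
    unfolding \<Theta>_def motion_group_def pi1_def loops_at_def by simp
qed

text \<open>The motion for \<rho> followed by the motion for \<pi>, relabelled by \<rho>, is again
  planar and ends at \<pi> \<circ> \<rho>; so \<open>planar_homotopic\<close> applies. The
  relabelling is invisible in the unordered loop, and traversing \<rho> first agrees with the order
  of products in \<open>pi1\<close>.\<close>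

lemma \<Theta>_mult:
  assumes \<pi>: "\<pi> permutes {..<n}" and \<rho>: "\<rho> permutes {..<n}"
  shows "\<Theta> \<pi> \<otimes>\<^bsub>motion_group n M \<phi>\<^esub> \<Theta> \<rho> = \<Theta> (\<pi> \<circ> \<rho>)"
proof -
  let ?h = "homotopic_with (\<lambda>p. p 0 = bp \<and> p 1 = bp) (top_of_set {0..1}) ConfT"
  have \<pi>\<rho>: "\<pi> \<circ> \<rho> permutes {..<n}" by (rule permutes_compose[OF \<rho> \<pi>])
  define j where "j t i = (if t \<le> 1/2 then pm \<rho> (2 * t) i else pm \<pi> (2 * t - 1) (\<rho> i))" for t :: real and i
  have \<rho>n: "\<rho> i < n" if "i < n" for i using permutes_in_image[OF \<rho>, of i] that by simp
  have P\<pi>: "planar_motion (pm \<pi>)" and P\<rho>: "planar_motion (pm \<rho>)" using pm_planar \<pi> \<rho> by auto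
  have sepc: "separated (v \<circ> \<rho>)" if "separated v" for v
    unfolding separated_def
  proof (intro conjI allI impI)
    fix i assume i: "i < n"
    show "(v \<circ> \<rho>) i \<in> range Q" using that \<rho>n[OF i] by (simp add: separated_def)
    fix k assume k: "k < n" "i \<noteq> k"
    have "\<rho> i \<noteq> \<rho> k" using injD[OF permutes_inj[OF \<rho>]] k(2) by blast
    then show "1 \<le> norm ((v \<circ> \<rho>) i - (v \<circ> \<rho>) k)"
      using that \<rho>n[OF i] \<rho>n[OF k(1)] by (simp add: separated_def)
  qed
  have "planar_motion j"
    unfolding planar_motion_def
  proof (intro conjI allI impI ballI)
    fix i assume i: "i < n"
    have "continuous_on {0..1} (\<lambda>t. if t \<le> 1/2 then pm \<rho> (2 * t) i else pm \<pi> (2 * t - 1) (\<rho> i))"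
    proof (rule continuous_on_cases_le[where h = "\<lambda>t. t"])
      show "pm \<rho> (2 * t) i = pm \<pi> (2 * t - 1) (\<rho> i)" if "t \<in> {0..1}" "t = 1/2" for t
      proof -
        have e: "2 * t = 1" using that(2) by simp
        show ?thesis unfolding e by (simp add: pm_ends)
      qed
    qed (unfold pm_def, (intro continuous_intros)+)
    then show "continuous_on {0..1} (\<lambda>t. j t i)" by (simp add: j_def)
    show "j 0 i = real i *\<^sub>R e1" by (simp add: j_def pm_ends)
  next
    fix t :: real assume t: "t \<in> {0..1}"
    show "separated (j t)"
    proof (cases "t \<le> 1/2")
      case True
      have "2 * t \<in> {0..1}" using True t by auto
      then have "separated (pm \<rho> (2 * t))" using P\<rho> unfolding planar_motion_def by blast
      moreover have "j t = pm \<rho> (2 * t)" using True by (simp add: j_def fun_eq_iff)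
      ultimately show ?thesis by simp
    next
      case False
      have "2 * t - 1 \<in> {0..1}" using False t by auto
      then have "separated (pm \<pi> (2 * t - 1))" using P\<pi> unfolding planar_motion_def by blast
      moreover have "j t = pm \<pi> (2 * t - 1) \<circ> \<rho>" using False by (simp add: j_def fun_eq_iff)
      ultimately show ?thesis using sepc by simp
    qed
    fix i assume i: "i < n"
    show "e3 \<bullet> j t i = 0" using eo by (simp add: j_def pm_def inner_add_right inner_commute)
    \<comment> \<open>\<open>pm\<close> rests for a fifth of the time at each end, so that after
      doubling the speed a tenth is left, as \<open>planar_motion\<close> demands.\<close>
    show "j t i = j 0 i" if "t \<le> 1/10"
      using that slide_spread_ends(1)[of "2 * t"] slide_spread_ends(1)[of 0] by (simp add: j_def pm_def)
    show "j t i = j 1 i" if "9/10 \<le> t"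
      using that slide_spread_ends(2)[of "2 * t - 1"] slide_spread_ends(2)[of 1] by (simp add: j_def pm_def)
  qed
  moreover have "j 1 i = pm (\<pi> \<circ> \<rho>) 1 i" for i by (simp add: j_def pm_ends)
  moreover have "conf_class n (cf (j 1)) = bp"
    using cf_cong[of "j 1" "pm (\<pi> \<circ> \<rho>) 1"] calculation(2) cf_pm_1[OF \<pi>\<rho>] conf_class_comp[OF \<pi>\<rho>, of \<phi>] by simp
  ultimately have hj: "?h (lp j) (lp (pm (\<pi> \<circ> \<rho>)))"
    by (intro planar_homotopic pm_planar[OF \<pi>\<rho>])
  have "lp j = join_loops (lp (pm \<rho>)) (lp (pm \<pi>))"
  proof
    fix t
    show "lp j t = join_loops (lp (pm \<rho>)) (lp (pm \<pi>)) t"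
    proof (cases "t \<le> 1/2")
      case True
      then have "j t = pm \<rho> (2 * t)" by (simp add: j_def fun_eq_iff)
      then show ?thesis using True by (simp add: lp_def join_loops_def)
    next
      case False
      then have "j t = pm \<pi> (2 * t - 1) \<circ> \<rho>" by (simp add: j_def fun_eq_iff)
      then show ?thesis using False cf_comp[OF \<rho>] conf_class_comp[OF \<rho>] by (simp add: lp_def join_loops_def)
    qed
  qed
  with hj have hj': "?h (join_loops (lp (pm \<rho>)) (lp (pm \<pi>))) (lp (pm (\<pi> \<circ> \<rho>)))" by simp
  have "loop_class ConfT bp (join_loops \<delta> \<gamma>) = \<Theta> (\<pi> \<circ> \<rho>)" if "\<gamma> \<in> \<Theta> \<pi>" "\<delta> \<in> \<Theta> \<rho>" for \<gamma> \<delta>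
  proof -
    have "?h (lp (pm \<rho>)) \<delta>" "?h (lp (pm \<pi>)) \<gamma>" using that by (simp_all add: \<Theta>_def loop_class_def)
    from join_loops_homotopic[OF this]
    have "?h (join_loops \<delta> \<gamma>) (join_loops (lp (pm \<rho>)) (lp (pm \<pi>)))" by (rule homotopic_with_symD)
    from homotopic_with_trans[OF this hj'] show ?thesis unfolding \<Theta>_def by (rule loop_class_eq)
  qed
  then have "(\<Union>\<gamma>\<in>\<Theta> \<pi>. \<Union>\<delta>\<in>\<Theta> \<rho>. loop_class ConfT bp (join_loops \<delta> \<gamma>)) = \<Theta> (\<pi> \<circ> \<rho>)"
    using \<Theta>_self[OF \<pi>] \<Theta>_self[OF \<rho>] by blast
  then show ?thesis by (simp add: motion_group_def pi1_def)
qed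

end


section \<open>Realizations by diffeomorphisms\<close>

lemma (in C1_retract) Diff_id_subset: "Diff_id M \<subseteq> C1_maps M M \<inter> Diff_c M"
proof
  fix f assume "f \<in> Diff_id M"
  then have "path_component_of (subtopology (C1_topology M M) (Diff_c M)) (\<lambda>x\<in>M. x) f"
    by (simp add: Diff_id_def)
  from path_component_in_topspace[OF this] show "f \<in> C1_maps M M \<inter> Diff_c M" by simp
qed

context standard_config
begin

lemma \<phi>M:
  assumes "i < n" "x \<in> sphere 0 1"
  shows "\<phi> i x \<in> M"
proof -
  have "\<phi> i \<in> sphere 0 1 \<rightarrow>\<^sub>E M" using \<phi>E assms(1) by (simp add: Emb_def C1_embedding_def C1_maps_def)
  then show ?thesis using assms(2) by (rule PiE_mem)
qed

lemma apply_diffeo_eval: "i < n \<Longrightarrow> x \<in> sphere 0 1 \<Longrightarrow> apply_diffeo n f \<phi> i x = f (\<phi> i x)"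
  by (simp add: apply_diffeo_def compose_def)

lemma Diff_conf_perm:
  assumes "f \<in> Diff_conf n M \<phi>"
  obtains \<pi> where "\<pi> permutes {..<n}" "\<forall>i<n. \<forall>x\<in>sphere 0 1. f (\<phi> i x) = \<phi> (\<pi> i) x"
proof -
  have "conf_class n (apply_diffeo n f \<phi>) = conf_class n \<phi>" using assms by (simp add: Diff_conf_def)
  then obtain \<pi> where \<pi>: "\<pi> permutes {..<n}" "apply_diffeo n f \<phi> = \<phi> \<circ> \<pi>" by (rule conf_class_eqD)
  show thesis
  proof (rule that[OF \<pi>(1)], intro allI impI ballI)
    fix i and x :: 'a assume ix: "i < n" "x \<in> sphere 0 1"
    show "f (\<phi> i x) = \<phi> (\<pi> i) x" using apply_diffeo_eval[OF ix, of f] \<pi>(2) by simp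
  qed
qed

lemma \<phi>_inj:
  assumes "i < n" "j < n" "x \<in> sphere 0 1" "\<phi> i x = \<phi> j x"
  shows "i = j"
proof (rule ccontr)
  assume "i \<noteq> j"
  have "disjoint_family_on (\<lambda>i. \<phi> i ` sphere 0 1) {..<n}" using \<phi>E by (simp add: Emb_def)
  then have "\<phi> i ` sphere 0 1 \<inter> \<phi> j ` sphere 0 1 = {}"
    using assms(1,2) \<open>i \<noteq> j\<close> unfolding disjoint_family_on_def by blast
  moreover have "\<phi> i x \<in> \<phi> i ` sphere 0 1" "\<phi> i x \<in> \<phi> j ` sphere 0 1"
    using imageI[OF assms(3), of "\<phi> i"] imageI[OF assms(3), of "\<phi> j"] assms(4) by simp_all
  ultimately show False by blast
qed

text \<open>Ensures that the choice in \<open>push_map\<close> is made from a nonempty set.\<close>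

lemma lift_exists:
  assumes \<pi>: "\<pi> permutes {..<n}"
  shows "\<exists>F. lifts_loop n M \<phi> (lp (pm \<pi>)) F"
proof -
  have P: "planar_motion (pm \<pi>)" by (rule pm_planar[OF \<pi>])
  have sep: "separated (pm \<pi> u)" if "u \<in> {0..1}" for u using P that unfolding planar_motion_def by blast
  obtain G where G: "Diff_path 0 1 G" "\<forall>x\<in>X. G 0 x = r x"
    and Gp: "\<forall>u\<in>{0..1}. \<forall>i<n. \<forall>x\<in>sphere 0 1. G u (cfg C (pm \<pi> 0) (\<lambda>_. K) i x) = cfg C (pm \<pi> u) (\<lambda>_. K) i x"
  proof (rule isotopy_extension[of n "\<lambda>u. cfg C (pm \<pi> u) (\<lambda>_. K)"])
    show "C1_fam {0..1} (- {0}) (\<lambda>u. cfg C (pm \<pi> u) (\<lambda>_. K) i)" if "i < n" for i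
      by (rule cfg_fam[where a = "pm \<pi>" and L = "\<lambda>_ _. K", OF C1o_C _ continuous_on_const])
        (use P that in \<open>simp add: planar_motion_def\<close>)
    show "is_emb n M (cfg C (pm \<pi> u) (\<lambda>_. K))" if "u \<in> {0..1}" for u
      by (rule separated_emb[OF sep[OF that]])
  qed (rule that)
  have "apply_diffeo n (restrict (G u) M) \<phi> = cf (pm \<pi> u)" if u: "u \<in> {0..1}" for u
  proof
    fix i
    show "apply_diffeo n (restrict (G u) M) \<phi> i = cf (pm \<pi> u) i"
    proof (cases "i < n")
      case True
      have "restrict (G u) M (\<phi> i x) = cfg C (pm \<pi> u) (\<lambda>_. K) i x" if x: "x \<in> sphere 0 1" for x
      proof -
        have "\<phi> i x = cfg C (pm \<pi> 0) (\<lambda>_. K) i x" using \<phi>_eq True x by (simp add: cfg_def nrm_sphere pm_ends)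
        then show ?thesis using Gp u True x \<phi>M[OF True x] by simp
      qed
      then show ?thesis using True by (simp add: apply_diffeo_def cf_def emb_of_def compose_def restrict_def fun_eq_iff)
    qed (simp add: apply_diffeo_def cf_def emb_of_def)
  qed
  then have "lifts_loop n M \<phi> (lp (pm \<pi>)) (\<lambda>u. restrict (G u) M)"
    using pathin_Diff_path[OF G] by (simp add: lifts_loop_def lp_def)
  then show ?thesis by blast
qed

text \<open>\<gamma> and F are arbitrary, as \<open>push_map\<close> may pick any of them. Over the
  homotopy from the explicit loop to \<gamma>, the marked point of sphere j follows the explicit
  motion on one side of the square and F on the other. Monodromy makes both end at the same
  point.\<close>

lemma lift_endpoint:
  assumes \<pi>: "\<pi> permutes {..<n}" and \<gamma>: "\<gamma> \<in> \<Theta> \<pi>" and F: "lifts_loop n M \<phi> \<gamma> F"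
    and j: "j < n" and x: "x \<in> sphere 0 1"
  shows "F 1 (\<phi> j x) = \<phi> (\<pi> j) x"
proof -
  let ?I = "{0..1::real}"
  have P: "planar_motion (pm \<pi>)" by (rule pm_planar[OF \<pi>])
  have \<pi>j: "\<pi> j < n" using permutes_in_image[OF \<pi>, of j] j by simp
  have "homotopic_with (\<lambda>p. p 0 = bp \<and> p 1 = bp) (top_of_set ?I) ConfT (lp (pm \<pi>)) \<gamma>"
    using \<gamma> by (simp add: \<Theta>_def loop_class_def)
  then obtain h where h: "continuous_map (prod_topology (top_of_set ?I) (top_of_set ?I)) ConfT h"
    and h0: "\<forall>t. h (0, t) = lp (pm \<pi>) t" and h1: "\<forall>t. h (1, t) = \<gamma> t"
    and hb: "\<forall>s\<in>?I. h (s, 0) = bp \<and> h (s, 1) = bp"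
    unfolding homotopic_with_def by blast
  have h': "continuous_map (top_of_set (?I \<times> ?I)) ConfT h"
    using h by (simp add: prod_topology_subtopology_eu)
  have fb: "fibre n x bp = (\<lambda>i. \<phi> i x) ` {..<n}" by (rule fibre_conf_class)
  have F': "pathin (Diff_id_top M) F" "F 0 = (\<lambda>x\<in>M. x)" "\<forall>t\<in>?I. conf_class n (apply_diffeo n (F t) \<phi>) = \<gamma> t"
    using F by (auto simp: lifts_loop_def)
  define A where "A t = cf (pm \<pi> t) j x" for t
  define A' where "A' t = F t (\<phi> j x)" for t
  have A: "A t = C (pm \<pi> t j + blinfun_apply K x)" for t
    using j x by (simp add: A_def cf_def emb_of_def cfg_def nrm_sphere)
  have A0: "A 0 = \<phi> j x" using A \<phi>_eq j x by (simp add: pm_ends)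
  have A1: "A 1 = \<phi> (\<pi> j) x" by (simp add: A_def cf_pm_1[OF \<pi>])
  have "A' 1 = A 1"
  proof (rule monodromy_square[OF n0, where E = "\<lambda>z. fibre n x (h z)"])
    show "\<exists>p. inj_on p {..<n} \<and> fibre n x (h z) = p ` {..<n} \<and> (\<forall>\<epsilon>>0. \<exists>U. open U \<and> z \<in> U \<and>
        (\<forall>z'\<in>U \<inter> ?I \<times> ?I. \<exists>p'. fibre n x (h z') = p' ` {..<n} \<and> (\<forall>i<n. dist (p i) (p' i) < \<epsilon>)))"
      if "z \<in> ?I \<times> ?I" for z
      by (rule conf_fibre_local[OF h' that x])
    have "continuous_on ?I (\<lambda>t. pm \<pi> t j)" using P j unfolding planar_motion_def by blast
    then show "continuous_on ?I A" unfolding A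
      by (intro continuous_on_compose2[OF C1o_imp_continuous_on[OF C1o_C]] continuous_intros) auto
    show "A t \<in> fibre n x (h (0, t))" for t
      using j h0 by (simp add: lp_def fibre_conf_class A_def)
    have "continuous_map (Diff_id_top M) euclidean (\<lambda>f. f (\<phi> j x))"
      unfolding Diff_id_top_def by (rule continuous_map_from_subtopology[OF continuous_map_C1_eval[OF \<phi>M[OF j x]]])
    from continuous_map_compose[OF F'(1)[unfolded pathin_def] this]
    show "continuous_on ?I A'" by (simp add: A'_def[abs_def] o_def)
    show "A' t \<in> fibre n x (h (1, t))" if t: "t \<in> ?I" for t
    proof -
      have "fibre n x (h (1, t)) = (\<lambda>i. apply_diffeo n (F t) \<phi> i x) ` {..<n}"
        using h1 F'(3) t fibre_conf_class by metis
      then show ?thesis using j apply_diffeo_eval[OF j x] by (auto simp: A'_def intro!: image_eqI[of _ _ j])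
    qed
    show "A' 0 = A 0" using F'(2) \<phi>M[OF j x] by (simp add: A'_def A0)
    show "A 0 \<in> fibre n x (h (s, 0))" if "s \<in> ?I" for s using hb that fb A0 j by simp
    show "A 1 \<in> fibre n x (h (s, 1))" if "s \<in> ?I" for s using hb that fb A1 \<pi>j by simp
  qed
  then show ?thesis by (simp add: A'_def A1)
qed

text \<open>f is joined to the chosen endpoint by a path of diffeomorphisms preserving the
  configuration. Along it the image of \<open>\<phi> j x\<close> moves continuously in the finite
  set of marked points, hence not at all.\<close>

lemma push_map_perm:
  assumes \<pi>: "\<pi> permutes {..<n}" and f: "f \<in> Diff_conf n M \<phi>" and eq: "to_pi0 n M \<phi> f = push_map n M \<phi> (\<Theta> \<pi>)"
    and j: "j < n" and x: "x \<in> sphere 0 1"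
  shows "f (\<phi> j x) = \<phi> (\<pi> j) x"
proof -
  let ?P = "\<lambda>f. \<exists>\<gamma>\<in>\<Theta> \<pi>. \<exists>F. lifts_loop n M \<phi> \<gamma> F \<and> f = F 1"
  have "\<exists>f. ?P f" using \<Theta>_self[OF \<pi>] lift_exists[OF \<pi>] by blast
  then have "?P (SOME f. ?P f)" by (rule someI_ex)
  then obtain \<gamma> F where \<gamma>: "\<gamma> \<in> \<Theta> \<pi>" "lifts_loop n M \<phi> \<gamma> F" "(SOME f. ?P f) = F 1" by blast
  have F1: "F 1 (\<phi> j x) = \<phi> (\<pi> j) x" by (rule lift_endpoint[OF \<pi> \<gamma>(1,2) j x])
  let ?T = "subtopology (Diff_id_top M) (Diff_conf n M \<phi>)"
  have "f \<in> topspace ?T"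
    using f Diff_id_subset by (auto simp: Diff_id_top_def Diff_conf_def)
  then have "f \<in> to_pi0 n M \<phi> f" by (simp add: to_pi0_def path_component_of_refl)
  then have "f \<in> to_pi0 n M \<phi> (F 1)"
    unfolding eq push_map_def \<gamma>(3) .
  then have "f \<in> path_component_of_set ?T (F 1)" unfolding to_pi0_def .
  then obtain g where g: "pathin ?T g" "g 0 = F 1" "g 1 = f" by (auto simp: path_component_of_def)
  define B where "B t = g t (\<phi> j x)" for t
  have "continuous_map ?T euclidean (\<lambda>f. f (\<phi> j x))"
    unfolding Diff_id_top_def
    by (intro continuous_map_from_subtopology continuous_map_C1_eval \<phi>M j x)
  from continuous_map_compose[OF g(1)[unfolded pathin_def] this]
  have "continuous_on {0..1} B" by (simp add: B_def[abs_def] o_def)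
  then have con: "connected (B ` {0..1})" by (rule connected_continuous_image) simp
  have "B ` {0..1} \<subseteq> (\<lambda>i. \<phi> i x) ` {..<n}"
  proof (rule image_subsetI)
    fix t :: real assume t: "t \<in> {0..1}"
    have "g t \<in> Diff_conf n M \<phi>"
      using g(1) t by (auto simp: pathin_def continuous_map_in_subtopology)
    then obtain \<pi>' where \<pi>': "\<pi>' permutes {..<n}" "\<forall>i<n. \<forall>x\<in>sphere 0 1. g t (\<phi> i x) = \<phi> (\<pi>' i) x"
      by (rule Diff_conf_perm)
    have "\<pi>' j < n" using permutes_in_image[OF \<pi>'(1), of j] j by simp
    then show "B t \<in> (\<lambda>i. \<phi> i x) ` {..<n}" using \<pi>'(2) j x by (simp add: B_def)
  qed
  then have "finite (B ` {0..1})" by (rule finite_subset) simp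
  then obtain b where b: "B ` {0..1} = {b}" using con connected_finite_iff_sing[of "B ` {0..1}"] by auto
  have "B 0 \<in> B ` {0..1}" "B 1 \<in> B ` {0..1}" by auto
  then have "B 0 = B 1" unfolding b by simp
  then show ?thesis using F1 g by (simp add: B_def)
qed

lemma no_realization:
  assumes n5: "n \<ge> 5" and dimT: "\<And>p. p \<in> M \<Longrightarrow> dim (range (blinfun_apply (Dif r p))) = DIM('a) + 1"
    and \<sigma>: "\<sigma> \<in> hom (motion_group n M \<phi>) (Diff_conf_group n M \<phi>)"
    and push: "\<And>c. c \<in> carrier (motion_group n M \<phi>) \<Longrightarrow> to_pi0 n M \<phi> (\<sigma> c) = push_map n M \<phi> c"
  shows False
proof -
  interpret S: C1_retract "sphere 0 1 :: 'a set" "- {0}" nrm by (rule C1_retract_sphere[OF D])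
  let ?per = "\<lambda>\<pi>. \<pi> permutes {..<n}"
  define f where "f \<pi> = \<sigma> (\<Theta> \<pi>)" for \<pi>
  have fD: "f \<pi> \<in> Diff_conf n M \<phi>" if "?per \<pi>" for \<pi>
    using \<sigma> \<Theta>_carrier[OF that] by (auto simp: f_def hom_def Diff_conf_group_def)
  have fc: "f \<pi> \<in> Diff_c M" if "?per \<pi>" for \<pi>
    using fD[OF that] Diff_id_subset by (auto simp: Diff_conf_def)
  have fM: "f \<pi> x \<in> M" if "?per \<pi>" "x \<in> M" for \<pi> x
    using fc[OF that(1)] that(2) by (auto simp: Diff_c_def Bij_def bij_betw_def)
  have fcomp: "f (\<pi> \<circ> \<rho>) x = f \<pi> (f \<rho> x)" if "?per \<pi>" "?per \<rho>" "x \<in> M" for \<pi> \<rho> x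
  proof -
    have "f (\<pi> \<circ> \<rho>) = f \<pi> \<otimes>\<^bsub>Diff_conf_group n M \<phi>\<^esub> f \<rho>"
      using hom_mult[OF \<sigma> \<Theta>_carrier[OF that(1)] \<Theta>_carrier[OF that(2)]] \<Theta>_mult[OF that(1,2)] by (simp add: f_def)
    also have "\<dots> = compose M (f \<pi>) (f \<rho>)"
      using fc[OF that(1)] fc[OF that(2)] by (simp add: Diff_conf_group_def BijGroup_def Diff_c_def)
    finally show ?thesis using that(3) by (simp add: compose_def)
  qed
  have fperm: "f \<pi> (\<phi> j x) = \<phi> (\<pi> j) x" if "?per \<pi>" "j < n" "x \<in> sphere 0 1" for \<pi> j x
    by (rule push_map_perm[OF that(1) fD[OF that(1)] _ that(2,3)]) (use push \<Theta>_carrier that(1) in \<open>simp add: f_def\<close>)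
  \<comment> \<open>f id is idempotent by multiplicativity, and injective, so it is the
    identity.\<close>
  have fid: "f id x = x" if "x \<in> M" for x
  proof -
    have "f id (f id x) = f id x" using fcomp[OF permutes_id permutes_id that] by simp
    moreover have "inj_on (f id) M" using fc[OF permutes_id] by (simp add: Diff_c_def Bij_def bij_betw_def)
    ultimately show ?thesis using fM[OF permutes_id that] that by (meson inj_onD)
  qed
  obtain b :: 'a where "b \<in> Basis" using nonempty_Basis by blast
  then have b: "b \<in> sphere 0 1" by simp
  then have b0: "b \<in> - {0}" by auto
  \<comment> \<open>Indices start at 0, so this is a point of the fifth sphere, which permutations
    of 0, 1, 2, 3 fix pointwise.\<close>
  define p where "p = \<phi> 4 b"
  have n4: "4 < n" using n5 by simp
  have pM: "p \<in> M" unfolding p_def by (rule \<phi>M[OF n4 b])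
  have pX: "p \<in> X" using pM M_sub by blast
  \<comment> \<open>Because of the composition with \<open>r\<close>, the identity permutation acts
    by the tangential projection P, and relations between permutations become relations between maps
    on the tangent space T, the range of P.\<close>
  define A where "A \<pi> = blinfun_apply (Dif (\<lambda>x. f \<pi> (r x)) p)" for \<pi>
  define P where "P = blinfun_apply (Dif r p)"
  have C1f: "C1o X (\<lambda>x. f \<pi> (r x))" if "?per \<pi>" for \<pi>
    by (rule C1o_compose_r) (use fc[OF that] in \<open>simp add: Diff_c_def\<close>)
  have fp: "f \<pi> p = p" if "?per \<pi>" "\<pi> 4 = 4" for \<pi>
    using fperm[OF that(1) n4 b] that(2) by (simp add: p_def)
  have A_comp: "A (\<pi> \<circ> \<rho>) v = A \<pi> (A \<rho> v)" if \<pi>: "?per \<pi>" and \<rho>: "?per \<rho>" "\<rho> 4 = 4" for \<pi> \<rho> v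
  proof -
    have e: "f (\<pi> \<circ> \<rho>) (r x) = f \<pi> (r (f \<rho> (r x)))" if "x \<in> X" for x
      using fcomp[OF \<pi> \<rho>(1) r_in[OF that]] r_id[OF fM[OF \<rho>(1) r_in[OF that]]] by simp
    have fr: "f \<rho> (r p) = p" using fp[OF \<rho>] r_id[OF pM] by simp
    have im: "f \<rho> (r x) \<in> X" if "x \<in> X" for x using fM[OF \<rho>(1) r_in[OF that]] M_sub by blast
    have c: "C1o X (\<lambda>x. f \<pi> (r (f \<rho> (r x))))" by (rule C1o_compose[OF C1f[OF \<rho>(1)] C1f[OF \<pi>] im])
    have "Dif (\<lambda>x. f (\<pi> \<circ> \<rho>) (r x)) p = Dif (\<lambda>x. f \<pi> (r (f \<rho> (r x)))) p"
      by (rule Dif_cong[OF open_X pX]) (use e c pX in \<open>auto simp: C1o_def\<close>)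
    also have "\<dots> = Dif (\<lambda>x. f \<pi> (r x)) p o\<^sub>L Dif (\<lambda>x. f \<rho> (r x)) p"
      using Dif_compose[OF C1f[OF \<rho>(1)] C1f[OF \<pi>] pX] im[OF pX] by (simp add: fr)
    finally show ?thesis by (simp add: A_def)
  qed
  have A_id: "A id = P"
  proof -
    have "Dif (\<lambda>x. f id (r x)) p = Dif r p"
      by (rule Dif_cong[OF open_X pX]) (use fid r_in C1_r pX in \<open>auto simp: C1o_def\<close>)
    then show ?thesis by (simp add: A_def P_def)
  qed
  have Alin: "linear (A \<pi>)" for \<pi>
    unfolding A_def by (rule bounded_linear.linear[OF blinfun.bounded_linear_right])
  have PA: "P (A \<pi> v) = A \<pi> v" and AP: "A \<pi> (P v) = A \<pi> v" if "?per \<pi>" "\<pi> 4 = 4" for \<pi> v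
    using A_comp[OF permutes_id that, of v, symmetric] A_comp[OF that(1) permutes_id id_apply, of v, symmetric]
    unfolding A_id[symmetric] id_comp comp_id .
  define T where "T = range P"
  have T: "subspace T" unfolding T_def P_def
    by (intro linear_subspace_image subspace_UNIV bounded_linear.linear[OF blinfun.bounded_linear_right])
  have AT: "A \<pi> t \<in> T" if "?per \<pi>" "\<pi> 4 = 4" for \<pi> t
    using PA[OF that, of t] unfolding T_def by (metis rangeI)
  have PT: "P t = t" if t: "t \<in> T" for t
  proof -
    obtain v where "t = P v" using t unfolding T_def by blast
    then show ?thesis using PA[OF permutes_id, of v] by (simp add: A_id)
  qed
  \<comment> \<open>The values of N are the tangent vectors of the fifth sphere at p.
    Differentiating the fact that the sphere is fixed pointwise shows that these vectors are
    fixed.\<close>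
  define N where "N = blinfun_apply (Dif (\<lambda>x. \<phi> 4 (nrm x)) b)"
  define V0 where "V0 = range N"
  have emb4: "C1_embedding (sphere 0 1) M (\<phi> 4)" using \<phi>E n4 by (simp add: Emb_def)
  then have C1\<phi>: "C1o (- {0}) (\<lambda>x. \<phi> 4 (nrm x))"
    by (intro S.C1o_compose_r) (simp add: C1_embedding_def C1_maps_def)
  have nS: "nrm x \<in> sphere 0 1" if "x \<in> - {0}" for x :: 'a using norm_nrm[of x] that by simp
  have \<phi>X: "\<phi> 4 (nrm x) \<in> X" if "x \<in> - {0}" for x using \<phi>M[OF n4 nS[OF that]] M_sub by blast
  have \<phi>b: "\<phi> 4 (nrm b) = p" by (simp add: p_def nrm_sphere[OF b])
  have opS: "open (- {0::'a})" by (simp add: open_Compl)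
  have AN: "A \<pi> (N v) = N v" if "?per \<pi>" "\<pi> 4 = 4" for \<pi> v
  proof -
    have e: "f \<pi> (r (\<phi> 4 (nrm x))) = \<phi> 4 (nrm x)" if "x \<in> - {0}" for x
      using fperm[OF \<open>?per \<pi>\<close> n4 nS[OF that]] \<open>\<pi> 4 = 4\<close> r_id[OF \<phi>M[OF n4 nS[OF that]]] by simp
    have "Dif (\<lambda>x. f \<pi> (r (\<phi> 4 (nrm x)))) b = Dif (\<lambda>x. \<phi> 4 (nrm x)) b"
      by (rule Dif_cong[OF opS b0]) (use e C1\<phi> b0 in \<open>auto simp: C1o_def\<close>)
    moreover have "Dif (\<lambda>x. f \<pi> (r (\<phi> 4 (nrm x)))) b = Dif (\<lambda>x. f \<pi> (r x)) p o\<^sub>L Dif (\<lambda>x. \<phi> 4 (nrm x)) b"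
      using Dif_compose[OF C1\<phi> C1f[OF that(1)] b0 \<phi>X[OF b0]] by (simp add: \<phi>b)
    ultimately show ?thesis unfolding A_def N_def by (metis blinfun_apply_blinfun_compose)
  qed
  have V0: "subspace V0" "V0 \<subseteq> T"
    unfolding V0_def N_def
     apply (intro linear_subspace_image subspace_UNIV bounded_linear.linear[OF blinfun.bounded_linear_right])
    using AN[OF permutes_id] AT[OF permutes_id] unfolding N_def by (metis id_apply image_subsetI)
  \<comment> \<open>A C1 left inverse of the embedding shows that the tangent space of the sphere
    keeps its full dimension k; with dim T = k + 2 this leaves at most a normal plane.\<close>
  have dimV: "dim T \<le> dim V0 + 2"
  proof -
    obtain U \<kappa> where U: "open U" "\<phi> 4 ` sphere 0 1 \<subseteq> U" "C1o U \<kappa>" "\<forall>x\<in>sphere 0 1. \<kappa> (\<phi> 4 x) = x"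
      by (rule C1_embedding_left_inverse[OF emb4])
    have \<phi>U: "\<phi> 4 (nrm x) \<in> U" if "x \<in> - {0}" for x using U(2) nS[OF that] by blast
    have "Dif (\<lambda>x. \<kappa> (\<phi> 4 (nrm x))) b = Dif nrm b"
      by (rule Dif_cong[OF opS b0]) (use U(4) nS C1o_nrm b0 in \<open>auto simp: C1o_def\<close>)
    moreover have "Dif (\<lambda>x. \<kappa> (\<phi> 4 (nrm x))) b = Dif \<kappa> p o\<^sub>L Dif (\<lambda>x. \<phi> 4 (nrm x)) b"
      using Dif_compose[OF C1\<phi> U(3) b0 \<phi>U[OF b0]] by (simp add: \<phi>b)
    ultimately have "blinfun_apply (Dif nrm b) v = blinfun_apply (Dif \<kappa> p) (N v)" for v
      unfolding N_def by (metis blinfun_apply_blinfun_compose)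
    then have "range (blinfun_apply (Dif nrm b)) = blinfun_apply (Dif \<kappa> p) ` V0"
      unfolding V0_def by (simp add: image_image)
    then have "dim (range (blinfun_apply (Dif nrm b))) \<le> dim V0"
      using dim_image_le[OF bounded_linear.linear[OF blinfun.bounded_linear_right]] by metis
    then have "DIM('a) - 1 \<le> dim V0" using dim_range_Dif_nrm(2)[of b] b by simp
    moreover have "dim T = DIM('a) + 1" unfolding T_def P_def by (rule dimT[OF pM])
    ultimately show ?thesis using D by simp
  qed
  have rigid: "f \<pi> x = x" if \<pi>: "?per \<pi>" "\<pi> 4 = 4" "\<pi> \<circ> \<pi> = id" and triv: "\<forall>t\<in>T. A \<pi> t = t" and x: "x \<in> M" for \<pi> x
  proof (rule involution_rigid[OF fc[OF \<pi>(1)] _ pM fp[OF \<pi>(1,2)] _ x])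
    show "f \<pi> (f \<pi> y) = y" if "y \<in> M" for y
      using fcomp[OF \<pi>(1,1) that] fid[OF that] \<pi>(3) by simp
    have "A \<pi> v = P v" for v
      using AP[OF \<pi>(1,2), of v] triv unfolding T_def by auto
    then show "Dif (\<lambda>x. f \<pi> (r x)) p = Dif r p"
      by (intro blinfun_eqI) (simp add: A_def P_def)
  qed
  have moved: False if \<pi>: "?per \<pi>" "\<pi> 4 = 4" "\<pi> \<circ> \<pi> = id" "\<pi> 0 \<noteq> 0" and triv: "\<forall>t\<in>T. A \<pi> t = t" for \<pi>
  proof -
    have 0: "0 < n" "\<pi> 0 < n" using n0 permutes_in_image[OF \<pi>(1), of 0] by auto
    have "\<phi> (\<pi> 0) b = \<phi> 0 b"
      using fperm[OF \<pi>(1) 0(1) b] rigid[OF \<pi>(1-3) triv \<phi>M[OF 0(1) b]] by simp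
    then show False using \<phi>_inj[OF 0(2,1) b] \<pi>(4) by simp
  qed
  \<comment> \<open>y1 is the 4-cycle 0, 2, 1, 3 and y2 the 4-cycle 0, 1, 2, 3. Their squares are (0
    1)(2 3) and (0 2)(1 3), with product (0 3)(1 2). These are the three double transpositions, and
    each of them moves 0.\<close>
  define y1 :: "nat \<Rightarrow> nat" where "y1 = id(0 := 2, 2 := 1, 1 := 3, 3 := 0)"
  define y2 :: "nat \<Rightarrow> nat" where "y2 = id(0 := 1, 1 := 2, 2 := 3, 3 := 0)"
  have y: "?per y1" "?per y2"
  proof -
    have "y1 permutes {0, 1, 2, 3}" "y2 permutes {0, 1, 2, 3}"
      by (rule bij_imp_permutes; auto simp: y1_def y2_def bij_betw_def inj_on_def)+
    moreover have "{0, 1, 2, 3} \<subseteq> {..<n}" using n5 by auto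
    ultimately show "?per y1" "?per y2" by (auto intro: permutes_subset)
  qed
  have y4: "y1 4 = 4" "y2 4 = 4" by (simp_all add: y1_def y2_def)
  define x1 where "x1 = y1 \<circ> y1"
  define x2 where "x2 = y2 \<circ> y2"
  have x: "?per x1" "?per x2" "?per (x1 \<circ> x2)" unfolding x1_def x2_def using y by (auto intro: permutes_compose)
  have x4: "x1 4 = 4" "x2 4 = 4" "(x1 \<circ> x2) 4 = 4" using y4 by (simp_all add: x1_def x2_def)
  have xx: "x1 \<circ> x1 = id" "x2 \<circ> x2 = id" "(x1 \<circ> x2) \<circ> (x1 \<circ> x2) = id"
    by (auto simp: x1_def x2_def y1_def y2_def fun_eq_iff)
  have x0: "x1 0 \<noteq> 0" "x2 0 \<noteq> 0" "(x1 \<circ> x2) 0 \<noteq> 0" by (simp_all add: x1_def x2_def y1_def y2_def)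
  have Ax1: "A x1 v = A y1 (A y1 v)" and Ax2: "A x2 v = A y2 (A y2 v)" for v
    using A_comp[OF y(1,1) y4(1)] A_comp[OF y(2,2) y4(2)] by (simp_all add: x1_def x2_def)
  have Ax12: "A (x1 \<circ> x2) v = A x1 (A x2 v)" for v by (rule A_comp[OF x(1,2) x4(2)])
  have Axx: "A x1 (A x1 t) = t" "A x2 (A x2 t) = t" "A (x1 \<circ> x2) (A (x1 \<circ> x2) t) = t" if "t \<in> T" for t
    using A_comp[OF x(1,1) x4(1), of t, symmetric] A_comp[OF x(2,2) x4(2), of t, symmetric]
      A_comp[OF x(3,3) x4(3), of t, symmetric]
    unfolding xx A_id PT[OF that] .
  have "(\<forall>t\<in>T. A y1 (A y1 t) = t) \<or> (\<forall>t\<in>T. A y2 (A y2 t) = t) \<or> (\<forall>t\<in>T. A y1 (A y1 (A y2 (A y2 t))) = t)"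
  proof (rule klein_four_dichotomy[OF Alin AT[OF y(1) y4(1)] Alin AT[OF y(2) y4(2)] T V0 dimV])
    fix t assume t: "t \<in> T"
    show "A y1 (A y1 (A y1 (A y1 t))) = t" "A y2 (A y2 (A y2 (A y2 t))) = t"
      "A y1 (A y1 (A y2 (A y2 (A y1 (A y1 (A y2 (A y2 t))))))) = t"
      using Axx[OF t] by (simp_all add: Ax1 Ax2 Ax12)
  next
    fix v assume "v \<in> V0"
    then obtain w where w: "v = N w" unfolding V0_def by blast
    show "A y1 (A y1 v) = v" "A y2 (A y2 v) = v"
      using AN[OF y(1) y4(1), of w] AN[OF y(2) y4(2), of w] by (simp_all add: w)
  qed
  then have "(\<forall>t\<in>T. A x1 t = t) \<or> (\<forall>t\<in>T. A x2 t = t) \<or> (\<forall>t\<in>T. A (x1 \<circ> x2) t = t)"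
    by (simp add: Ax1 Ax2 Ax12)
  then show False
    using moved[OF x(1) x4(1) xx(1) x0(1)] moved[OF x(2) x4(2) xx(2) x0(2)] moved[OF x(3) x4(3) xx(3) x0(3)] by blast
qed

end

theorem theorem1p4:
  fixes k n :: nat
    and M :: "'b::euclidean_space set"
    and \<phi> :: "nat \<Rightarrow> 'a::euclidean_space \<Rightarrow> 'b"
  assumes "k \<ge> 1"
    and "DIM('a) = k + 1"
    and "(M = UNIV \<and> DIM('b) = k + 2 \<and> n \<ge> 5) \<or> (M = sphere 0 1 \<and> DIM('b) = k + 3 \<and> n \<ge> 6)"
    and "unlinked n M \<phi>"
  shows "\<not> (\<exists>\<sigma> \<in> hom (motion_group n M \<phi>) (Diff_conf_group n M \<phi>).
            \<forall>c \<in> carrier (motion_group n M \<phi>). to_pi0 n M \<phi> (\<sigma> c) = push_map n M \<phi> c)"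
proof -
  have D: "DIM('a) \<ge> 2" and n: "n \<ge> 5" using assms(1,2,3) by auto
  have "\<exists>X r. C1_retract M X r \<and> (\<forall>p\<in>M. dim (range (blinfun_apply (Dif r p))) = DIM('a) + 1) \<and>
      (\<forall>F. finite F \<longrightarrow> F \<subseteq> M \<longrightarrow> (\<exists>Q C Ci V. chart M Q C Ci V \<and> dim (range Q) = DIM('a) + 1 \<and>
        F \<subseteq> V \<and> (\<forall>y\<in>M \<inter> V. Ci y \<in> range Q \<and> C (Ci y) = y)))"
    using assms(3)
  proof
    assume *: "M = UNIV \<and> DIM('b) = k + 2 \<and> n \<ge> 5"
    then have M: "M = UNIV" and d: "DIM('b) = DIM('a) + 1" using assms(2) by auto
    show ?thesis
    proof (rule exI[of _ UNIV], rule exI[of _ "\<lambda>x. x"], intro conjI ballI allI impI)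
      show "C1_retract M UNIV (\<lambda>x. x)" unfolding M by (rule C1_retract_UNIV)
      show "dim (range (blinfun_apply (Dif (\<lambda>x. x) p))) = DIM('a) + 1" for p :: 'b using d by simp
      show "\<exists>Q C Ci V. chart M Q C Ci V \<and> dim (range Q) = DIM('a) + 1 \<and> F \<subseteq> V \<and> (\<forall>y\<in>M \<inter> V. Ci y \<in> range Q \<and> C (Ci y) = y)" for F
        unfolding M
        by (rule exI[of _ "\<lambda>x. x"], rule exI[of _ "\<lambda>x. x"], rule exI[of _ "\<lambda>x. x"], rule exI[of _ UNIV])
          (simp add: chart_UNIV d)
    qed
  next
    assume *: "M = sphere 0 1 \<and> DIM('b) = k + 3 \<and> n \<ge> 6"
    then have M: "M = sphere 0 1" and d: "DIM('b) - 1 = DIM('a) + 1" "DIM('b) \<ge> 2" using assms(1,2) by auto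
    show ?thesis
    proof (rule exI[of _ "- {0}"], rule exI[of _ nrm], intro conjI ballI allI impI)
      show "C1_retract M (- {0}) nrm" unfolding M by (rule C1_retract_sphere[OF d(2)])
      show "dim (range (blinfun_apply (Dif nrm p))) = DIM('a) + 1" if "p \<in> M" for p
        using dim_range_Dif_nrm(2)[of p] that d by (simp add: M)
      fix F :: "'b set" assume F: "finite F" "F \<subseteq> M"
      \<comment> \<open>A finite connected set has at most one point, but b and -b are two.\<close>
      have "infinite (sphere (0::'b) 1)"
      proof
        assume "finite (sphere (0::'b) 1)"
        moreover have "connected (sphere (0::'b) 1)" using d(2) by (rule connected_sphere)
        ultimately have "sphere (0::'b) 1 = {} \<or> (\<exists>x. sphere (0::'b) 1 = {x})"
          using connected_finite_iff_sing by blast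
        moreover obtain b :: 'b where "b \<in> Basis" using nonempty_Basis by blast
        then have "b \<in> sphere 0 1" "- b \<in> sphere 0 1" "b \<noteq> - b" by (auto simp: eq_neg_iff_add_eq_0 simp flip: scaleR_2)
        ultimately show False by (metis empty_iff singletonD)
      qed
      \<comment> \<open>Stereographic projection from a pole outside F puts all of F, later the set
        of centres of the disks, into a single chart.\<close>
      then obtain e where e: "e \<in> sphere 0 1" "e \<notin> F" using F(1) by (meson finite_subset subsetI)
      let ?Q = "\<lambda>v. v - (e \<bullet> v) *\<^sub>R e"
      let ?Ci = "\<lambda>y. inverse (1 - e \<bullet> y) *\<^sub>R (y - (e \<bullet> y) *\<^sub>R e)"
      have ne: "norm e = 1" using e by simp
      have eF: "e \<bullet> y \<noteq> 1" if "y \<in> F" for y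
      proof
        assume "e \<bullet> y = 1"
        moreover have "norm y = 1" using F(2) that by (auto simp: M)
        ultimately have "e = y" using ne norm_cauchy_schwarz_eq[of e y] by simp
        then show False using e that by simp
      qed
      show "\<exists>Q C Ci V. chart M Q C Ci V \<and> dim (range Q) = DIM('a) + 1 \<and> F \<subseteq> V \<and> (\<forall>y\<in>M \<inter> V. Ci y \<in> range Q \<and> C (Ci y) = y)"
      proof (rule exI[of _ ?Q], rule exI[of _ "\<lambda>v. stereo e (?Q v)"], rule exI[of _ ?Ci],
          rule exI[of _ "{y. e \<bullet> y \<noteq> 1}"], intro conjI ballI)
        show "chart M ?Q (\<lambda>v. stereo e (?Q v)) ?Ci {y. e \<bullet> y \<noteq> 1}" unfolding M by (rule chart_sphere(1)[OF ne])
        show "dim (range ?Q) = DIM('a) + 1" using chart_sphere(3)[OF ne] d by simp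
        show "F \<subseteq> {y. e \<bullet> y \<noteq> 1}" using eF by auto
        show "?Ci y \<in> range ?Q" "stereo e (?Q (?Ci y)) = y" if "y \<in> M \<inter> {y. e \<bullet> y \<noteq> 1}" for y
          using chart_sphere(2)[OF ne, of y] that by (simp_all add: M)
      qed
    qed
  qed
  then obtain X r where ret: "C1_retract M X r" and dimT: "\<forall>p\<in>M. dim (range (blinfun_apply (Dif r p))) = DIM('a) + 1"
    and charts: "\<forall>F. finite F \<longrightarrow> F \<subseteq> M \<longrightarrow> (\<exists>Q C Ci V. chart M Q C Ci V \<and> dim (range Q) = DIM('a) + 1 \<and>
        F \<subseteq> V \<and> (\<forall>y\<in>M \<inter> V. Ci y \<in> range Q \<and> C (Ci y) = y))"
    by (elim exE conjE)
  interpret R: C1_retract M X r by (rule ret)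
  have n0: "n > 0" using n by simp
  obtain Q C Ci V and K :: "'a \<Rightarrow>\<^sub>L 'b" and e1 e2 e3 where st: "chart M Q C Ci V"
    "range (blinfun_apply K) \<subseteq> range Q" "inj (blinfun_apply K)" "norm K < 1/2"
    "\<forall>i<n. \<forall>x\<in>sphere 0 1. \<phi> i x = C (real i *\<^sub>R e1 + blinfun_apply K x)"
    "e1 \<in> range Q" "e2 \<in> range Q" "e3 \<in> range Q" "norm e1 = 1" "norm e2 = 1" "norm e3 = 1"
    "e1 \<bullet> e2 = 0" "e1 \<bullet> e3 = 0" "e2 \<bullet> e3 = 0"
    by (rule R.unlinked_standard_position[OF assms(4) n0 charts[rule_format] D])
  have \<phi>E: "\<phi> \<in> Emb n (sphere 0 1) M" using assms(4) by (simp add: unlinked_def)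
  interpret standard_config M X r Q C Ci V K e1 e2 e3 n \<phi>
    by unfold_locales (fact st \<phi>E D n0)+
  show ?thesis using no_realization[OF n] dimT by blast
qed

end
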